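(* Let $f,g$ satisfy $(H_1)$, $(H_2)$, $(H_3)$ and let $K$ be a kernel as in the context. Suppose that for any $c\in\mathbb{R}$ there exists some $\gamma^\#=\gamma^\#(c)\in(0,+\infty]$ such that $\chi_0(z,c)<\infty$ for each $z\in[0,\gamma^\#)$ and $\chi_0(z,c)$ diverges if $z>\gamma^\#$. Suppose that, for some $L>0$, $|g(s_1)-g(s_2)|\le L|s_1-s_2|$ for all $s_1,s_2\ge 0$, and let $\chi_L$ and $c_\star$ be defined with this $L$. Then the equation $$u_t(t,x)=u_{xx}(t,x)-f(u(t,x))+\int_0^\infty\int_{\mathbb{R}}K(s,w)g(u(t-s,x-w))\,dw\,ds$$ has at most one (modulo translation) semi-wavefront solution $u(t,x)=\phi(x+ct)$ with speed $c$: (a) for each $c>c_\star$, if $\chi_L(\gamma^\#(c_\star)-,c_\star)=0$; (b) for each $c\ge c_\star$, if $\chi_L(\gamma^\#(c_\star)-,c_\star)\ne 0$. Here $\chi_L(\gamma^\#(c_\star)-,c_\star)=\lim_{z\uparrow\gamma^\#(c_\star)}\chi_L(z,c_\star)$.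
   Context: Kernel: $K\in L^1(\mathbb{R}_+\times\mathbb{R})$, $K\ge0$, $\int_0^\infty\int_{\mathbb{R}}K(s,w)\,dw\,ds=1$ ($K$ may be asymmetric in $w$). Hypotheses: $(H_1)$ $g\in C(\mathbb{R}_+,\mathbb{R}_+)$, $g(0)=0$, $g(s)>0$ for all $s>0$, $g$ is differentiable at $0$ with $g'(0)>0$. $(H_2)$ $f\in C^1(\mathbb{R}_+,\mathbb{R}_+)$, $f(0)=0$, $f$ is strictly increasing, and $f'(0)<g'(0)$. $(H_3)$ $f,g\in C^{1,\alpha}$ in some neighborhood of $0$ (in $\mathbb{R}_+$), for some $\alpha\in(0,1)$. A semi-wavefront with speed $c$ is a solution $u(t,x)=\phi(x+ct)$ whose profile $\phi:\mathbb{R}\to(0,\infty)$ is bounded, continuous, non-constant and satisfies $\phi(-\infty)=0$; equivalently, $\phi$ is a positive bounded non-constant solution on $\mathbb{R}$ of $\phi''(t)-c\phi'(t)-f(\phi(t))+\int_0^\infty\int_{\mathbb{R}}K(s,w)g(\phi(t-cs-w))\,dw\,ds=0$ with $\phi(-\infty)=0$. "At most one modulo translation" means that any two profiles $\phi_1,\phi_2$ with the same speed $c$ satisfy $\phi_1(t)=\phi_2(t+t_0)$ for all $t$, for some $t_0\in\mathbb{R}$. Characteristic functions (for real $z\ge 0$, $c\in\mathbb{R}$): $$\chi_0(z,c)=z^2-cz-f'(0)+g'(0)\int_0^\infty\int_{\mathbb{R}}K(s,w)e^{-z(cs+w)}\,dw\,ds,$$ $$\chi_L(z,c)=z^2-cz-\inf_{s\ge0}f'(s)+L\int_0^\infty\int_{\mathbb{R}}K(s,w)e^{-z(cs+w)}\,dw\,ds,\qquad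 L\ge g'(0).$$ $c_\star$ is the minimal value of $c$ for which $\chi_L(\cdot,c)$ has at least one positive root. *)

theory Defs
  imports "HOL-Analysis.Analysis"
begin

text \<open>Functions on the half-line \<open>[0, \<infinity>)\<close> are total functions on the reals whose values at
  negative arguments are never constrained or used; their derivatives are taken within the
  half-line, hence one-sided at \<open>0\<close>.\<close>

definition hderiv :: "(real \<Rightarrow> real) \<Rightarrow> real \<Rightarrow> real" where
  "hderiv h s = vector_derivative h (at s within {0..})"

text \<open>Non-negativity is required almost everywhere because an element of \<open>L\<^sup>1\<close> is a class of
  functions.\<close>

definition normalized_kernel :: "(real \<Rightarrow> real \<Rightarrow> real) \<Rightarrow> bool" where
  "normalized_kernel K \<longleftrightarrow>
     set_integrable lborel ({0..} \<times> UNIV) (\<lambda>(s, w). K s w) \<and>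
     (AE (s, w) in lborel. 0 \<le> s \<longrightarrow> 0 \<le> K s w) \<and>
     (LBINT s:{0..}. (LBINT w. K s w)) = 1"

definition H1 :: "(real \<Rightarrow> real) \<Rightarrow> bool" where
  "H1 g \<longleftrightarrow>
     continuous_on {0..} g \<and> (\<forall>s\<ge>0. 0 \<le> g s) \<and> g 0 = 0 \<and> (\<forall>s>0. 0 < g s) \<and>
     g differentiable (at 0 within {0..}) \<and> 0 < hderiv g 0"

definition H2 :: "(real \<Rightarrow> real) \<Rightarrow> (real \<Rightarrow> real) \<Rightarrow> bool" where
  "H2 f g \<longleftrightarrow>
     f differentiable_on {0..} \<and> continuous_on {0..} (hderiv f) \<and> (\<forall>s\<ge>0. 0 \<le> f s) \<and>
     f 0 = 0 \<and> strict_mono_on {0..} f \<and> hderiv f 0 < hderiv g 0"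

definition C1_holder_on :: "real \<Rightarrow> real set \<Rightarrow> (real \<Rightarrow> real) \<Rightarrow> bool" where
  "C1_holder_on \<alpha> S h \<longleftrightarrow>
     (\<exists>h' C. (\<forall>x\<in>S. (h has_real_derivative h' x) (at x within S)) \<and>
             (\<forall>x\<in>S. \<forall>y\<in>S. \<bar>h' x - h' y\<bar> \<le> C * \<bar>x - y\<bar> powr \<alpha>))"

definition H3 :: "(real \<Rightarrow> real) \<Rightarrow> (real \<Rightarrow> real) \<Rightarrow> bool" where
  "H3 f g \<longleftrightarrow>
     (\<exists>\<alpha> \<delta>. 0 < \<alpha> \<and> \<alpha> < 1 \<and> 0 < \<delta> \<and>
        C1_holder_on \<alpha> {0..<\<delta>} f \<and> C1_holder_on \<alpha> {0..<\<delta>} g)"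

definition solves_equation ::
  "(real \<Rightarrow> real \<Rightarrow> real) \<Rightarrow> (real \<Rightarrow> real) \<Rightarrow> (real \<Rightarrow> real) \<Rightarrow> (real \<Rightarrow> real \<Rightarrow> real) \<Rightarrow> bool" where
  "solves_equation K f g u \<longleftrightarrow>
     (\<exists>u_t u_x u_xx. \<forall>t x.
        ((\<lambda>\<tau>. u \<tau> x) has_real_derivative u_t t x) (at t) \<and>
        ((\<lambda>y. u t y) has_real_derivative u_x t x) (at x) \<and>
        ((\<lambda>y. u_x t y) has_real_derivative u_xx t x) (at x) \<and>
        u_t t x = u_xx t x - f (u t x)
          + (LBINT s:{0..}. (LBINT w. K s w * g (u (t - s) (x - w)))))"

definition semi_wavefront_profile ::
  "(real \<Rightarrow> real \<Rightarrow> real) \<Rightarrow> (real \<Rightarrow> real) \<Rightarrow> (real \<Rightarrow> real) \<Rightarrow> real \<Rightarrow> (real \<Rightarrow> real) \<Rightarrow> bool" where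
  "semi_wavefront_profile K f g c \<phi> \<longleftrightarrow>
     (\<forall>t. 0 < \<phi> t) \<and> bounded (range \<phi>) \<and> continuous_on UNIV \<phi> \<and>
     \<not> \<phi> constant_on UNIV \<and> (\<phi> \<longlongrightarrow> 0) at_bot \<and>
     solves_equation K f g (\<lambda>t x. \<phi> (x + c * t))"

definition at_most_one_semi_wavefront ::
  "(real \<Rightarrow> real \<Rightarrow> real) \<Rightarrow> (real \<Rightarrow> real) \<Rightarrow> (real \<Rightarrow> real) \<Rightarrow> real \<Rightarrow> bool" where
  "at_most_one_semi_wavefront K f g c \<longleftrightarrow>
     (\<forall>\<phi>\<^sub>1 \<phi>\<^sub>2. semi_wavefront_profile K f g c \<phi>\<^sub>1 \<longrightarrow> semi_wavefront_profile K f g c \<phi>\<^sub>2 \<longrightarrow>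
        (\<exists>t\<^sub>0. \<forall>t. \<phi>\<^sub>1 t = \<phi>\<^sub>2 (t + t\<^sub>0)))"

text \<open>The characteristic functions take the value \<open>\<infinity>\<close> exactly where the integral of the
  (non-negative) integrand diverges; in particular a zero is always a point of convergence.\<close>

definition K_transform :: "(real \<Rightarrow> real \<Rightarrow> real) \<Rightarrow> real \<Rightarrow> real \<Rightarrow> ennreal" where
  "K_transform K z c =
     (\<integral>\<^sup>+s\<in>{0..}. (\<integral>\<^sup>+w. ennreal (K s w * exp (- z * (c * s + w))) \<partial>lborel) \<partial>lborel)"

definition chi_0 ::
  "(real \<Rightarrow> real \<Rightarrow> real) \<Rightarrow> (real \<Rightarrow> real) \<Rightarrow> (real \<Rightarrow> real) \<Rightarrow> real \<Rightarrow> real \<Rightarrow> ereal" where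
  "chi_0 K f g z c =
     ereal (z\<^sup>2 - c * z - hderiv f 0) + ereal (hderiv g 0) * enn2ereal (K_transform K z c)"

definition chi_L ::
  "(real \<Rightarrow> real \<Rightarrow> real) \<Rightarrow> (real \<Rightarrow> real) \<Rightarrow> real \<Rightarrow> real \<Rightarrow> real \<Rightarrow> ereal" where
  "chi_L K f L z c =
     ereal (z\<^sup>2 - c * z - (INF s\<in>{0..}. hderiv f s)) + ereal L * enn2ereal (K_transform K z c)"

definition c_star :: "(real \<Rightarrow> real \<Rightarrow> real) \<Rightarrow> (real \<Rightarrow> real) \<Rightarrow> real \<Rightarrow> real" where
  "c_star K f L = (LEAST c. \<exists>z>0. chi_L K f L z c = 0)"

text \<open>The abscissa \<open>\<gamma>\<close> may be \<open>\<infinity>\<close>, in which case the limit is the one for \<open>z \<rightarrow> \<infinity>\<close>; the limit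
  itself is an extended real.\<close>

definition chi_L_left ::
  "(real \<Rightarrow> real \<Rightarrow> real) \<Rightarrow> (real \<Rightarrow> real) \<Rightarrow> real \<Rightarrow> ereal \<Rightarrow> real \<Rightarrow> ereal" where
  "chi_L_left K f L \<gamma> c = Lim (at_left \<gamma>) (\<lambda>z. chi_L K f L (real_of_ereal z) c)"

end

theory Submission
  imports Defs "HOL-Real_Asymp.Real_Asymp"
begin

text \<open>Pushing the kernel forward under \<open>(s, w) \<mapsto> c s + w\<close> turns the profile equation into
  \<open>\<phi>'' - c \<phi>' - f \<phi> + \<integral> g (\<phi> (t - v)) d\<nu>(v) = 0\<close> with a probability measure \<open>\<nu>\<close> on the line.
  If two solutions differ by \<open>o(exp (z t))\<close> at \<open>-\<infinity>\<close> and \<open>chi_L z \<le> 0\<close>, the maximum principle applied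
  to \<open>\<bar>\<phi> - \<psi>\<bar> exp (- z t)\<close> makes them equal, so everything rests on the asymptotics at \<open>-\<infinity>\<close>.

  Let \<open>l\<close> be the first zero of \<open>chi_0\<close> and \<open>p = \<phi> exp (- l t)\<close>. A comparison with
  \<open>exp (x t) - exp (l t)\<close> gives \<open>\<phi> = O(exp (x t))\<close> for every \<open>x < l\<close>, so the nonlinear remainder is
  \<open>O(exp ((l + \<epsilon>) t))\<close>. After integrating the equation of \<open>p\<close> twice and multiplying by \<open>p\<close> minus the
  expected limit profile, an energy estimate yields \<open>p \<longrightarrow> A\<close> if \<open>l\<close> is a simple zero and \<open>p \<sim> A \<bar>t\<bar>\<close>
  if it is a double one. Comparing with the solution \<open>0\<close> shows \<open>A > 0\<close>, and a translation makes the
  constants of two profiles agree. In the simple case the difference is then \<open>o(exp (l t))\<close> and bootstraps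
  to \<open>O(exp (z t))\<close>. In the double case it is only \<open>o(\<bar>t\<bar> exp (l t))\<close>, and a barrier that
  grows like \<open>\<bar>t\<bar> exp (l t)\<close> replaces the bootstrap.\<close>

section \<open>Calculus on the line\<close>

text \<open>Since \<open>g\<close> need not be monotone, two solutions can be compared only through
  |\<phi> - \<psi>| and the Lipschitz constant. The maximum principle therefore sees
  \<open>chi_L\<close>, whereas the behaviour at -infinity is governed by the smaller function
  \<open>chi_0\<close>. The gap between the zero l of \<open>chi_0\<close> and a point z with
  \<open>chi_L z \<le> 0\<close> can be bridged because strict convexity makes \<open>chi_0\<close>
  negative in between; a double zero matters only when the two functions coincide. Neither the
  kernel is symmetric nor a profile monotone, so a limit of p has to come from elsewhere. In the
  energy estimate the convolution contributes an exact derivative and a nonnegative square whatever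
  its asymmetry, and the local term has the right sign because the slope of \<open>chi_0\<close> at
  its first zero is nonpositive. The energy controls integrals only; a Harnack inequality, available
  because profiles are positive, makes the result pointwise. All of this needs convergence of the
  transform slightly beyond z. Above the minimal speed z can be moved to the left to gain this room;
  at the minimal speed it is there unless the root sits at the abscissa of convergence, whence the
  two cases.\<close>

lemma local_max_derivs:
  fixes u :: "real \<Rightarrow> real"
  assumes d: "0 < d" and der: "\<And>t. \<bar>t - t0\<bar> < d \<Longrightarrow> (u has_real_derivative u1 t) (at t)"
    and der2: "(u1 has_real_derivative u2) (at t0)"
    and le: "\<And>t. \<bar>t - t0\<bar> < d \<Longrightarrow> u t \<le> u t0"
  shows "u1 t0 = 0" and "u2 \<le> 0"
proof -
  show 0: "u1 t0 = 0"
    by (rule DERIV_local_max[OF der[of t0] d]) (use d le in \<open>auto simp: abs_minus_commute\<close>)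
  show "u2 \<le> 0"
  proof (rule ccontr)
    assume "\<not> u2 \<le> 0"
    then obtain e where e: "0 < e" "\<And>h. 0 < h \<Longrightarrow> h < e \<Longrightarrow> u1 t0 < u1 (t0 + h)"
      using DERIV_pos_inc_right[OF der2] by force
    define h where "h = min d e / 2"
    have h: "0 < h" "h < d" "h < e" using d e(1) by (auto simp: h_def)
    have "u t0 < u (t0 + h)"
    proof (rule DERIV_pos_imp_increasing_open[of t0 "t0 + h"])
      show "t0 < t0 + h" using h by simp
      show "\<exists>y. DERIV u x :> y \<and> 0 < y" if "t0 < x" "x < t0 + h" for x
        using der[of x] e(2)[of "x - t0"] 0 that h by (intro exI[of _ "u1 x"]) auto
      show "continuous_on {t0..t0 + h} u"
        using h by (intro continuous_at_imp_continuous_on ballI DERIV_isCont[OF der]) auto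
    qed
    with le[of "t0 + h"] h show False by auto
  qed
qed

text \<open>Beyond some compact interval \<open>u\<close> stays below the value \<open>u t1\<close>,
  so a maximum over that interval is global. The conditions at the ends are implications, which lets
  one of them hold vacuously when \<open>S\<close> is a half-line.\<close>

lemma attains_max_on_closed:
  fixes u :: "real \<Rightarrow> real"
  assumes S: "closed S" and cont: "continuous_on S u" and t1: "t1 \<in> S" "0 < u t1"
    and bot: "\<forall>\<^sub>F t in at_bot. t \<in> S \<longrightarrow> u t < u t1"
    and top: "\<forall>\<^sub>F t in at_top. t \<in> S \<longrightarrow> u t < u t1"
  obtains t0 where "t0 \<in> S" "\<And>t. t \<in> S \<Longrightarrow> u t \<le> u t0"
proof -
  obtain A where A: "\<And>t. t \<le> A \<Longrightarrow> t \<in> S \<Longrightarrow> u t < u t1"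
    using bot by (auto simp: eventually_at_bot_linorder)
  obtain B where B: "\<And>t. t \<ge> B \<Longrightarrow> t \<in> S \<Longrightarrow> u t < u t1"
    using top by (auto simp: eventually_at_top_linorder)
  have t1': "A < t1" "t1 < B" using A[of t1] B[of t1] t1 by (force simp: not_le[symmetric])+
  have "compact (S \<inter> {A..B})" using S by (simp add: closed_Int_compact)
  moreover have "S \<inter> {A..B} \<noteq> {}" using t1 t1' by auto
  moreover have "continuous_on (S \<inter> {A..B}) u" using cont by (rule continuous_on_subset) auto
  ultimately obtain t0 where t0: "t0 \<in> S \<inter> {A..B}" "\<And>t. t \<in> S \<inter> {A..B} \<Longrightarrow> u t \<le> u t0"
    by (metis continuous_attains_sup)
  have "u t \<le> u t0" if "t \<in> S" for t
  proof (cases "t \<in> {A..B}")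
    case False
    then have "u t < u t1" using A B that by (meson atLeastAtMost_iff linear)
    also have "u t1 \<le> u t0" using t0(2)[of t1] t1 t1' by auto
    finally show ?thesis by simp
  qed (use t0 that in auto)
  with t0 that show ?thesis by auto
qed

lemma continuous_antiderivative:
  fixes f :: "real \<Rightarrow> real"
  assumes "continuous_on UNIV f"
  obtains F where "\<And>t. (F has_real_derivative f t) (at t)" "F 0 = 0"
proof -
  obtain F where F: "\<And>t. (F has_real_derivative f t) (at t)"
    using einterval_antiderivative[of "-\<infinity>" "\<infinity>" f] assms
    by (auto simp: has_real_derivative_iff_has_vector_derivative continuous_on_eq_continuous_at)
  have "((\<lambda>t. F t - F 0) has_real_derivative f t) (at t)" for t
    using F[of t] by (auto intro!: derivative_eq_intros)
  from that[OF this] show ?thesis by simp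
qed

lemma mean_value_bound:
  fixes u :: "real \<Rightarrow> real"
  assumes "\<And>t. t \<in> closed_segment s r \<Longrightarrow> (u has_real_derivative u' t) (at t)"
    and "\<And>t. t \<in> closed_segment s r \<Longrightarrow> \<bar>u' t\<bar> \<le> B"
  shows "\<bar>u r - u s\<bar> \<le> B * \<bar>r - s\<bar>"
  using field_differentiable_bound[of "closed_segment s r" u u' B r s] assms
  by (auto intro: has_field_derivative_at_within)

text \<open>Adding or subtracting the primitive \<open>e\<close> of the bound makes \<open>y\<close>
  monotone. The supremum of y - e is the limit at -infinity and lies between y - e and y + e, which
  gives existence and rate at once.\<close>

lemma limit_at_minus_infinity_of_derivative_bound:
  fixes y :: "real \<Rightarrow> real"
  assumes k: "0 < k" and der: "\<And>t. t \<le> 0 \<Longrightarrow> (y has_real_derivative y' t) (at t)"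
    and bd: "\<And>t. t \<le> 0 \<Longrightarrow> \<bar>y' t\<bar> \<le> C * exp (k * t)"
  obtains l where "\<And>t. t \<le> 0 \<Longrightarrow> \<bar>y t - l\<bar> \<le> C / k * exp (k * t)"
proof -
  define e where "e t = C / k * exp (k * t)" for t
  have de: "(e has_real_derivative C * exp (k * t)) (at t)" for t
    unfolding e_def using k by (auto intro!: derivative_eq_intros)
  have inc: "y s + e s \<le> y t + e t" if "s \<le> t" "t \<le> 0" for s t
  proof (rule DERIV_nonneg_imp_nondecreasing[OF that(1)])
    fix x assume "s \<le> x" "x \<le> t"
    then show "\<exists>z. ((\<lambda>x. y x + e x) has_real_derivative z) (at x) \<and> 0 \<le> z"
      using that bd[of x] DERIV_add[OF der[of x] de[of x]]
      by (intro exI[of _ "y' x + C * exp (k * x)"]) (auto simp: abs_le_iff)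
  qed
  have dec: "y t - e t \<le> y s - e s" if "s \<le> t" "t \<le> 0" for s t
  proof (rule DERIV_nonpos_imp_nonincreasing[OF that(1)])
    fix x assume "s \<le> x" "x \<le> t"
    then show "\<exists>z. ((\<lambda>x. y x - e x) has_real_derivative z) (at x) \<and> z \<le> 0"
      using that bd[of x] DERIV_diff[OF der[of x] de[of x]]
      by (intro exI[of _ "y' x - C * exp (k * x)"]) (auto simp: abs_le_iff)
  qed
  have C: "0 \<le> C" using bd[of 0] by auto
  have e0: "0 \<le> e t" for t using C k by (auto simp: e_def)
  define l where "l = (SUP t\<in>{..0}. y t - e t)"
  have ub: "y s - e s \<le> y t + e t" if "s \<le> 0" "t \<le> 0" for s t
  proof (cases "s \<le> t")
    case True
    then have "y s + e s \<le> y t + e t" using inc that by auto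
    with e0[of s] show ?thesis by simp
  next
    case False
    then have "y s - e s \<le> y t - e t" using dec that by auto
    with e0[of t] show ?thesis by simp
  qed
  have bdd: "bdd_above ((\<lambda>t. y t - e t) ` {..0})"
    using ub[of _ 0] by (auto intro!: bdd_aboveI)
  have "\<bar>y t - l\<bar> \<le> e t" if "t \<le> 0" for t
  proof -
    have "y t - e t \<le> l" unfolding l_def using that by (intro cSUP_upper bdd) auto
    moreover have "l \<le> y t + e t" unfolding l_def using that ub by (intro cSUP_least) auto
    ultimately show ?thesis by auto
  qed
  with that show ?thesis by (auto simp: e_def)
qed

text \<open>Energies are expressed through primitives: here and below \<open>S\<close> is a primitive of \<open>- h\<^sup>2\<close>, so \<open>S s - S a\<close> is the energy on \<open>[s, a]\<close>.\<close>

lemma cauchy_schwarz_antiderivative: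
  fixes f h S :: "real \<Rightarrow> real"
  assumes "s < a" and f: "\<And>t. (f has_real_derivative h t) (at t)"
    and S: "\<And>t. (S has_real_derivative - (h t)\<^sup>2) (at t)"
  shows "(f a - f s)\<^sup>2 \<le> (a - s) * (S s - S a)"
proof -
  \<comment> \<open>The mean value of \<open>h\<close> on [s, a]: the constant for which integrating
    (h - n)^2 \<ge> 0 gives the sharpest inequality.\<close>
  define n where "n = (f a - f s) / (a - s)"
  let ?y = "\<lambda>t. - S t - 2 * n * f t + n\<^sup>2 * t"
  have "?y s \<le> ?y a"
  proof (rule DERIV_nonneg_imp_nondecreasing[where f = ?y])
    fix x
    have "(?y has_real_derivative (h x)\<^sup>2 - 2 * n * h x + n\<^sup>2) (at x)"
      by (auto intro!: derivative_eq_intros f S)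
    moreover have "(h x)\<^sup>2 - 2 * n * h x + n\<^sup>2 = (h x - n)\<^sup>2" by (simp add: power2_eq_square algebra_simps)
    ultimately show "\<exists>z. (?y has_real_derivative z) (at x) \<and> 0 \<le> z" by auto
  qed (use assms in auto)
  then have "2 * n * (f a - f s) - n\<^sup>2 * (a - s) \<le> S s - S a" by (simp add: algebra_simps)
  then have "(a - s) * (2 * n * (f a - f s) - n\<^sup>2 * (a - s)) \<le> (a - s) * (S s - S a)"
    using assms(1) by (intro mult_left_mono) auto
  moreover have eq: "f a - f s = n * (a - s)" using assms(1) by (simp add: n_def)
  have "(a - s) * (2 * n * (f a - f s) - n\<^sup>2 * (a - s)) = (f a - f s)\<^sup>2"
    unfolding eq by (simp add: power2_eq_square algebra_simps)
  ultimately show ?thesis by simp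
qed

lemma abs_le_exp:
  fixes e v :: real assumes "0 < e" shows "\<bar>v\<bar> \<le> exp (e * \<bar>v\<bar>) / e"
proof -
  have "e * \<bar>v\<bar> \<le> exp (e * \<bar>v\<bar>)" using exp_ge_add_one_self[of "e * \<bar>v\<bar>"] by linarith
  then show ?thesis using assms by (simp add: field_simps)
qed

text \<open>Dominated convergence works along sequences, so the difference quotients are taken along
  an arbitrary null sequence. The mean value theorem bounds them by \<open>w\<close> once the
  sequence has entered the \<open>d\<close>-neighbourhood, which the shift by \<open>N\<close>
  ensures.\<close>

lemma DERIV_integral:
  fixes u :: "real \<Rightarrow> 'a \<Rightarrow> real"
  assumes d: "0 < d"
    and int: "\<And>t. \<bar>t - t0\<bar> < d \<Longrightarrow> integrable M (u t)"
    and der: "\<And>v t. v \<in> space M \<Longrightarrow> \<bar>t - t0\<bar> < d \<Longrightarrow> ((\<lambda>t. u t v) has_real_derivative u' t v) (at t)"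
    and bd: "\<And>v t. v \<in> space M \<Longrightarrow> \<bar>t - t0\<bar> < d \<Longrightarrow> \<bar>u' t v\<bar> \<le> w v"
    and w: "integrable M w"
    and meas: "u' t0 \<in> borel_measurable M"
  shows "((\<lambda>t. \<integral>v. u t v \<partial>M) has_real_derivative (\<integral>v. u' t0 v \<partial>M)) (at t0)"
proof -
  have t0: "\<bar>t0 - t0\<bar> < d" using d by simp
  let ?q = "\<lambda>h v. (u (t0 + h) v - u t0 v) / h"
  have "((\<lambda>h. \<integral>v. ?q h v \<partial>M) \<longlongrightarrow> (\<integral>v. u' t0 v \<partial>M)) (at 0)"
  proof (subst tendsto_at_iff_sequentially, intro allI impI)
    fix X :: "nat \<Rightarrow> real" assume X: "\<forall>i. X i \<in> UNIV - {0}" "X \<longlonglongrightarrow> 0"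
    have "\<forall>\<^sub>F i in sequentially. \<bar>X i\<bar> < d"
      using X(2) d by (auto simp: tendsto_iff dist_real_def)
    then obtain N where N: "\<And>i. i \<ge> N \<Longrightarrow> \<bar>X i\<bar> < d" by (auto simp: eventually_sequentially)
    have "(\<lambda>i. \<integral>v. ?q (X (i + N)) v \<partial>M) \<longlonglongrightarrow> (\<integral>v. u' t0 v \<partial>M)"
    proof (rule integral_dominated_convergence[OF meas _ w])
      fix i
      have Xi: "\<bar>X (i + N)\<bar> < d" "X (i + N) \<noteq> 0" using N[of "i + N"] X(1) by auto
      have "u (t0 + X (i + N)) \<in> borel_measurable M" "u t0 \<in> borel_measurable M"
        using Xi t0 int by auto
      then show "(\<lambda>v. ?q (X (i + N)) v) \<in> borel_measurable M" by measurable
      show "AE v in M. norm (?q (X (i + N)) v) \<le> w v"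
      proof (rule AE_I2)
        fix v assume v: "v \<in> space M"
        have seg: "\<bar>t - t0\<bar> < d" if "t \<in> closed_segment t0 (t0 + X (i + N))" for t
          using that Xi by (auto simp: closed_segment_eq_real_ivl split: if_splits)
        have "\<bar>u (t0 + X (i + N)) v - u t0 v\<bar> \<le> w v * \<bar>t0 + X (i + N) - t0\<bar>"
          using seg der[OF v] bd[OF v] by (intro mean_value_bound[where u' = "\<lambda>t. u' t v"]) auto
        with Xi show "norm (?q (X (i + N)) v) \<le> w v" by (simp add: field_simps)
      qed
    next
      show "AE v in M. (\<lambda>i. ?q (X (i + N)) v) \<longlonglongrightarrow> u' t0 v"
      proof (rule AE_I2)
        fix v assume v: "v \<in> space M"
        have "((\<lambda>h. ?q h v) \<longlongrightarrow> u' t0 v) (at 0)"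
          using der[OF v t0] by (simp add: DERIV_def)
        then have "(\<lambda>i. ?q (X i) v) \<longlonglongrightarrow> u' t0 v"
          using X by (auto simp: tendsto_at_iff_sequentially o_def)
        then show "(\<lambda>i. ?q (X (i + N)) v) \<longlonglongrightarrow> u' t0 v" by (rule LIMSEQ_ignore_initial_segment)
      qed
    qed
    then show "((\<lambda>h. \<integral>v. ?q h v \<partial>M) \<circ> X) \<longlonglongrightarrow> (\<integral>v. u' t0 v \<partial>M)"
      by (simp add: o_def LIMSEQ_offset[of _ N])
  qed
  moreover have "\<forall>\<^sub>F h in at 0. (\<integral>v. ?q h v \<partial>M) = ((\<integral>v. u (t0 + h) v \<partial>M) - (\<integral>v. u t0 v \<partial>M)) / h"
  proof -
    have "\<forall>\<^sub>F h in at 0. \<bar>h\<bar> < d"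
      using d by (auto simp: eventually_at dist_real_def)
    then show ?thesis
    proof eventually_elim
      case (elim h)
      then have "integrable M (u (t0 + h))" "integrable M (u t0)" using t0 by (auto intro: int)
      then show ?case by simp
    qed
  qed
  ultimately have "((\<lambda>h. ((\<integral>v. u (t0 + h) v \<partial>M) - (\<integral>v. u t0 v \<partial>M)) / h) \<longlongrightarrow> (\<integral>v. u' t0 v \<partial>M)) (at 0)"
    by (rule Lim_transform_eventually)
  then show ?thesis by (simp add: DERIV_def)
qed

text \<open>The class contains polynomials and is closed under products, shifts and primitives, so
  every function in the energy estimate is integrable against a measure with some exponential
  moment. The function p is at first known only to lie in this class, because its profile is O(exp
  (x t)) for x < l but not yet for x = l.\<close>

definition subexp :: "(real \<Rightarrow> real) \<Rightarrow> bool" where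
  "subexp u \<longleftrightarrow> (\<forall>e>0. \<exists>C. \<forall>t. \<bar>u t\<bar> \<le> C * exp (e * \<bar>t\<bar>))"

lemma subexpE:
  assumes "subexp u" "0 < e"
  obtains C where "0 < C" "\<And>t. \<bar>u t\<bar> \<le> C * exp (e * \<bar>t\<bar>)"
proof -
  obtain C where C: "\<And>t. \<bar>u t\<bar> \<le> C * exp (e * \<bar>t\<bar>)" using assms unfolding subexp_def by blast
  have "\<bar>u t\<bar> \<le> (\<bar>C\<bar> + 1) * exp (e * \<bar>t\<bar>)" for t
    by (rule order_trans[OF C]) (auto intro: mult_right_mono)
  with that[of "\<bar>C\<bar> + 1"] show ?thesis by auto
qed

lemma subexp_bounded: "(\<And>t. \<bar>u t\<bar> \<le> B) \<Longrightarrow> subexp u"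
proof (unfold subexp_def, intro allI impI exI)
  fix e t :: real assume *: "\<And>t. \<bar>u t\<bar> \<le> B" and e: "0 < e"
  have "\<bar>u t\<bar> \<le> B * 1" using * by simp
  also have "\<dots> \<le> B * exp (e * \<bar>t\<bar>)"
    using *[of t] e by (intro mult_left_mono) auto
  finally show "\<bar>u t\<bar> \<le> B * exp (e * \<bar>t\<bar>)" .
qed

lemma subexp_const [intro, simp]: "subexp (\<lambda>_. b)"
  by (rule subexp_bounded) (rule order_refl)

lemma subexp_id [intro, simp]: "subexp (\<lambda>t. t)"
  unfolding subexp_def
proof (intro allI impI exI)
  fix e t :: real assume "0 < e"
  from abs_le_exp[OF this, of t] show "\<bar>t\<bar> \<le> (1 / e) * exp (e * \<bar>t\<bar>)" by simp
qed

lemma subexp_add [intro]: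
  assumes "subexp u" "subexp w" shows "subexp (\<lambda>t. u t + w t)"
  unfolding subexp_def
proof (intro allI impI)
  fix e :: real assume e: "0 < e"
  obtain C where C: "\<And>t. \<bar>u t\<bar> \<le> C * exp (e * \<bar>t\<bar>)" using subexpE[OF assms(1) e] by metis
  obtain D where D: "\<And>t. \<bar>w t\<bar> \<le> D * exp (e * \<bar>t\<bar>)" using subexpE[OF assms(2) e] by metis
  have "\<bar>u t + w t\<bar> \<le> (C + D) * exp (e * \<bar>t\<bar>)" for t
    using C[of t] D[of t] by (simp add: distrib_right)
  then show "\<exists>C. \<forall>t. \<bar>u t + w t\<bar> \<le> C * exp (e * \<bar>t\<bar>)" by blast
qed

lemma subexp_mult [intro]:
  assumes "subexp u" "subexp w" shows "subexp (\<lambda>t. u t * w t)"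
  unfolding subexp_def
proof (intro allI impI)
  fix e :: real assume "0 < e"
  then have e: "0 < e / 2" by simp
  obtain C where C: "0 < C" "\<And>t. \<bar>u t\<bar> \<le> C * exp (e / 2 * \<bar>t\<bar>)" using subexpE[OF assms(1) e] by metis
  obtain D where D: "\<And>t. \<bar>w t\<bar> \<le> D * exp (e / 2 * \<bar>t\<bar>)" using subexpE[OF assms(2) e] by metis
  have "\<bar>u t * w t\<bar> \<le> (C * D) * exp (e * \<bar>t\<bar>)" for t
  proof -
    have "\<bar>u t * w t\<bar> \<le> (C * exp (e / 2 * \<bar>t\<bar>)) * (D * exp (e / 2 * \<bar>t\<bar>))"
      unfolding abs_mult using C(1) by (intro mult_mono C(2) D) auto
    also have "\<dots> = (C * D) * exp (e * \<bar>t\<bar>)" by (simp add: mult_exp_exp field_simps)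
    finally show ?thesis .
  qed
  then show "\<exists>C. \<forall>t. \<bar>u t * w t\<bar> \<le> C * exp (e * \<bar>t\<bar>)" by blast
qed

text \<open>Half of the rate bounds \<open>u\<close> between 0 and t, the other half absorbs the
  length |t| of that interval.\<close>

lemma subexp_antiderivative:
  assumes "subexp u" and F: "\<And>t. (F has_real_derivative u t) (at t)"
  shows "subexp F"
  unfolding subexp_def
proof (intro allI impI)
  fix e :: real assume "0 < e"
  then have e: "0 < e / 2" by simp
  obtain C where C: "0 < C" "\<And>t. \<bar>u t\<bar> \<le> C * exp (e / 2 * \<bar>t\<bar>)" using subexpE[OF assms(1) e] by metis
  have "\<bar>F t\<bar> \<le> (\<bar>F 0\<bar> + C / (e / 2)) * exp (e * \<bar>t\<bar>)" for t
  proof -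
    have "\<bar>F t - F 0\<bar> \<le> C * exp (e / 2 * \<bar>t\<bar>) * \<bar>t - 0\<bar>"
    proof (rule mean_value_bound[OF F])
      fix x assume "x \<in> closed_segment 0 t"
      then have "\<bar>x\<bar> \<le> \<bar>t\<bar>" by (auto simp: closed_segment_eq_real_ivl split: if_splits)
      then have "C * exp (e / 2 * \<bar>x\<bar>) \<le> C * exp (e / 2 * \<bar>t\<bar>)" using C(1) e by (auto simp: mult_left_mono)
      with C(2)[of x] show "\<bar>u x\<bar> \<le> C * exp (e / 2 * \<bar>t\<bar>)" by linarith
    qed
    also have "\<dots> \<le> C * exp (e / 2 * \<bar>t\<bar>) * (exp (e / 2 * \<bar>t\<bar>) / (e / 2))"
      using abs_le_exp[OF e, of t] C(1) by (intro mult_left_mono) auto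
    also have "\<dots> = C / (e / 2) * (exp (e / 2 * \<bar>t\<bar>) * exp (e / 2 * \<bar>t\<bar>))" by simp
    also have "exp (e / 2 * \<bar>t\<bar>) * exp (e / 2 * \<bar>t\<bar>) = exp (e * \<bar>t\<bar>)"
      by (simp add: mult_exp_exp field_simps)
    finally have "\<bar>F t\<bar> \<le> \<bar>F 0\<bar> * 1 + C / (e / 2) * exp (e * \<bar>t\<bar>)" by linarith
    also have "\<bar>F 0\<bar> * 1 \<le> \<bar>F 0\<bar> * exp (e * \<bar>t\<bar>)" using e by (intro mult_left_mono) auto
    finally show ?thesis by (simp add: distrib_right)
  qed
  then show "\<exists>C. \<forall>t. \<bar>F t\<bar> \<le> C * exp (e * \<bar>t\<bar>)" by blast
qed

section \<open>The energy estimate\<close>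

text \<open>In the application \<open>\<mu>\<close> is the law of c s + w weighted with b exp (- l
  v). Its two-sided moment comes from convergence of the transform on both sides of l.\<close>

locale exp_moment =
  fixes \<mu> :: "real measure" and \<kappa> :: real
  assumes sets_mu [simp, measurable_cong]: "sets \<mu> = sets borel"
    and kappa: "0 < \<kappa>"
    and moment: "integrable \<mu> (\<lambda>v. exp (\<kappa> * \<bar>v\<bar>))"
begin

lemma space_mu [simp]: "space \<mu> = UNIV"
  using sets_eq_imp_space_eq[OF sets_mu] by simp

lemma meas_mu: "u \<in> borel_measurable borel \<Longrightarrow> u \<in> borel_measurable \<mu>"
  using measurable_cong_sets[OF sets_mu refl] by blast

lemma integrable_dom:
  assumes "u \<in> borel_measurable borel" "\<And>v. \<bar>u v\<bar> \<le> C * exp (\<kappa> * \<bar>v\<bar>)"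
  shows "integrable \<mu> u"
proof (rule Bochner_Integration.integrable_bound)
  show "integrable \<mu> (\<lambda>v. C * exp (\<kappa> * \<bar>v\<bar>))" using moment by simp
  show "u \<in> borel_measurable \<mu>" using assms(1) by (rule meas_mu)
  have "norm (u v) \<le> norm (C * exp (\<kappa> * \<bar>v\<bar>))" for v
    using assms(2)[of v] abs_ge_self[of "C * exp (\<kappa> * \<bar>v\<bar>)"] unfolding real_norm_def by linarith
  then show "AE v in \<mu>. norm (u v) \<le> norm (C * exp (\<kappa> * \<bar>v\<bar>))" by simp
qed

lemma integrable_subexp:
  assumes "u \<in> borel_measurable borel" "subexp u" shows "integrable \<mu> u"
proof -
  obtain C where "\<And>t. \<bar>u t\<bar> \<le> C * exp (\<kappa> * \<bar>t\<bar>)" using subexpE[OF assms(2) kappa] by metis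
  with assms(1) show ?thesis by (rule integrable_dom)
qed

lemma subexp_shift:
  assumes "subexp u" shows "subexp (\<lambda>v. u (t - v))"
  unfolding subexp_def
proof (intro allI impI)
  fix e :: real assume e: "0 < e"
  obtain C where C: "0 < C" "\<And>t. \<bar>u t\<bar> \<le> C * exp (e * \<bar>t\<bar>)" using subexpE[OF assms e] by metis
  have "\<bar>u (t - v)\<bar> \<le> (C * exp (e * \<bar>t\<bar>)) * exp (e * \<bar>v\<bar>)" for v
  proof -
    have "e * \<bar>t - v\<bar> \<le> e * \<bar>t\<bar> + e * \<bar>v\<bar>"
      using mult_left_mono[OF abs_triangle_ineq4[of t v], of e] e by (simp add: distrib_left)
    then have "exp (e * \<bar>t - v\<bar>) \<le> exp (e * \<bar>t\<bar>) * exp (e * \<bar>v\<bar>)" by (simp add: mult_exp_exp)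
    then have "C * exp (e * \<bar>t - v\<bar>) \<le> C * (exp (e * \<bar>t\<bar>) * exp (e * \<bar>v\<bar>))"
      using C(1) by simp
    with C(2)[of "t - v"] show ?thesis by (simp add: mult.assoc)
  qed
  then show "\<exists>C. \<forall>v. \<bar>u (t - v)\<bar> \<le> C * exp (e * \<bar>v\<bar>)" by blast
qed

lemma locally_dominated:
  assumes "subexp u" "0 < e"
  obtains C where "0 < C" "\<And>s v. \<bar>s - t\<bar> < 1 \<Longrightarrow> \<bar>u (s - v)\<bar> \<le> C * exp (e * \<bar>v\<bar>)"
proof -
  obtain C where C: "0 < C" "\<And>t. \<bar>u t\<bar> \<le> C * exp (e * \<bar>t\<bar>)" using subexpE[OF assms] by metis
  have "\<bar>u (s - v)\<bar> \<le> (C * exp (e * (\<bar>t\<bar> + 1))) * exp (e * \<bar>v\<bar>)" if "\<bar>s - t\<bar> < 1" for s v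
  proof -
    have "\<bar>s - v\<bar> \<le> (\<bar>t\<bar> + 1) + \<bar>v\<bar>" using that by linarith
    from mult_left_mono[OF this, of e] have "e * \<bar>s - v\<bar> \<le> e * (\<bar>t\<bar> + 1) + e * \<bar>v\<bar>"
      using assms(2) by (simp add: distrib_left)
    then have "exp (e * \<bar>s - v\<bar>) \<le> exp (e * (\<bar>t\<bar> + 1)) * exp (e * \<bar>v\<bar>)" by (simp add: mult_exp_exp)
    then have "C * exp (e * \<bar>s - v\<bar>) \<le> C * (exp (e * (\<bar>t\<bar> + 1)) * exp (e * \<bar>v\<bar>))"
      using C(1) by simp
    with C(2)[of "s - v"] show ?thesis by (simp add: mult.assoc)
  qed
  then show ?thesis using C(1) by (intro that[of "C * exp (e * (\<bar>t\<bar> + 1))"]) auto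
qed

lemma integrable_conv:
  assumes "continuous_on UNIV u" "subexp u"
  shows "integrable \<mu> (\<lambda>v. u (t - v))"
proof (rule integrable_subexp)
  show "(\<lambda>v. u (t - v)) \<in> borel_measurable borel"
    by (intro borel_measurable_continuous_onI continuous_on_compose2[OF assms(1)])
      (simp_all add: continuous_on_diff)
qed (rule subexp_shift[OF assms(2)])

lemma DERIV_conv:
  assumes der: "\<And>t. (u has_real_derivative u' t) (at t)" and c: "continuous_on UNIV u'"
    and sub: "subexp u" "subexp u'"
  shows "((\<lambda>t. \<integral>v. u (t - v) \<partial>\<mu>) has_real_derivative (\<integral>v. u' (t - v) \<partial>\<mu>)) (at t)"
proof -
  have cu: "continuous_on UNIV u"
    by (intro continuous_at_imp_continuous_on ballI DERIV_isCont[OF der])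
  obtain C where C: "\<And>s v. \<bar>s - t\<bar> < 1 \<Longrightarrow> \<bar>u' (s - v)\<bar> \<le> C * exp (\<kappa> * \<bar>v\<bar>)"
    using locally_dominated[OF sub(2) kappa] by metis
  show ?thesis
  proof (rule DERIV_integral[where u = "\<lambda>t v. u (t - v)" and u' = "\<lambda>t v. u' (t - v)"
        and w = "\<lambda>v. C * exp (\<kappa> * \<bar>v\<bar>)" and d = 1])
    show "integrable \<mu> (\<lambda>v. u (s - v))" for s by (rule integrable_conv[OF cu sub(1)])
    show "((\<lambda>t. u (t - v)) has_real_derivative u' (s - v)) (at s)" for s v
      using DERIV_chain2[OF der DERIV_diff[OF DERIV_ident DERIV_const[of v]]] by simp
    show "(\<lambda>v. u' (t - v)) \<in> borel_measurable \<mu>"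
      using integrable_conv[OF c sub(2)] by (rule borel_measurable_integrable)
    show "integrable \<mu> (\<lambda>v. C * exp (\<kappa> * \<bar>v\<bar>))" using moment by simp
    show "\<bar>u' (s - v)\<bar> \<le> C * exp (\<kappa> * \<bar>v\<bar>)" if "\<bar>s - t\<bar> < 1" for s v
      using C that by blast
  qed simp
qed

text \<open>Multiply the linear equation for \<open>F\<close> by \<open>h = F''\<close>. For fixed \<open>v\<close>,
  \<open>h (F (t - v) - F t + v f t)\<close> is a square plus the derivative of
  \<open>\<psi> t v = \<integral>\<^sub>t\<^sub>-\<^sub>v\<^sup>t (f s - f t)\<^sup>2 ds / 2\<close>, which is nonpositive for \<open>v \<le> 0\<close> and controlled by the energy for
  \<open>v \<ge> 0\<close>.\<close>

lemma energy_inequality: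
  assumes F: "\<And>t. (F has_real_derivative f t) (at t)" and f: "\<And>t. (f has_real_derivative h t) (at t)"
    and h: "continuous_on UNIV h" and sub: "subexp F" "subexp f" "subexp h" and D: "D \<le> 0"
    and G: "\<And>t. (G has_real_derivative
        - (h t + D * f t + (\<integral>v. (F (t - v) - F t + v * f t) \<partial>\<mu>))\<^sup>2) (at t)"
    and S: "\<And>t. (S has_real_derivative - (h t)\<^sup>2) (at t)"
  shows "\<exists>C. \<forall>a\<le>0. S a \<le> G a + C + (\<integral>v. indicator {0..} v * (v\<^sup>2 * (S (a - v) - S a)) \<partial>\<mu>)"
proof -
  define \<beta> where "\<beta> t = h t + D * f t + (\<integral>v. (F (t - v) - F t + v * f t) \<partial>\<mu>)" for t
  have cF: "continuous_on UNIV F" and cf: "continuous_on UNIV f" and cS: "continuous_on UNIV S"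
    by (auto intro!: continuous_at_imp_continuous_on DERIV_isCont[OF F] DERIV_isCont[OF f] DERIV_isCont[OF S])
  have "continuous_on UNIV (\<lambda>t. (f t)\<^sup>2)" using cf by (intro continuous_intros)
  then obtain F2 where F2: "\<And>t. (F2 has_real_derivative (f t)\<^sup>2) (at t)" by (rule continuous_antiderivative) blast
  have cF2: "continuous_on UNIV F2" by (auto intro!: continuous_at_imp_continuous_on DERIV_isCont[OF F2])
  have sF2: "subexp F2"
    using subexp_mult[OF sub(2) sub(2)] by (intro subexp_antiderivative[OF _ F2]) (simp add: power2_eq_square)
  have "subexp (\<lambda>t. (- 1) * (h t * h t))" by (intro subexp_mult subexp_const sub)
  then have sS: "subexp S" by (intro subexp_antiderivative[OF _ S]) (simp add: power2_eq_square)
  note [simp] = integrable_conv[OF cF sub(1)] integrable_conv[OF cf sub(2)] integrable_conv[OF cF2 sF2]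
  have iv [simp]: "integrable \<mu> (\<lambda>v. v)" by (rule integrable_subexp) auto
  have ic [simp]: "integrable \<mu> (\<lambda>v. k)" for k :: real by (rule integrable_subexp) auto
  have isq [simp]: "integrable \<mu> (\<lambda>v. (f a - f (a - v))\<^sup>2)" for a
  proof (rule integrable_subexp)
    show "(\<lambda>v. (f a - f (a - v))\<^sup>2) \<in> borel_measurable borel"
      by (intro borel_measurable_continuous_onI continuous_on_power continuous_on_diff continuous_on_const
          continuous_on_compose2[OF cf]) (simp_all add: continuous_on_diff)
    have "subexp (\<lambda>v. f a + (- 1) * f (a - v))"
      by (intro subexp_add subexp_mult subexp_const subexp_shift sub)
    from subexp_mult[OF this this] show "subexp (\<lambda>v. (f a - f (a - v))\<^sup>2)" by (simp add: power2_eq_square)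
  qed

  \<comment> \<open>Expanding the square with the primitives \<open>F\<close> of \<open>f\<close>
    and \<open>F2\<close> of its square gives a closed form that can be differentiated in both
    variables.\<close>
  define \<psi> where "\<psi> a v = (F2 a - F2 (a - v) - 2 * f a * (F a - F (a - v)) + v * (f a)\<^sup>2) / 2" for a v
  define \<psi>' where "\<psi>' a v = h a * (F (a - v) - F a + v * f a) - (f a - f (a - v))\<^sup>2 / 2" for a v
  have int\<psi>: "integrable \<mu> (\<psi> a)" for a unfolding \<psi>_def by simp
  have sh: "((\<lambda>a. u (a - v)) has_real_derivative u' (a - v)) (at a)"
    if "\<And>t. (u has_real_derivative u' t) (at t)" for u u' :: "real \<Rightarrow> real" and a v
    using DERIV_chain2[OF that DERIV_diff[OF DERIV_ident DERIV_const[of v]]] by simp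
  have sh': "((\<lambda>v. u (a - v)) has_real_derivative - u' (a - v)) (at v)"
    if "\<And>t. (u has_real_derivative u' t) (at t)" for u u' :: "real \<Rightarrow> real" and a v
    using DERIV_chain2[OF that DERIV_diff[OF DERIV_const[of a] DERIV_ident]] by simp
  have der\<psi>: "((\<lambda>a. \<psi> a v) has_real_derivative \<psi>' a v) (at a)" for a v
    unfolding \<psi>_def \<psi>'_def
    by (rule derivative_eq_intros F f F2 sh[OF F] sh[OF F2] refl)+
      (simp add: power2_eq_square, simp add: field_simps power2_eq_square)
  have der\<psi>v: "(\<psi> a has_real_derivative (f (a - v) - f a)\<^sup>2 / 2) (at v)" for a v
    unfolding \<psi>_def
    by (rule derivative_eq_intros sh'[OF F] sh'[OF F2] refl)+
      (simp add: power2_eq_square, simp add: field_simps power2_eq_square)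
  have \<psi>0: "\<psi> a 0 = 0" for a by (simp add: \<psi>_def)

  have der\<Psi>: "((\<lambda>a. \<integral>v. \<psi> a v \<partial>\<mu>) has_real_derivative (\<integral>v. \<psi>' t v \<partial>\<mu>)) (at t)" for t
  proof -
    \<comment> \<open>Each factor of a product is bounded at half the rate, so that products of two
      stay within the moment \<open>\<kappa>\<close>.\<close>
    have k2: "0 < \<kappa> / 2" using kappa by simp
    obtain C1 where C1: "0 < C1" "\<And>s v. \<bar>s - t\<bar> < 1 \<Longrightarrow> \<bar>F (s - v)\<bar> \<le> C1 * exp (\<kappa> / 2 * \<bar>v\<bar>)"
      using locally_dominated[OF sub(1) k2] by metis
    obtain C2 where C2: "0 < C2" "\<And>s v. \<bar>s - t\<bar> < 1 \<Longrightarrow> \<bar>f (s - v)\<bar> \<le> C2 * exp (\<kappa> / 2 * \<bar>v\<bar>)"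
      using locally_dominated[OF sub(2) k2] by metis
    obtain C3 where C3: "0 < C3" "\<And>s v. \<bar>s - t\<bar> < 1 \<Longrightarrow> \<bar>h (s - v)\<bar> \<le> C3 * exp (\<kappa> / 2 * \<bar>v\<bar>)"
      using locally_dominated[OF sub(3) k2] by metis
    define K where "K = C3 * (2 * C1 + 2 / \<kappa> * C2) + 2 * C2\<^sup>2"
    have bd: "\<bar>\<psi>' s v\<bar> \<le> K * exp (\<kappa> * \<bar>v\<bar>)" if s: "\<bar>s - t\<bar> < 1" for s v
    proof -
      define E where "E = exp (\<kappa> / 2 * \<bar>v\<bar>)"
      have E1: "1 \<le> E" using kappa by (simp add: E_def)
      have E2: "E * E = exp (\<kappa> * \<bar>v\<bar>)" by (simp add: E_def mult_exp_exp)
      have EE: "E \<le> E * E" using E1 by simp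
      have v: "\<bar>v\<bar> \<le> 2 / \<kappa> * E" using abs_le_exp[OF k2, of v] by (simp add: E_def field_simps)
      have b0: "\<bar>h s\<bar> \<le> C3" "\<bar>F s\<bar> \<le> C1" "\<bar>f s\<bar> \<le> C2"
        using C1(2)[OF s, of 0] C2(2)[OF s, of 0] C3(2)[OF s, of 0] by simp_all
      have b1: "\<bar>F (s - v)\<bar> \<le> C1 * E" "\<bar>f (s - v)\<bar> \<le> C2 * E"
        using C1(2)[OF s, of v] C2(2)[OF s, of v] by (simp_all add: E_def)
      have "\<bar>v * f s\<bar> \<le> 2 / \<kappa> * E * C2"
        unfolding abs_mult using v b0 E1 kappa by (intro mult_mono) auto
      moreover have "\<bar>F s\<bar> \<le> C1 * E" by (rule order_trans[OF b0(2)]) (use E1 C1(1) in simp)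
      ultimately have "\<bar>F (s - v) - F s + v * f s\<bar> \<le> (2 * C1 + 2 / \<kappa> * C2) * E"
        using b1(1) by (simp add: algebra_simps)
      then have "\<bar>h s * (F (s - v) - F s + v * f s)\<bar> \<le> C3 * ((2 * C1 + 2 / \<kappa> * C2) * E)"
        unfolding abs_mult using b0 C3(1) by (intro mult_mono) auto
      also have "\<dots> \<le> C3 * ((2 * C1 + 2 / \<kappa> * C2) * (E * E))"
        using EE C1 C2 C3 kappa by (intro mult_left_mono) auto
      finally have 1: "\<bar>h s * (F (s - v) - F s + v * f s)\<bar> \<le> C3 * (2 * C1 + 2 / \<kappa> * C2) * (E * E)"
        by (simp add: mult.assoc)
      have "C2 \<le> C2 * E" using E1 C2(1) by simp
      then have "\<bar>f s - f (s - v)\<bar> \<le> 2 * C2 * E" using b0(3) b1(2) by linarith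
      then have "\<bar>f s - f (s - v)\<bar>\<^sup>2 \<le> (2 * C2 * E)\<^sup>2" by (intro power_mono) auto
      then have 2: "(f s - f (s - v))\<^sup>2 / 2 \<le> 2 * C2\<^sup>2 * (E * E)" by (simp add: power2_eq_square mult_ac)
      have "\<bar>\<psi>' s v\<bar> \<le> \<bar>h s * (F (s - v) - F s + v * f s)\<bar> + (f s - f (s - v))\<^sup>2 / 2"
        unfolding \<psi>'_def by (rule order_trans[OF abs_triangle_ineq4]) simp
      also have "\<dots> \<le> K * (E * E)" using 1 2 by (simp add: K_def distrib_right)
      finally show ?thesis by (simp add: E2)
    qed
    show ?thesis
    proof (rule DERIV_integral[where u = \<psi> and u' = \<psi>' and d = 1])
      show "integrable \<mu> (\<lambda>v. K * exp (\<kappa> * \<bar>v\<bar>))" using moment by simp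
      show "\<psi>' t \<in> borel_measurable \<mu>"
        unfolding \<psi>'_def by (rule borel_measurable_integrable) simp
    qed (simp_all add: int\<psi> der\<psi> bd)
  qed
  have int\<psi>': "(\<integral>v. \<psi>' a v \<partial>\<mu>) \<le> h a * (\<beta> a - h a - D * f a)" for a
  proof -
    have "(\<integral>v. \<psi>' a v \<partial>\<mu>) \<le> (\<integral>v. h a * (F (a - v) - F a + v * f a) \<partial>\<mu>)"
      by (rule integral_mono) (simp_all add: \<psi>'_def)
    also have "\<dots> = h a * (\<beta> a - h a - D * f a)" by (simp add: \<beta>_def)
    finally show ?thesis .
  qed
  define Y where "Y a = 2 * ((\<integral>v. \<psi> a v \<partial>\<mu>) + D / 2 * (f a)\<^sup>2) + G a - S a" for a
  have Y: "Y 0 \<le> Y a" if "a \<le> 0" for a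
  proof (rule DERIV_nonpos_imp_nonincreasing[OF that])
    fix t
    have "(Y has_real_derivative 2 * ((\<integral>v. \<psi>' t v \<partial>\<mu>) + D * f t * h t) - (\<beta> t)\<^sup>2 + (h t)\<^sup>2) (at t)"
      unfolding Y_def \<beta>_def by (rule derivative_eq_intros der\<Psi> f G S refl)+ simp
    moreover have "2 * ((\<integral>v. \<psi>' t v \<partial>\<mu>) + D * f t * h t) - (\<beta> t)\<^sup>2 + (h t)\<^sup>2 \<le> 0"
    proof -
      have "2 * ((\<integral>v. \<psi>' t v \<partial>\<mu>) + D * f t * h t) \<le> 2 * (h t * \<beta> t - h t * h t)"
        using int\<psi>'[of t] by (simp add: algebra_simps)
      moreover have "0 \<le> (\<beta> t - h t)\<^sup>2" by simp
      ultimately show ?thesis by (simp add: power2_eq_square algebra_simps)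
    qed
    ultimately show "\<exists>y. (Y has_real_derivative y) (at t) \<and> y \<le> 0" by blast
  qed
  have S_anti: "S t \<le> S s" if "s \<le> t" for s t
    by (rule DERIV_nonpos_imp_nonincreasing[OF that]) (use S in force)
  have \<psi>_le: "2 * \<psi> a v \<le> indicator {0..} v * (v\<^sup>2 * (S (a - v) - S a))" for a v
  proof (cases "0 \<le> v")
    case False
    have "\<psi> a v \<le> \<psi> a 0"
      by (rule DERIV_nonneg_imp_nondecreasing) (use False der\<psi>v[of a] in \<open>auto intro!: exI\<close>)
    with False show ?thesis by (simp add: \<psi>0)
  next
    case True
    \<comment> \<open>By Cauchy-Schwarz the derivative in v is at most v / 2 times the energy on
      [a - v, a]; the length v of the interval supplies the second factor v.\<close>
    have "\<bar>\<psi> a v - \<psi> a 0\<bar> \<le> (v * (S (a - v) - S a) / 2) * \<bar>v - 0\<bar>"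
    proof (rule mean_value_bound[OF der\<psi>v])
      fix x assume "x \<in> closed_segment 0 v"
      then have x: "0 \<le> x" "x \<le> v" using True by (auto simp: closed_segment_eq_real_ivl)
      have "(f a - f (a - x))\<^sup>2 \<le> x * (S (a - x) - S a)"
        using x cauchy_schwarz_antiderivative[OF _ f S, of "a - x" a] by (cases "x = 0") auto
      also have "\<dots> \<le> v * (S (a - v) - S a)"
        using x S_anti[of "a - v" "a - x"] S_anti[of "a - x" a] by (intro mult_mono) auto
      finally show "\<bar>(f (a - x) - f a)\<^sup>2 / 2\<bar> \<le> v * (S (a - v) - S a) / 2"
        by (simp add: power2_commute)
    qed
    then have "2 * \<psi> a v \<le> v\<^sup>2 * (S (a - v) - S a)" using True by (simp add: \<psi>0 power2_eq_square mult_ac)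
    with True show ?thesis by simp
  qed
  have intS: "integrable \<mu> (\<lambda>v. indicator {0..} v * (v\<^sup>2 * (S (a - v) - S a)))" for a
  proof (rule Bochner_Integration.integrable_bound)
    have "subexp (\<lambda>v. v * (v * (S (a - v) + (- S a))))"
      by (intro subexp_add subexp_mult subexp_const subexp_id subexp_shift sS)
    moreover have m: "(\<lambda>v. v\<^sup>2 * (S (a - v) - S a)) \<in> borel_measurable borel"
      by (intro borel_measurable_continuous_onI continuous_on_mult continuous_on_power continuous_on_diff
          continuous_on_const continuous_on_id continuous_on_compose2[OF cS]) (simp_all add: continuous_on_diff)
    ultimately show "integrable \<mu> (\<lambda>v. v\<^sup>2 * (S (a - v) - S a))"
      by (intro integrable_subexp) (simp_all add: power2_eq_square mult.assoc)
    show "(\<lambda>v. indicator {0..} v * (v\<^sup>2 * (S (a - v) - S a))) \<in> borel_measurable \<mu>"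
      by (intro meas_mu borel_measurable_times borel_measurable_indicator m) simp
  qed (simp add: indicator_def)
  have "S a \<le> G a + (- Y 0) + (\<integral>v. indicator {0..} v * (v\<^sup>2 * (S (a - v) - S a)) \<partial>\<mu>)" if "a \<le> 0" for a
  proof -
    have "2 * (\<integral>v. \<psi> a v \<partial>\<mu>) = (\<integral>v. 2 * \<psi> a v \<partial>\<mu>)" by simp
    also have "\<dots> \<le> (\<integral>v. indicator {0..} v * (v\<^sup>2 * (S (a - v) - S a)) \<partial>\<mu>)"
      by (rule integral_mono) (use int\<psi> intS \<psi>_le in auto)
    finally have "2 * (\<integral>v. \<psi> a v \<partial>\<mu>) \<le> \<dots>" .
    moreover have "D * (f a)\<^sup>2 \<le> 0" using D by (simp add: mult_nonpos_nonneg)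
    ultimately show ?thesis using Y[OF that] by (simp add: Y_def)
  qed
  then show ?thesis by blast
qed

text \<open>With \<open>M = sup S a exp (e a)\<close> and \<open>w e = \<integral>\<^sub>v\<^sub>\<ge>\<^sub>0 v\<^sup>2 exp (e v)\<close> the hypothesis gives
  \<open>(1 + w 0) M \<le> B + w e M\<close>, which bounds \<open>M\<close> uniformly as long as \<open>w e \<le> w 0 + 1/2\<close>.\<close>

lemma energy_bootstrap:
  assumes S: "\<And>s t. s \<le> t \<Longrightarrow> S t \<le> S s" "S 0 = (0::real)" "subexp S" "continuous_on UNIV S"
    and le: "\<And>a. a \<le> 0 \<Longrightarrow> S a \<le> N a + (\<integral>v. indicator {0..} v * (v\<^sup>2 * (S (a - v) - S a)) \<partial>\<mu>)"
  obtains e0 where "0 < e0"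
    "\<And>e B a. 0 < e \<Longrightarrow> e \<le> e0 \<Longrightarrow> (\<And>a. a \<le> 0 \<Longrightarrow> N a * exp (e * a) \<le> B) \<Longrightarrow> a \<le> 0 \<Longrightarrow>
      S a \<le> 2 * B * exp (- e * a)"
proof -
  have ind: "integrable \<mu> (\<lambda>v. indicator {0..} v * u v)"
    if "continuous_on UNIV u" "\<And>v. 0 \<le> v \<Longrightarrow> \<bar>u v\<bar> \<le> C * exp (\<kappa> * v)" for u :: "real \<Rightarrow> real" and C
  proof (rule integrable_dom[where C = "\<bar>C\<bar>"])
    show "(\<lambda>v. indicator {0..} v * u v) \<in> borel_measurable borel"
      using borel_measurable_continuous_onI[OF that(1)] by measurable
    show "\<bar>indicator {0..} v * u v\<bar> \<le> \<bar>C\<bar> * exp (\<kappa> * \<bar>v\<bar>)" for v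
    proof (cases "0 \<le> v")
      case True
      have "\<bar>u v\<bar> \<le> \<bar>C\<bar> * exp (\<kappa> * v)"
        by (rule order_trans[OF that(2)[OF True] mult_right_mono]) auto
      with True show ?thesis by simp
    qed simp
  qed
  have ind_sub: "integrable \<mu> (\<lambda>v. indicator {0..} v * (u v * exp (e * v)))"
    if cu: "continuous_on UNIV u" and su: "subexp u" and ek: "e \<le> \<kappa> / 2" for u e
  proof -
    have k2: "0 < \<kappa> / 2" using kappa by simp
    obtain C where C: "0 < C" "\<And>t. \<bar>u t\<bar> \<le> C * exp (\<kappa> / 2 * \<bar>t\<bar>)" using subexpE[OF su k2] by metis
    show ?thesis
    proof (rule ind[where C = C])
      show "continuous_on UNIV (\<lambda>v. u v * exp (e * v))" by (intro continuous_intros cu)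
      fix v :: real assume v: "0 \<le> v"
      have "\<bar>u v * exp (e * v)\<bar> \<le> (C * exp (\<kappa> / 2 * v)) * exp (\<kappa> / 2 * v)"
        unfolding abs_mult using C(1) C(2)[of v] v mult_right_mono[OF ek v] by (intro mult_mono) auto
      also have "\<dots> = C * exp (\<kappa> * v)" by (simp add: mult_exp_exp)
      finally show "\<bar>u v * exp (e * v)\<bar> \<le> C * exp (\<kappa> * v)" .
    qed
  qed
  have sq: "subexp (\<lambda>v. v\<^sup>2)" using subexp_mult[OF subexp_id subexp_id] by (simp add: power2_eq_square)
  have cub: "subexp (\<lambda>v. v ^ 3)"
    using subexp_mult[OF subexp_id subexp_mult[OF subexp_id subexp_id]] by (simp add: power3_eq_cube mult.assoc)
  define w where "w e = (\<integral>v. indicator {0..} v * (v\<^sup>2 * exp (e * v)) \<partial>\<mu>)" for e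
  define K where "K = (\<integral>v. indicator {0..} v * (v ^ 3 * exp (\<kappa> / 2 * v)) \<partial>\<mu>)"
  have iw: "integrable \<mu> (\<lambda>v. indicator {0..} v * (v\<^sup>2 * exp (e * v)))" if "e \<le> \<kappa> / 2" for e
    using ind_sub[OF _ sq that] by (simp add: continuous_on_power)
  have iK: "integrable \<mu> (\<lambda>v. indicator {0..} v * (v ^ 3 * exp (\<kappa> / 2 * v)))"
    using ind_sub[OF _ cub order_refl] by (simp add: continuous_on_power)
  have K0: "0 \<le> K" unfolding K_def by (rule integral_nonneg_AE) (auto simp: indicator_def)
  have w_le: "w e \<le> w 0 + e * K" if "0 \<le> e" "e \<le> \<kappa> / 2" for e
  proof -
    have k0: "0 \<le> \<kappa> / 2" using kappa by simp
    have "w e \<le> (\<integral>v. indicator {0..} v * (v\<^sup>2 * exp (0 * v)) + e * (indicator {0..} v * (v ^ 3 * exp (\<kappa> / 2 * v))) \<partial>\<mu>)"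
      unfolding w_def
    proof (rule integral_mono[OF iw[OF that(2)]])
      show "integrable \<mu> (\<lambda>v. indicator {0..} v * (v\<^sup>2 * exp (0 * v)) + e * (indicator {0..} v * (v ^ 3 * exp (\<kappa> / 2 * v))))"
        by (intro Bochner_Integration.integrable_add iw[OF k0] integrable_mult_right iK)
      fix v
      show "indicator {0..} v * (v\<^sup>2 * exp (e * v))
          \<le> indicator {0..} v * (v\<^sup>2 * exp (0 * v)) + e * (indicator {0..} v * (v ^ 3 * exp (\<kappa> / 2 * v)))"
      proof (cases "0 \<le> v")
        case True
        have "1 - e * v \<le> exp (- (e * v))" using exp_ge_add_one_self[of "- (e * v)"] by simp
        then have "(1 - e * v) * exp (e * v) \<le> exp (- (e * v)) * exp (e * v)"
          by (rule mult_right_mono) simp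
        then have "exp (e * v) \<le> 1 + e * v * exp (e * v)" by (simp add: mult_exp_exp left_diff_distrib)
        also have "\<dots> \<le> 1 + e * v * exp (\<kappa> / 2 * v)"
          using True that mult_right_mono[OF that(2) True] by (intro add_left_mono mult_left_mono) auto
        finally have "v\<^sup>2 * exp (e * v) \<le> v\<^sup>2 * (1 + e * v * exp (\<kappa> / 2 * v))" by (rule mult_left_mono) simp
        with True show ?thesis by (simp add: algebra_simps power2_eq_square power3_eq_cube)
      qed simp
    qed
    also have "\<dots> = w 0 + e * K"
      unfolding w_def K_def using iw[OF k0] iK by simp
    finally show ?thesis .
  qed
  \<comment> \<open>Since exp (e v) \<le> 1 + e v exp (\<kappa> v / 2) for v \<ge> 0,
    \<open>w e\<close> exceeds \<open>w 0\<close> by at most \<open>e * K\<close>, where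
    \<open>K\<close> is a third moment. The second entry makes this at most 1/2, the first keeps
    \<open>w e\<close> finite.\<close>
  define e0 where "e0 = min (\<kappa> / 2) (1 / (2 * K + 1))"
  show ?thesis
  proof
    show "0 < e0" using kappa K0 by (simp add: e0_def)
    fix e B a :: real assume e: "0 < e" "e \<le> e0" and B: "\<And>a. a \<le> 0 \<Longrightarrow> N a * exp (e * a) \<le> B" and a: "a \<le> 0"
    have ek: "e \<le> \<kappa> / 2" and "e \<le> 1 / (2 * K + 1)" using e by (auto simp: e0_def)
    then have "e * (2 * K + 1) \<le> 1" using K0 by (simp add: field_simps)
    then have we: "w e \<le> w 0 + 1 / 2" using w_le[of e] e ek by (simp add: algebra_simps)
    have w0: "0 \<le> w 0" unfolding w_def by (rule integral_nonneg_AE) (auto simp: indicator_def)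
    obtain C where C: "0 < C" "\<And>t. \<bar>S t\<bar> \<le> C * exp (e * \<bar>t\<bar>)" using subexpE[OF S(3) e(1)] by metis
    \<comment> \<open>Finite for every positive \<open>e\<close> because \<open>S\<close> is
      subexponential; only a finite \<open>M\<close> can be absorbed into the left side
      below.\<close>
    define M where "M = (SUP a\<in>{..0}. S a * exp (e * a))"
    have bdd: "bdd_above ((\<lambda>a. S a * exp (e * a)) ` {..0})"
    proof (intro bdd_aboveI2)
      fix b :: real assume "b \<in> {..0}"
      then have "S b * exp (e * b) \<le> (C * exp (- (e * b))) * exp (e * b)"
        using C(2)[of b] by (intro mult_right_mono) auto
      then show "S b * exp (e * b) \<le> C" by (simp add: mult_exp_exp mult.assoc)
    qed
    have SM: "S b * exp (e * b) \<le> M" if "b \<le> 0" for b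
      unfolding M_def using that by (intro cSUP_upper bdd) auto
    have M0: "0 \<le> M" using SM[of 0] S(2) by simp
    have main: "(1 + w 0) * (S b * exp (e * b)) \<le> B + M * w e" if b: "b \<le> 0" for b
    proof -
      have i1: "integrable \<mu> (\<lambda>v. indicator {0..} v * (v\<^sup>2 * S (b - v)))"
      proof -
        have "subexp (\<lambda>v. v\<^sup>2 * S (b - v))" by (intro subexp_mult sq subexp_shift S)
        moreover have "continuous_on UNIV (\<lambda>v. v\<^sup>2 * S (b - v))"
          by (intro continuous_on_mult continuous_on_power continuous_on_id continuous_on_compose2[OF S(4)])
            (simp_all add: continuous_on_diff)
        ultimately show ?thesis using ind_sub[of "\<lambda>v. v\<^sup>2 * S (b - v)" 0] kappa by simp
      qed
      have i0: "integrable \<mu> (\<lambda>v. indicator {0..} v * v\<^sup>2)" using iw[of 0] kappa by simp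
      have "(\<integral>v. indicator {0..} v * (v\<^sup>2 * (S (b - v) - S b)) \<partial>\<mu>)
          = (\<integral>v. indicator {0..} v * (v\<^sup>2 * S (b - v)) - S b * (indicator {0..} v * v\<^sup>2) \<partial>\<mu>)"
        by (intro Bochner_Integration.integral_cong) (simp_all add: algebra_simps)
      also have "\<dots> = (\<integral>v. indicator {0..} v * (v\<^sup>2 * S (b - v)) \<partial>\<mu>) - S b * w 0"
        using i0 i1 by (simp add: w_def)
      finally have "(1 + w 0) * S b \<le> N b + (\<integral>v. indicator {0..} v * (v\<^sup>2 * S (b - v)) \<partial>\<mu>)"
        using le[OF b] by (simp add: algebra_simps)
      also have "(\<integral>v. indicator {0..} v * (v\<^sup>2 * S (b - v)) \<partial>\<mu>)
          \<le> (\<integral>v. (M * exp (- (e * b))) * (indicator {0..} v * (v\<^sup>2 * exp (e * v))) \<partial>\<mu>)"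
      proof (rule integral_mono[OF i1])
        show "integrable \<mu> (\<lambda>v. (M * exp (- (e * b))) * (indicator {0..} v * (v\<^sup>2 * exp (e * v))))"
          using iw[OF ek] by simp
        fix v
        show "indicator {0..} v * (v\<^sup>2 * S (b - v))
            \<le> (M * exp (- (e * b))) * (indicator {0..} v * (v\<^sup>2 * exp (e * v)))"
        proof (cases "0 \<le> v")
          case True
          then have "S (b - v) * exp (e * (b - v)) \<le> M" using b by (intro SM) auto
          then have "S (b - v) * exp (e * (b - v)) * exp (e * v - e * b) \<le> M * exp (e * v - e * b)"
            by (rule mult_right_mono) simp
          then have "S (b - v) \<le> M * exp (e * v - e * b)"
            by (simp add: mult_exp_exp mult.assoc right_diff_distrib)
          then have "v\<^sup>2 * S (b - v) \<le> v\<^sup>2 * (M * exp (e * v - e * b))" by (rule mult_left_mono) simp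
          also have "\<dots> = M * exp (- (e * b)) * (v\<^sup>2 * exp (e * v))"
            by (simp add: exp_diff exp_minus field_simps)
          finally show ?thesis using True by simp
        qed simp
      qed
      also have "\<dots> = M * exp (- (e * b)) * w e" by (simp add: w_def)
      finally have "(1 + w 0) * S b * exp (e * b) \<le> (N b + M * exp (- (e * b)) * w e) * exp (e * b)"
        by (intro mult_right_mono) auto
      also have "\<dots> = N b * exp (e * b) + M * w e" by (simp add: distrib_right exp_minus)
      also have "\<dots> \<le> B + M * w e" using B[OF b] by simp
      finally show ?thesis by (simp add: mult.assoc)
    qed
    define Q where "Q = (B + M * w e) / (1 + w 0)"
    have "S b * exp (e * b) \<le> Q" if "b \<le> 0" for b
      unfolding Q_def using main[OF that] w0 by (simp add: field_simps)
    then have "M \<le> Q" unfolding M_def by (intro cSUP_least) auto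
    then have "M \<le> (B + M * w e) / (1 + w 0)" unfolding Q_def .
    then have "(1 + w 0) * M \<le> B + M * w e" using w0 by (simp add: field_simps)
    also have "\<dots> \<le> B + M * (w 0 + 1 / 2)" using we M0 by (intro add_left_mono mult_left_mono)
    finally have "M \<le> 2 * B" by (simp add: algebra_simps)
    with SM[OF a] have "S a * exp (e * a) * exp (- (e * a)) \<le> 2 * B * exp (- (e * a))"
      by (intro mult_right_mono) auto
    then show "S a \<le> 2 * B * exp (- e * a)" by (simp add: mult_exp_exp mult.assoc)
  qed
qed

subsection \<open>Asymptotics of solutions of the linearized equation\<close>

text \<open>For k > 0 the squared right side is integrable at -infinity and the energy stays
  bounded; for k = 0 it is merely bounded and the energy may grow linearly. The bootstrap costs a
  factor exp (- e a), which is removed by letting \<open>e\<close> depend on the endpoint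
  \<open>a\<close>.\<close>

lemma energy_bounds:
  assumes F: "\<And>t. (F has_real_derivative f t) (at t)" and f: "\<And>t. (f has_real_derivative h t) (at t)"
    and h: "continuous_on UNIV h" and sub: "subexp F" "subexp f" "subexp h" and D: "D \<le> 0"
    and S: "\<And>t. (S has_real_derivative - (h t)\<^sup>2) (at t)" "S 0 = 0"
    and k: "0 \<le> k"
    and \<beta>: "\<And>t. t \<le> 0 \<Longrightarrow> \<bar>h t + D * f t + (\<integral>v. (F (t - v) - F t + v * f t) \<partial>\<mu>)\<bar> \<le> C * exp (k * t)"
  shows "\<exists>B. \<forall>a\<le>0. S a \<le> B * (1 + (if k = 0 then \<bar>a\<bar> else 0))"
proof -
  define \<beta> where "\<beta> t = h t + D * f t + (\<integral>v. (F (t - v) - F t + v * f t) \<partial>\<mu>)" for t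
  have cF: "continuous_on UNIV F" and cf: "continuous_on UNIV f" and cS: "continuous_on UNIV S"
    by (auto intro!: continuous_at_imp_continuous_on DERIV_isCont[OF F] DERIV_isCont[OF f] DERIV_isCont[OF S(1)])
  have [simp]: "integrable \<mu> (\<lambda>v. F (t - v))" for t by (rule integrable_conv[OF cF sub(1)])
  have [simp]: "integrable \<mu> (\<lambda>v. v)" by (rule integrable_subexp) auto
  have [simp]: "integrable \<mu> (\<lambda>v. k)" for k :: real by (rule integrable_subexp) auto
  have eq: "\<beta> = (\<lambda>t. h t + D * f t + (\<integral>v. F (t - v) \<partial>\<mu>) - measure \<mu> UNIV * F t + (\<integral>v. v \<partial>\<mu>) * f t)"
    unfolding \<beta>_def by (auto simp: fun_eq_iff)
  have "continuous_on UNIV (\<lambda>t. \<integral>v. F (t - v) \<partial>\<mu>)"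
    by (intro continuous_at_imp_continuous_on ballI DERIV_isCont[OF DERIV_conv[OF F cf sub(1,2)]])
  then have "continuous_on UNIV \<beta>" unfolding eq by (intro continuous_intros h cf cF)
  then have "continuous_on UNIV (\<lambda>t. - (\<beta> t)\<^sup>2)" by (intro continuous_intros)
  then obtain G where G: "\<And>t. (G has_real_derivative - (\<beta> t)\<^sup>2) (at t)" "G 0 = 0"
    by (rule continuous_antiderivative) blast
  obtain C1 where C1: "\<And>a. a \<le> 0 \<Longrightarrow>
      S a \<le> G a + C1 + (\<integral>v. indicator {0..} v * (v\<^sup>2 * (S (a - v) - S a)) \<partial>\<mu>)"
    using energy_inequality[OF F f h sub D G(1)[unfolded \<beta>_def] S(1)] by blast
  have S_anti: "S t \<le> S s" if "s \<le> t" for s t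
    by (rule DERIV_nonpos_imp_nonincreasing[OF that]) (use S(1) in force)
  have "subexp (\<lambda>t. (- 1) * (h t * h t))" by (intro subexp_mult subexp_const sub)
  then have sS: "subexp S" by (intro subexp_antiderivative[OF _ S(1)]) (simp add: power2_eq_square)
  obtain e0 where e0: "0 < e0"
    "\<And>e B a. 0 < e \<Longrightarrow> e \<le> e0 \<Longrightarrow> (\<And>a. a \<le> 0 \<Longrightarrow> (G a + C1) * exp (e * a) \<le> B) \<Longrightarrow> a \<le> 0 \<Longrightarrow>
      S a \<le> 2 * B * exp (- e * a)"
    using energy_bootstrap[OF S_anti S(2) sS cS, of "\<lambda>a. G a + C1"] C1 by blast
  have \<beta>sq: "(\<beta> t)\<^sup>2 \<le> C\<^sup>2 * exp (2 * k * t)" if "t \<le> 0" for t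
  proof -
    have "\<bar>\<beta> t\<bar>\<^sup>2 \<le> (C * exp (k * t))\<^sup>2" using \<beta>[OF that] by (intro power_mono) (auto simp: \<beta>_def)
    then show ?thesis by (simp add: power_mult_distrib power2_eq_square mult_exp_exp mult_ac)
  qed
  have "\<exists>B0\<ge>0. \<forall>a\<le>0. G a + C1 \<le> B0 * (1 + (if k = 0 then \<bar>a\<bar> else 0))"
  proof (cases "k = 0")
    case True
    have "G a + C1 \<le> (C\<^sup>2 + \<bar>C1\<bar>) * (1 + \<bar>a\<bar>)" if a: "a \<le> 0" for a
    proof -
      have "\<bar>G a - G 0\<bar> \<le> C\<^sup>2 * \<bar>a - 0\<bar>"
        using a \<beta>sq True by (intro mean_value_bound[OF G(1)]) (auto simp: closed_segment_eq_real_ivl split: if_splits)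
      then have "G a + C1 \<le> C\<^sup>2 * \<bar>a\<bar> + \<bar>C1\<bar>" using G(2) by simp
      also have "\<dots> \<le> (C\<^sup>2 + \<bar>C1\<bar>) * (1 + \<bar>a\<bar>)" by (simp add: algebra_simps)
      finally show ?thesis .
    qed
    with True show ?thesis by (intro exI[of _ "C\<^sup>2 + \<bar>C1\<bar>"]) simp
  next
    case False
    with k have k0: "0 < 2 * k" by simp
    obtain l where l: "\<And>t. t \<le> 0 \<Longrightarrow> \<bar>G t - l\<bar> \<le> C\<^sup>2 / (2 * k) * exp (2 * k * t)"
      by (rule limit_at_minus_infinity_of_derivative_bound[OF k0 G(1), of "C\<^sup>2"]) (use \<beta>sq in auto)
    have "G a + C1 \<le> C\<^sup>2 / (2 * k) + \<bar>l\<bar> + \<bar>C1\<bar>" if a: "a \<le> 0" for a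
    proof -
      have "C\<^sup>2 / (2 * k) * exp (2 * k * a) \<le> C\<^sup>2 / (2 * k) * 1"
        using k0 a by (intro mult_left_mono) (auto simp: mult_nonneg_nonpos)
      with l[OF a] show ?thesis by linarith
    qed
    with False k0 show ?thesis by (intro exI[of _ "C\<^sup>2 / (2 * k) + \<bar>l\<bar> + \<bar>C1\<bar>"]) auto
  qed
  then obtain B0 where B0: "0 \<le> B0" "\<And>a. a \<le> 0 \<Longrightarrow> G a + C1 \<le> B0 * (1 + (if k = 0 then \<bar>a\<bar> else 0))" by blast
  have "S a \<le> 2 * B0 * exp 1 * (2 + 1 / e0) * (1 + (if k = 0 then \<bar>a\<bar> else 0))" if a: "a \<le> 0" for a
  proof -
    \<comment> \<open>With \<open>e\<close> of order 1 / (1 + |a|) the factor exp (- e a) is at most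
      exp 1, while 1 / e, the price of a linearly growing bound, is again linear in |a|.\<close>
    define e where "e = min e0 (1 / (1 + \<bar>a\<bar>))"
    have e: "0 < e" "e \<le> e0" using e0 by (auto simp: e_def)
    have "e * \<bar>a\<bar> \<le> 1 / (1 + \<bar>a\<bar>) * \<bar>a\<bar>" by (intro mult_right_mono) (auto simp: e_def)
    also have "\<dots> \<le> 1" by simp
    finally have ea: "- e * a \<le> 1" using a by simp
    have inv: "1 / e \<le> 1 / e0 + 1 + \<bar>a\<bar>" using e0(1) by (auto simp: e_def min_def)
    define j where "j = (if k = 0 then 1 else 0 :: real)"
    have j: "0 \<le> j" by (simp add: j_def)
    have "S a \<le> 2 * (B0 * (1 + j / e)) * exp (- e * a)"
    proof (rule e0(2)[OF e _ a])
      fix b :: real assume b: "b \<le> 0"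
      have "(G b + C1) * exp (e * b) \<le> (B0 * (1 + (if k = 0 then \<bar>b\<bar> else 0))) * exp (e * b)"
        by (intro mult_right_mono B0(2)[OF b]) simp
      also have "\<dots> = B0 * (exp (e * b) + j * (\<bar>b\<bar> * exp (e * b)))" by (simp add: j_def algebra_simps)
      also have "\<dots> \<le> B0 * (1 + j * (1 / e))"
      proof (intro mult_left_mono add_mono B0(1) j)
        show "exp (e * b) \<le> 1" using e b by (simp add: mult_nonneg_nonpos)
        have "\<bar>b\<bar> * exp (e * b) \<le> exp (e * \<bar>b\<bar>) / e * exp (e * b)" by (intro mult_right_mono abs_le_exp e) simp
        also have "\<dots> = 1 / e" using b by (simp add: mult_exp_exp)
        finally show "\<bar>b\<bar> * exp (e * b) \<le> 1 / e" .
      qed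
      finally show "(G b + C1) * exp (e * b) \<le> B0 * (1 + j / e)" by simp
    qed
    also have "\<dots> \<le> 2 * (B0 * (1 + j / e)) * exp 1"
      using ea B0(1) j e by (intro mult_left_mono) auto
    also have "\<dots> = 2 * B0 * exp 1 * (1 + j * (1 / e))" by simp
    also have "\<dots> \<le> 2 * B0 * exp 1 * (1 + j * (1 / e0 + 1 + \<bar>a\<bar>))"
      using inv j B0(1) by (intro mult_left_mono add_left_mono) auto
    also have "\<dots> \<le> 2 * B0 * exp 1 * ((2 + 1 / e0) * (1 + (if k = 0 then \<bar>a\<bar> else 0)))"
      using B0(1) e0(1) by (intro mult_left_mono) (auto simp: j_def algebra_simps)
    finally show ?thesis by (simp add: mult.assoc)
  qed
  then show ?thesis by blast
qed

text \<open>If |p - q| were at least \<open>\<eta> * \<omega> t\<close> at t, the Harnack inequality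
  for \<open>p\<close> and the Lipschitz bound for \<open>q\<close> would keep it above half its
  value on a window [t - \<sigma>, t] of fixed length, whose energy would then be at least of order
  \<open>(\<omega> t)\<^sup>2\<close>.\<close>

lemma harnack_pointwise:
  fixes p q \<omega> S :: "real \<Rightarrow> real"
  assumes p: "\<And>t. 0 < p t" and harnack: "\<And>t s. p (t + s) \<le> exp (\<rho> * \<bar>s\<bar>) * p t" and \<rho>: "0 \<le> \<rho>"
    and q: "\<And>s t. \<bar>q s - q t\<bar> \<le> Q * \<bar>s - t\<bar>" "\<And>t. t \<le> - 1 \<Longrightarrow> \<bar>q t\<bar> \<le> Q * \<omega> t" and Q: "0 \<le> Q"
    and \<omega>: "\<And>t. t \<le> - 1 \<Longrightarrow> 1 \<le> \<omega> t"
    and S: "\<And>t. (S has_real_derivative - (p t - q t)\<^sup>2) (at t)"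
    and lim: "\<And>\<sigma>. 0 < \<sigma> \<Longrightarrow> ((\<lambda>t. (S (t - \<sigma>) - S t) / (\<omega> t)\<^sup>2) \<longlongrightarrow> 0) at_bot"
  shows "((\<lambda>t. (p t - q t) / \<omega> t) \<longlongrightarrow> 0) at_bot"
proof (rule tendstoI)
  fix \<eta> :: real assume \<eta>: "0 < \<eta>"
  \<comment> \<open>Let H be the value of |p - q| at t. Relative to H, the first term bounds the
    oscillation of \<open>p\<close> on the window, because p t \<le> (Q / \<eta> + 1) H, and the
    second that of \<open>q\<close>, because \<eta> \<le> H. The sum has to stay below 1/2.\<close>
  have "((\<lambda>\<sigma>. (exp (\<rho> * \<sigma>) - 1) * (Q / \<eta> + 1) + Q * \<sigma> / \<eta>) \<longlongrightarrow> (exp (\<rho> * 0) - 1) * (Q / \<eta> + 1) + Q * 0 / \<eta>) (at_right 0)"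
    using \<eta> by (intro tendsto_intros) auto
  then have "\<forall>\<^sub>F \<sigma> in at_right 0. (exp (\<rho> * \<sigma>) - 1) * (Q / \<eta> + 1) + Q * \<sigma> / \<eta> < 1 / 2"
    by (rule order_tendstoD) simp
  moreover have "\<forall>\<^sub>F \<sigma> in at_right 0. (0::real) < \<sigma>" by (simp add: eventually_at_right_less)
  ultimately have "\<forall>\<^sub>F \<sigma> in at_right 0. 0 < \<sigma> \<and> (exp (\<rho> * \<sigma>) - 1) * (Q / \<eta> + 1) + Q * \<sigma> / \<eta> < 1 / 2"
    by eventually_elim auto
  then obtain \<sigma> where \<sigma>: "0 < \<sigma>" "(exp (\<rho> * \<sigma>) - 1) * (Q / \<eta> + 1) + Q * \<sigma> / \<eta> < 1 / 2"
    using eventually_happens'[OF trivial_limit_at_right_real] by blast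
  have "0 < \<sigma> * \<eta>\<^sup>2 / 4" using \<sigma> \<eta> by simp
  from order_tendstoD(2)[OF lim[OF \<sigma>(1)] this]
  have "\<forall>\<^sub>F t in at_bot. (S (t - \<sigma>) - S t) / (\<omega> t)\<^sup>2 < \<sigma> * \<eta>\<^sup>2 / 4" .
  moreover have "\<forall>\<^sub>F t in at_bot. t \<le> (- 1 :: real)" by (rule eventually_le_at_bot)
  ultimately show "\<forall>\<^sub>F t in at_bot. dist ((p t - q t) / \<omega> t) 0 < \<eta>"
  proof eventually_elim
    case (elim t)
    define H where "H = \<bar>p t - q t\<bar>"
    have w1: "1 \<le> \<omega> t" using \<omega> elim by auto
    show ?case
    proof (rule ccontr)
      assume "\<not> ?thesis"
      then have H: "\<eta> * \<omega> t \<le> H" using w1 by (simp add: H_def abs_divide field_simps)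
      have H0: "0 < H" using H \<eta> w1 by (smt (verit) mult_pos_pos)
      have low: "H / 2 \<le> \<bar>p x - q x\<bar>" if x: "t - \<sigma> \<le> x" "x \<le> t" for x
      proof -
        define s where "s = x - t"
        have s: "\<bar>s\<bar> \<le> \<sigma>" using x by (auto simp: s_def)
        have E: "exp (\<rho> * \<bar>s\<bar>) \<le> exp (\<rho> * \<sigma>)" using s \<rho> by (auto intro: mult_left_mono)
        have up: "p x \<le> exp (\<rho> * \<bar>s\<bar>) * p t" using harnack[of t s] by (simp add: s_def)
        have dn: "p t \<le> exp (\<rho> * \<bar>s\<bar>) * p x" using harnack[of x "- s"] by (simp add: s_def abs_minus_commute)
        have e1: "1 \<le> exp (\<rho> * \<bar>s\<bar>)" using \<rho> by simp
        have "p t - p x \<le> (exp (\<rho> * \<bar>s\<bar>) - 1) * p t"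
        proof (cases "p x \<le> p t")
          case True
          then have "(exp (\<rho> * \<bar>s\<bar>) - 1) * p x \<le> (exp (\<rho> * \<bar>s\<bar>) - 1) * p t" using e1 by (intro mult_left_mono) auto
          with dn show ?thesis by (simp add: algebra_simps)
        next
          case False
          have "0 \<le> (exp (\<rho> * \<bar>s\<bar>) - 1) * p t" using e1 p[of t] by (intro mult_nonneg_nonneg) auto
          with False show ?thesis by linarith
        qed
        with up have "\<bar>p x - p t\<bar> \<le> (exp (\<rho> * \<bar>s\<bar>) - 1) * p t" by (simp add: abs_le_iff algebra_simps)
        also have "\<dots> \<le> (exp (\<rho> * \<sigma>) - 1) * (Q * \<omega> t + H)"
          using E e1 p[of t] q(2)[of t] elim by (intro mult_mono) (auto simp: H_def)
        also have "\<dots> \<le> (exp (\<rho> * \<sigma>) - 1) * ((Q / \<eta> + 1) * H)"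
        proof (intro mult_left_mono)
          have "Q * \<omega> t = (Q / \<eta>) * (\<eta> * \<omega> t)" using \<eta> by simp
          also have "\<dots> \<le> (Q / \<eta>) * H" using H Q \<eta> by (intro mult_left_mono) auto
          finally show "Q * \<omega> t + H \<le> (Q / \<eta> + 1) * H" by (simp add: distrib_right)
        qed (use E e1 in auto)
        finally have A: "\<bar>p x - p t\<bar> \<le> (exp (\<rho> * \<sigma>) - 1) * (Q / \<eta> + 1) * H" by (simp add: mult.assoc)
        have "\<eta> \<le> H" using H w1 \<eta> by (smt (verit) mult_le_cancel_left1)
        then have "Q * \<sigma> * 1 \<le> Q * \<sigma> * (H / \<eta>)" using \<eta> Q \<sigma> by (intro mult_left_mono) (auto simp: field_simps)
        moreover have "\<bar>q x - q t\<bar> \<le> Q * \<sigma>"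
          using q(1)[of x t] mult_left_mono[OF s Q] by (simp add: s_def)
        ultimately have B: "\<bar>q x - q t\<bar> \<le> Q * \<sigma> / \<eta> * H" by simp
        have "\<bar>p x - p t\<bar> + \<bar>q x - q t\<bar> \<le> ((exp (\<rho> * \<sigma>) - 1) * (Q / \<eta> + 1) + Q * \<sigma> / \<eta>) * H"
          using A B by (simp add: distrib_right)
        also have "\<dots> \<le> 1 / 2 * H" using \<sigma>(2) H0 by (intro mult_right_mono) auto
        finally have "\<bar>p x - p t\<bar> + \<bar>q x - q t\<bar> \<le> 1 / 2 * H" .
        moreover have "H \<le> \<bar>p x - q x\<bar> + (\<bar>p x - p t\<bar> + \<bar>q x - q t\<bar>)" unfolding H_def by arith
        ultimately show ?thesis by linarith
      qed
      have "S t + (H / 2)\<^sup>2 * t \<le> S (t - \<sigma>) + (H / 2)\<^sup>2 * (t - \<sigma>)"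
      proof (rule DERIV_nonpos_imp_nonincreasing[where f = "\<lambda>x. S x + (H / 2)\<^sup>2 * x"])
        fix x assume "t - \<sigma> \<le> x" "x \<le> t"
        from low[OF this] have "(H / 2)\<^sup>2 \<le> \<bar>p x - q x\<bar>\<^sup>2" using H0 by (intro power_mono) auto
        then show "\<exists>y. ((\<lambda>x. S x + (H / 2)\<^sup>2 * x) has_real_derivative y) (at x) \<and> y \<le> 0"
          by (intro exI[of _ "- (p x - q x)\<^sup>2 + (H / 2)\<^sup>2"])
            (auto intro!: derivative_eq_intros S)
      qed (use \<sigma> in simp)
      then have "(H / 2)\<^sup>2 * \<sigma> \<le> S (t - \<sigma>) - S t" by (simp add: algebra_simps)
      moreover have "S (t - \<sigma>) - S t < \<sigma> * \<eta>\<^sup>2 / 4 * (\<omega> t)\<^sup>2"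
        using elim w1 by (simp add: pos_divide_less_eq)
      moreover have "(\<eta> * \<omega> t)\<^sup>2 \<le> H\<^sup>2" using H \<eta> w1 by (intro power_mono) auto
      then have "\<sigma> * ((\<eta> * \<omega> t)\<^sup>2 / 4) \<le> \<sigma> * (H\<^sup>2 / 4)" using \<sigma> by (intro mult_left_mono) auto
      ultimately show False by (simp add: power_mult_distrib power_divide algebra_simps)
    qed
  qed
qed

text \<open>In the application \<open>p\<close> is the profile divided by exp (l t) and
  \<open>D\<close> is the slope of \<open>chi_0\<close> at l. Two integrations turn the
  exponentially small right side into l1 t + l0 plus a small error. A polynomial added to the twice
  integrated \<open>p\<close> cancels this, for D = 0 up to a bounded term; its second derivative is
  minus the limit profile.\<close>

lemma asymptotics_linear:
  assumes p: "\<And>t. (p has_real_derivative p' t) (at t)" and p': "\<And>t. (p' has_real_derivative p'' t) (at t)"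
    and pos: "\<And>t. 0 < p t" and sub: "subexp p"
    and harnack: "\<And>t s. p (t + s) \<le> exp (\<rho> * \<bar>s\<bar>) * p t" and \<rho>: "0 \<le> \<rho>"
    and eq: "\<And>t. t \<le> 0 \<Longrightarrow>
      \<bar>p'' t + (D + (\<integral>v. v \<partial>\<mu>)) * p' t + (\<integral>v. (p (t - v) - p t) \<partial>\<mu>)\<bar> \<le> C * exp (k * t)"
    and k: "0 < k" and D: "D \<le> 0"
  shows "D < 0 \<Longrightarrow> \<exists>A\<ge>0. (p \<longlongrightarrow> A) at_bot"
    and "D = 0 \<Longrightarrow> \<exists>A\<ge>0. ((\<lambda>t. p t / (- t)) \<longlongrightarrow> A) at_bot"
proof -
  have cp: "continuous_on UNIV p" by (intro continuous_at_imp_continuous_on ballI DERIV_isCont[OF p])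
  obtain f where f: "\<And>t. (f has_real_derivative p t) (at t)"
    using continuous_antiderivative[OF cp] by metis
  have cf: "continuous_on UNIV f" by (intro continuous_at_imp_continuous_on ballI DERIV_isCont[OF f])
  obtain F where F: "\<And>t. (F has_real_derivative f t) (at t)"
    using continuous_antiderivative[OF cf] by metis
  have cF: "continuous_on UNIV F" by (intro continuous_at_imp_continuous_on ballI DERIV_isCont[OF F])
  have sf: "subexp f" by (rule subexp_antiderivative[OF sub f])
  have sF: "subexp F" by (rule subexp_antiderivative[OF sf F])
  define m0 m1 m2 m3 where "m0 = measure \<mu> UNIV" "m1 = (\<integral>v. v \<partial>\<mu>)" "m2 = (\<integral>v. v\<^sup>2 \<partial>\<mu>)" "m3 = (\<integral>v. v ^ 3 \<partial>\<mu>)"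
  note m = this
  have [simp]: "integrable \<mu> (\<lambda>v. F (t - v))" "integrable \<mu> (\<lambda>v. f (t - v))" "integrable \<mu> (\<lambda>v. p (t - v))" for t
    using integrable_conv[OF cF sF] integrable_conv[OF cf sf] integrable_conv[OF cp sub] by auto
  have [simp]: "integrable \<mu> (\<lambda>v. v)" by (rule integrable_subexp) auto
  have [simp]: "integrable \<mu> (\<lambda>v. k)" for k :: real by (rule integrable_subexp) auto
  have sq: "subexp (\<lambda>v. v\<^sup>2)" using subexp_mult[OF subexp_id subexp_id] by (simp add: power2_eq_square)
  have cub: "subexp (\<lambda>v. v ^ 3)"
    using subexp_mult[OF subexp_id subexp_mult[OF subexp_id subexp_id]] by (simp add: power3_eq_cube mult.assoc)
  have [simp]: "integrable \<mu> (\<lambda>v. v\<^sup>2)" by (rule integrable_subexp[OF _ sq]) simp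
  have [simp]: "integrable \<mu> (\<lambda>v. v ^ 3)" by (rule integrable_subexp[OF _ cub]) simp
  have m2: "0 \<le> m2" unfolding m by (rule integral_nonneg_AE) auto

  \<comment> \<open>The twice integrated left side of the equation; \<open>DERIV_conv\<close> lets
    differentiation pass through the convolution.\<close>
  define u where "u t = p t + (D + m1) * f t + (\<integral>v. F (t - v) \<partial>\<mu>) - m0 * F t" for t
  define u' where "u' t = p' t + (D + m1) * p t + (\<integral>v. f (t - v) \<partial>\<mu>) - m0 * f t" for t
  define u'' where "u'' t = p'' t + (D + m1) * p' t + (\<integral>v. p (t - v) \<partial>\<mu>) - m0 * p t" for t
  have du: "(u has_real_derivative u' t) (at t)" for t
    unfolding u_def u'_def by (auto intro!: derivative_eq_intros p f F DERIV_conv[OF F cf sF sf])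
  have du': "(u' has_real_derivative u'' t) (at t)" for t
    unfolding u''_def u'_def by (auto intro!: derivative_eq_intros p p' f DERIV_conv[OF f cp sf sub])
  have "\<bar>u'' t\<bar> \<le> C * exp (k * t)" if "t \<le> 0" for t
    using eq[OF that] by (simp add: u''_def m algebra_simps)
  then obtain l1 where l1: "\<And>t. t \<le> 0 \<Longrightarrow> \<bar>u' t - l1\<bar> \<le> C / k * exp (k * t)"
    using limit_at_minus_infinity_of_derivative_bound[OF k du', of C] by metis
  have "((\<lambda>t. u t - l1 * t) has_real_derivative u' t - l1) (at t)" for t
    by (auto intro!: derivative_eq_intros du)
  from limit_at_minus_infinity_of_derivative_bound[OF k this, of "C / k"] l1
  obtain l0 where l0: "\<And>t. t \<le> 0 \<Longrightarrow> \<bar>u t - l1 * t - l0\<bar> \<le> C / k / k * exp (k * t)" by metis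
  define C' where "C' = C / k / k"

  \<comment> \<open>A cubic added to \<open>F\<close> turns \<open>p\<close> into p + A3 t + A2 and
    adds polynomial terms to \<open>u\<close>. The quadratic one has the coefficient D A3 / 2,
    whence the condition that this product vanishes.\<close>
  have bounds: "\<exists>B. \<forall>a\<le>0. S a \<le> B * (1 + (if j = 0 then \<bar>a\<bar> else 0))"
    if A: "D * A3 = 0" and j: "0 \<le> j"
      and S: "\<And>t. (S has_real_derivative - (p t + A3 * t + A2)\<^sup>2) (at t)" "S 0 = 0"
      and \<beta>: "\<And>t. t \<le> 0 \<Longrightarrow> \<bar>u t + A3 * ((1 + m2 / 2) * t - m3 / 6) + A2 * (1 + m2 / 2 + D * t) + A1 * D\<bar>
        \<le> B1 * exp (j * t)"
    for A1 A2 A3 j B1 :: real and S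
  proof (rule energy_bounds[where F = "\<lambda>t. F t + A3 * t ^ 3 / 6 + A2 * t\<^sup>2 / 2 + A1 * t"
        and f = "\<lambda>t. f t + A3 * t\<^sup>2 / 2 + A2 * t + A1" and h = "\<lambda>t. p t + A3 * t + A2" and D = D and C = B1 and k = j])
    show "((\<lambda>t. F t + A3 * t ^ 3 / 6 + A2 * t\<^sup>2 / 2 + A1 * t) has_real_derivative
        f t + A3 * t\<^sup>2 / 2 + A2 * t + A1) (at t)" for t
      by (auto intro!: derivative_eq_intros F)
    show df: "((\<lambda>t. f t + A3 * t\<^sup>2 / 2 + A2 * t + A1) has_real_derivative p t + A3 * t + A2) (at t)" for t
      by (auto intro!: derivative_eq_intros f)
    show "continuous_on UNIV (\<lambda>t. p t + A3 * t + A2)" by (intro continuous_intros cp)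
    show sh: "subexp (\<lambda>t. p t + A3 * t + A2)" by (intro subexp_add subexp_mult subexp_const subexp_id sub)
    show sf': "subexp (\<lambda>t. f t + A3 * t\<^sup>2 / 2 + A2 * t + A1)" by (rule subexp_antiderivative[OF sh df])
    show "subexp (\<lambda>t. F t + A3 * t ^ 3 / 6 + A2 * t\<^sup>2 / 2 + A1 * t)"
      by (rule subexp_antiderivative[OF sf']) (auto intro!: derivative_eq_intros F)
    fix t :: real assume t: "t \<le> 0"
    have "(\<integral>v. (F (t - v) + A3 * (t - v) ^ 3 / 6 + A2 * (t - v)\<^sup>2 / 2 + A1 * (t - v)
          - (F t + A3 * t ^ 3 / 6 + A2 * t\<^sup>2 / 2 + A1 * t) + v * (f t + A3 * t\<^sup>2 / 2 + A2 * t + A1)) \<partial>\<mu>)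
        = (\<integral>v. (F (t - v) - F t + f t * v + (A3 * t / 2 + A2 / 2) * v\<^sup>2 - (A3 / 6) * v ^ 3) \<partial>\<mu>)"
      by (intro Bochner_Integration.integral_cong)
        (simp_all add: power2_eq_square power3_eq_cube field_simps)
    also have "\<dots> = (\<integral>v. F (t - v) \<partial>\<mu>) - m0 * F t + f t * m1 + (A3 * t / 2 + A2 / 2) * m2 - (A3 / 6) * m3"
      by (simp add: m)
    finally have eq: "p t + A3 * t + A2 + D * (f t + A3 * t\<^sup>2 / 2 + A2 * t + A1)
        + (\<integral>v. (F (t - v) + A3 * (t - v) ^ 3 / 6 + A2 * (t - v)\<^sup>2 / 2 + A1 * (t - v)
          - (F t + A3 * t ^ 3 / 6 + A2 * t\<^sup>2 / 2 + A1 * t) + v * (f t + A3 * t\<^sup>2 / 2 + A2 * t + A1)) \<partial>\<mu>)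
      = u t + A3 * ((1 + m2 / 2) * t - m3 / 6) + A2 * (1 + m2 / 2 + D * t) + A1 * D + (D * A3) * (t\<^sup>2 / 2)"
      unfolding u_def by (simp add: field_simps)
    show "\<bar>p t + A3 * t + A2 + D * (f t + A3 * t\<^sup>2 / 2 + A2 * t + A1)
        + (\<integral>v. (F (t - v) + A3 * (t - v) ^ 3 / 6 + A2 * (t - v)\<^sup>2 / 2 + A1 * (t - v)
          - (F t + A3 * t ^ 3 / 6 + A2 * t\<^sup>2 / 2 + A1 * t) + v * (f t + A3 * t\<^sup>2 / 2 + A2 * t + A1)) \<partial>\<mu>)\<bar>
      \<le> B1 * exp (j * t)" unfolding eq A using \<beta>[OF t] by simp
  qed (use D j S in auto)

  have antiS: "\<exists>S. (\<forall>t. (S has_real_derivative - (p t + A3 * t + A2)\<^sup>2) (at t)) \<and> S 0 = 0" for A3 A2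
  proof -
    have "continuous_on UNIV (\<lambda>t. - (p t + A3 * t + A2)\<^sup>2)" by (intro continuous_intros cp)
    from continuous_antiderivative[OF this] show ?thesis by metis
  qed

  show "\<exists>A\<ge>0. (p \<longlongrightarrow> A) at_bot" if D0: "D < 0"
  proof -
    \<comment> \<open>For D < 0 the condition D A3 = 0 leaves a constant profile: \<open>A2\<close>
      cancels the slope \<open>l1\<close> and \<open>A1\<close> the remaining constant.\<close>
    define A2 where "A2 = - l1 / D"
    define A1 where "A1 = - (l0 + A2 * (1 + m2 / 2)) / D"
    obtain S where S: "\<And>t. (S has_real_derivative - (p t + 0 * t + A2)\<^sup>2) (at t)" "S 0 = 0"
      using antiS by blast
    have A12: "A2 * (1 + m2 / 2 + D * t) + A1 * D = - l1 * t - l0" for t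
      using D0 by (simp add: A1_def A2_def field_simps)
    have "\<exists>B. \<forall>a\<le>0. S a \<le> B * (1 + (if k = 0 then \<bar>a\<bar> else 0))"
    proof (rule bounds[where ?A3.0 = 0 and ?A2.0 = A2 and ?A1.0 = A1 and ?B1.0 = C'])
      show "\<bar>u t + 0 * ((1 + m2 / 2) * t - m3 / 6) + A2 * (1 + m2 / 2 + D * t) + A1 * D\<bar> \<le> C' * exp (k * t)"
        if "t \<le> 0" for t
        using l0[OF that] A12[of t] unfolding C'_def by (simp add: add.assoc diff_diff_eq)
    qed (use S k in auto)
    with k obtain B where B: "\<And>a. a \<le> 0 \<Longrightarrow> S a \<le> B" by auto
    have S_anti: "S t \<le> S s" if "s \<le> t" for s t
      by (rule DERIV_nonpos_imp_nonincreasing[OF that]) (use S(1) in force)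
    \<comment> \<open>\<open>S\<close> is monotone and bounded, hence convergent at -infinity, so
      the energy of a window of fixed length tends to 0.\<close>
    have "\<exists>l. (S \<longlongrightarrow> l) at_bot"
    proof -
      have "((\<lambda>t. - S (- t)) \<longlongrightarrow> - (SUP t\<in>{..0}. S t)) at_top"
      proof (rule decreasing_tendsto)
        have bdd: "bdd_above (S ` {..0})" using B by (auto intro!: bdd_aboveI2)
        show "\<forall>\<^sub>F t in at_top. - (SUP t\<in>{..0}. S t) \<le> - S (- t)"
          using eventually_ge_at_top[of 0] by eventually_elim (auto intro!: cSUP_upper bdd)
        fix x assume "- (SUP t\<in>{..0}. S t) < x"
        then have "- x < (SUP t\<in>{..0}. S t)" by linarith
        then obtain s where s: "s \<le> 0" "- x < S s" using bdd by (auto simp: less_cSUP_iff)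
        show "\<forall>\<^sub>F t in at_top. - S (- t) < x"
          using eventually_ge_at_top[of "- s"]
        proof eventually_elim
          case (elim t)
          then have "S s \<le> S (- t)" by (intro S_anti) auto
          with s show ?case by linarith
        qed
      qed
      then have "((\<lambda>t. S (- t)) \<longlongrightarrow> (SUP t\<in>{..0}. S t)) at_top" by (simp add: tendsto_minus_cancel_left)
      then show ?thesis by (auto simp: at_bot_mirror filterlim_filtermap)
    qed
    then obtain l where l: "(S \<longlongrightarrow> l) at_bot" by blast
    have "((\<lambda>t. (p t - (- A2)) / 1) \<longlongrightarrow> 0) at_bot"
    proof (rule harnack_pointwise[OF pos harnack \<rho>, where Q = "\<bar>A2\<bar>" and S = S])
      fix \<sigma> :: real assume \<sigma>: "0 < \<sigma>"
      have "\<forall>\<^sub>F t in at_bot. t - \<sigma> \<le> Z" for Z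
        using eventually_le_at_bot[of Z] by eventually_elim (use \<sigma> in simp)
      then have "filterlim (\<lambda>t. t - \<sigma>) at_bot at_bot" by (simp add: filterlim_at_bot)
      from tendsto_diff[OF filterlim_compose[OF l this] l]
      show "((\<lambda>t. (S (t - \<sigma>) - S t) / 1\<^sup>2) \<longlongrightarrow> 0) at_bot" by simp
    next
      show "(S has_real_derivative - (p t - - A2)\<^sup>2) (at t)" for t using S(1)[of t] by simp
    qed simp_all
    from tendsto_add[OF this tendsto_const[of "- A2"]] have "(p \<longlongrightarrow> - A2) at_bot" by simp
    moreover from this have "0 \<le> - A2"
      by (rule tendsto_lowerbound[OF _ always_eventually]) (simp_all add: less_imp_le[OF pos])
    ultimately show ?thesis by blast
  qed

  show "\<exists>A\<ge>0. ((\<lambda>t. p t / (- t)) \<longlongrightarrow> A) at_bot" if D0: "D = 0"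
  proof -
    \<comment> \<open>For D = 0 the slope \<open>l1\<close> has to be cancelled by a linear profile.
      In the application 1 + m2 / 2 is half the second derivative of \<open>chi_0\<close> at the
      double zero. The bounded rest makes the energy grow at most linearly, which is negligible
      against t^2.\<close>
    define A3 where "A3 = - l1 / (1 + m2 / 2)"
    obtain S where S: "\<And>t. (S has_real_derivative - (p t + A3 * t + 0)\<^sup>2) (at t)" "S 0 = 0"
      using antiS by blast
    have A3: "A3 * ((1 + m2 / 2) * t - m3 / 6) = - l1 * t - A3 * m3 / 6" for t
      using m2 by (simp add: A3_def field_simps)
    have C'0: "0 \<le> C'" using order_trans[OF abs_ge_zero l0[of 0]] by (simp add: C'_def)
    have "\<exists>B. \<forall>a\<le>0. S a \<le> B * (1 + (if (0::real) = 0 then \<bar>a\<bar> else 0))"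
    proof (rule bounds[where ?A3.0 = A3 and ?A2.0 = 0 and ?A1.0 = 0 and ?B1.0 = "C' + \<bar>l0\<bar> + \<bar>A3 * m3 / 6\<bar>"])
      fix t :: real assume t: "t \<le> 0"
      have "C' * exp (k * t) \<le> C' * 1" using C'0 k t by (intro mult_left_mono) (auto simp: mult_nonneg_nonpos)
      then show "\<bar>u t + A3 * ((1 + m2 / 2) * t - m3 / 6) + 0 * (1 + m2 / 2 + D * t) + 0 * D\<bar>
          \<le> (C' + \<bar>l0\<bar> + \<bar>A3 * m3 / 6\<bar>) * exp (0 * t)"
        using l0[OF t] unfolding A3 C'_def[symmetric] by simp
    qed (simp_all add: D0 S[simplified])
    then obtain B where B: "\<And>a. a \<le> 0 \<Longrightarrow> S a \<le> B * (1 + \<bar>a\<bar>)" unfolding if_P[OF refl] by blast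
    have S_anti: "S t \<le> S s" if "s \<le> t" for s t
      by (rule DERIV_nonpos_imp_nonincreasing[OF that]) (use S(1) in force)
    have "((\<lambda>t. (p t - (- A3 * t)) / (- t)) \<longlongrightarrow> 0) at_bot"
    proof (rule harnack_pointwise[OF pos harnack \<rho>, where Q = "\<bar>A3\<bar>" and S = S])
      fix \<sigma> :: real assume \<sigma>: "0 < \<sigma>"
      have "((\<lambda>t::real. (1 + \<sigma> - t) / t\<^sup>2) \<longlongrightarrow> 0) at_bot" by real_asymp
      from tendsto_mult_left[OF this, of B]
      have lim: "((\<lambda>t::real. B * (1 - t + \<sigma>) / t\<^sup>2) \<longlongrightarrow> 0) at_bot" by (simp add: algebra_simps)
      have up: "\<forall>\<^sub>F t in at_bot. (S (t - \<sigma>) - S t) / (- t)\<^sup>2 \<le> B * (1 - t + \<sigma>) / t\<^sup>2"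
        using eventually_le_at_bot[of 0]
      proof eventually_elim
        case (elim t)
        then have "S (t - \<sigma>) - S t \<le> B * (1 - t + \<sigma>)"
          using B[of "t - \<sigma>"] S_anti[of t 0] S(2) \<sigma> by (simp add: algebra_simps)
        then show ?case by (simp add: divide_right_mono)
      qed
      have lo: "\<forall>\<^sub>F t in at_bot. 0 \<le> (S (t - \<sigma>) - S t) / (- t)\<^sup>2"
      proof (intro always_eventually allI divide_nonneg_nonneg)
        show "0 \<le> S (t - \<sigma>) - S t" for t using S_anti[of "t - \<sigma>" t] \<sigma> by simp
      qed simp
      show "((\<lambda>t. (S (t - \<sigma>) - S t) / (- t)\<^sup>2) \<longlongrightarrow> 0) at_bot"
        by (rule tendsto_sandwich[OF lo up tendsto_const lim])
    next
      have "- A3 * s - - A3 * t = - (A3 * (s - t))" for s t by (simp add: algebra_simps)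
      then show "\<bar>- A3 * s - - A3 * t\<bar> \<le> \<bar>A3\<bar> * \<bar>s - t\<bar>" for s t
        by (simp only: abs_minus_cancel abs_mult order_refl)
      show "\<bar>- A3 * t\<bar> \<le> \<bar>A3\<bar> * - t" if "t \<le> - 1" for t
        using that by (simp add: abs_mult)
      show "(S has_real_derivative - (p t - - A3 * t)\<^sup>2) (at t)" for t using S(1)[of t] by simp
    qed simp_all
    from tendsto_add[OF this tendsto_const[of A3]]
    have "((\<lambda>t. (p t - (- A3 * t)) / (- t) + A3) \<longlongrightarrow> A3) at_bot" by simp
    moreover have "\<forall>\<^sub>F t in at_bot. (p t - (- A3 * t)) / (- t) + A3 = p t / (- t)"
      using eventually_le_at_bot[of "- 1"] by eventually_elim (simp add: field_simps)
    ultimately have *: "((\<lambda>t. p t / (- t)) \<longlongrightarrow> A3) at_bot" by (rule Lim_transform_eventually)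
    moreover have "\<forall>\<^sub>F t in at_bot. 0 \<le> p t / (- t)"
      using eventually_le_at_bot[of "- 1"]
      by eventually_elim (rule divide_nonneg_nonneg[OF less_imp_le[OF pos]], simp)
    from tendsto_lowerbound[OF * this] have "0 \<le> A3" by simp
    ultimately show ?thesis by blast
  qed
qed

end

section \<open>Wave profiles\<close>

text \<open>The operator factors as \<open>(D - r1) (D - r2)\<close>, and positivity of \<open>\<phi>\<close> on the whole line forces
  \<open>(D - r1) \<phi> \<ge> 0\<close>.\<close>

lemma exp_monotone_of_supersolution:
  fixes \<phi> :: "real \<Rightarrow> real"
  assumes pos: "\<And>t. 0 < \<phi> t" and der: "\<And>t. (\<phi> has_real_derivative \<phi>' t) (at t)"
    and der2: "\<And>t. (\<phi>' has_real_derivative \<phi>'' t) (at t)"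
    and le: "\<And>t. \<phi>'' t - (r1 + r2) * \<phi>' t + r1 * r2 * \<phi> t \<le> 0" and r: "r1 < 0" "0 < r2"
    and st: "s \<le> t"
  shows "\<phi> s * exp (- r1 * s) \<le> \<phi> t * exp (- r1 * t)"
proof -
  define w where "w t = \<phi>' t - r1 * \<phi> t" for t
  define y where "y t = w t * exp (- r2 * t)" for t
  define z where "z t = \<phi> t * exp (- r1 * t)" for t
  have dy: "(y has_real_derivative (\<phi>'' t - (r1 + r2) * \<phi>' t + r1 * r2 * \<phi> t) * exp (- r2 * t)) (at t)" for t
    unfolding y_def w_def by (auto intro!: derivative_eq_intros der der2 simp: algebra_simps)
  have dz: "(z has_real_derivative w t * exp (- r1 * t)) (at t)" for t
    unfolding z_def w_def by (auto intro!: derivative_eq_intros der simp: algebra_simps)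
  have y_anti: "y t \<le> y s" if "s \<le> t" for s t
  proof (rule DERIV_nonpos_imp_nonincreasing[OF that])
    fix x
    show "\<exists>l. (y has_real_derivative l) (at x) \<and> l \<le> 0"
      using dy[of x] mult_nonpos_nonneg[OF le[of x] exp_ge_zero[of "- r2 * x"]] by blast
  qed
  \<comment> \<open>If \<open>w\<close> were negative at \<open>t1\<close>, then \<open>z\<close>
    would decrease at a rate of at least \<open>\<eta>\<close> after \<open>t1\<close>, because
    \<open>y\<close> is nonincreasing; at the point \<open>t\<close> it would be negative, against
    the positivity of \<open>\<phi>\<close>.\<close>
  have w0: "0 \<le> w t1" for t1
  proof (rule ccontr)
    assume "\<not> 0 \<le> w t1"
    then have neg: "y t1 < 0" by (simp add: y_def mult_neg_pos)
    define \<eta> where "\<eta> = - y t1 * exp ((r2 - r1) * t1)"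
    have \<eta>: "0 < \<eta>" using mult_neg_pos[OF neg exp_gt_zero[of "(r2 - r1) * t1"]] by (simp add: \<eta>_def)
    define t where "t = t1 + z t1 / \<eta> + 1"
    have z1: "0 < z t1" using pos by (simp add: z_def)
    then have t: "t1 \<le> t" using \<eta> by (simp add: t_def)
    have "z t + \<eta> * t \<le> z t1 + \<eta> * t1"
    proof (rule DERIV_nonpos_imp_nonincreasing[OF t, where f = "\<lambda>t. z t + \<eta> * t"])
      fix x assume x: "t1 \<le> x" "x \<le> t"
      have "w x * exp (- r1 * x) = y x * exp ((r2 - r1) * x)"
        by (simp add: y_def mult.assoc mult_exp_exp algebra_simps)
      also have "\<dots> \<le> y t1 * exp ((r2 - r1) * x)" using y_anti[OF x(1)] by (intro mult_right_mono) auto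
      also have "\<dots> \<le> y t1 * exp ((r2 - r1) * t1)"
        using neg r x(1) by (intro mult_left_mono_neg) auto
      finally have "w x * exp (- r1 * x) + \<eta> \<le> 0" by (simp add: \<eta>_def)
      moreover have "((\<lambda>t. z t + \<eta> * t) has_real_derivative w x * exp (- r1 * x) + \<eta>) (at x)"
        by (auto intro!: derivative_eq_intros dz)
      ultimately show "\<exists>l. ((\<lambda>t. z t + \<eta> * t) has_real_derivative l) (at x) \<and> l \<le> 0" by blast
    qed
    moreover have "\<eta> * t = \<eta> * t1 + z t1 + \<eta>" using \<eta> by (simp add: t_def field_simps)
    ultimately have "z t < 0" using \<eta> by simp
    with pos[of t] show False by (simp add: z_def mult_less_0_iff not_less_iff_gr_or_eq)
  qed
  have "z s \<le> z t"
    by (rule DERIV_nonneg_imp_nondecreasing[OF st]) (use dz w0 in \<open>force\<close>)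
  then show ?thesis by (simp add: z_def)
qed

text \<open>The roots r1 < 0 < r2 of r^2 - c r - M make exp (- r1 t) \<phi> nondecreasing. The
  reflected function satisfies the same kind of inequality with the roots - r2 and - r1, so exp (-
  r2 t) \<phi> is nonincreasing. Together the two rates bound the growth in either
  direction.\<close>

lemma harnack_of_supersolution:
  fixes \<phi> :: "real \<Rightarrow> real"
  assumes pos: "\<And>t. 0 < \<phi> t" and der: "\<And>t. (\<phi> has_real_derivative \<phi>' t) (at t)"
    and der2: "\<And>t. (\<phi>' has_real_derivative \<phi>'' t) (at t)"
    and le: "\<And>t. \<phi>'' t - c * \<phi>' t - M * \<phi> t \<le> 0" and M: "0 < M"
  obtains \<rho> where "0 \<le> \<rho>" "\<And>t s. \<phi> (t + s) \<le> exp (\<rho> * \<bar>s\<bar>) * \<phi> t"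
proof -
  define d where "d = sqrt (c\<^sup>2 + 4 * M)"
  have d2: "d\<^sup>2 = c\<^sup>2 + 4 * M" using M by (simp add: d_def)
  have "sqrt (c\<^sup>2) < d" unfolding d_def using M by (intro real_sqrt_less_mono) simp
  then have d: "\<bar>c\<bar> < d" by simp
  define r1 r2 where "r1 = (c - d) / 2" "r2 = (c + d) / 2"
  note r_def = this
  have r: "r1 < 0" "0 < r2" "r1 + r2 = c" "r1 * r2 = - M"
  proof -
    show "r1 < 0" "0 < r2" using d by (simp_all add: r_def abs_less_iff)
    show "r1 + r2 = c" by (simp add: r_def field_simps)
    have "r1 * r2 = (c\<^sup>2 - d\<^sup>2) / 4" by (simp add: r_def power2_eq_square square_diff_square_factored mult.commute)
    then show "r1 * r2 = - M" using d2 by simp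
  qed
  have le': "\<phi>'' t - (r1 + r2) * \<phi>' t + r1 * r2 * \<phi> t \<le> 0" for t
    unfolding r(3,4) using le[of t] by simp
  have inc: "\<phi> s * exp (- r1 * s) \<le> \<phi> t * exp (- r1 * t)" if "s \<le> t" for s t
    by (rule exp_monotone_of_supersolution[OF pos der der2 le' r(1,2) that])
  have dec: "\<phi> t * exp (- r2 * t) \<le> \<phi> s * exp (- r2 * s)" if "s \<le> t" for s t
  proof -
    have "\<phi> (- (- t)) * exp (- (- r2) * (- t)) \<le> \<phi> (- (- s)) * exp (- (- r2) * (- s))"
    proof (rule exp_monotone_of_supersolution[where \<phi> = "\<lambda>t. \<phi> (- t)" and \<phi>' = "\<lambda>t. - \<phi>' (- t)" and \<phi>'' = "\<lambda>t. \<phi>'' (- t)"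
          and ?r2.0 = "- r1"])
      show "((\<lambda>t. \<phi> (- t)) has_real_derivative - \<phi>' (- t)) (at t)" for t
        using der[of "- t"] by (simp add: DERIV_mirror)
      show "((\<lambda>t. - \<phi>' (- t)) has_real_derivative \<phi>'' (- t)) (at t)" for t
        using der2[of "- t"] DERIV_minus[of "\<lambda>t. \<phi>' (- t)" "- \<phi>'' (- t)" t] by (simp add: DERIV_mirror)
      show "\<phi>'' (- t) - (- r2 + - r1) * - \<phi>' (- t) + - r2 * - r1 * \<phi> (- t) \<le> 0" for t
        using le'[of "- t"] by (simp add: algebra_simps)
    qed (use pos r(1,2) that in simp_all)
    then show ?thesis by simp
  qed
  define \<rho> where "\<rho> = max (- r1) r2"
  show ?thesis
  proof
    show "0 \<le> \<rho>" using r by (simp add: \<rho>_def)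
    fix t s
    show "\<phi> (t + s) \<le> exp (\<rho> * \<bar>s\<bar>) * \<phi> t"
    proof (cases "0 \<le> s")
      case True
      then have "\<phi> (t + s) * exp (- r2 * (t + s)) * exp (r2 * (t + s)) \<le> \<phi> t * exp (- r2 * t) * exp (r2 * (t + s))"
        by (intro mult_right_mono dec) auto
      then have "\<phi> (t + s) \<le> \<phi> t * exp (r2 * s)" by (simp add: mult.assoc mult_exp_exp distrib_left)
      also have "\<dots> \<le> \<phi> t * exp (\<rho> * s)"
        using pos[of t] True by (intro mult_left_mono) (auto simp: \<rho>_def intro: mult_right_mono)
      finally show ?thesis using True by (simp add: mult.commute)
    next
      case False
      then have "\<phi> (t + s) * exp (- r1 * (t + s)) * exp (r1 * (t + s)) \<le> \<phi> t * exp (- r1 * t) * exp (r1 * (t + s))"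
        by (intro mult_right_mono inc) auto
      then have "\<phi> (t + s) \<le> \<phi> t * exp (r1 * s)" by (simp add: mult.assoc mult_exp_exp distrib_left)
      also have "\<dots> \<le> \<phi> t * exp (\<rho> * - s)"
      proof -
        have "- r1 * - s \<le> \<rho> * - s" using False by (intro mult_right_mono) (auto simp: \<rho>_def)
        then show ?thesis using pos[of t] by (intro mult_left_mono) auto
      qed
      finally show ?thesis using False by (simp add: mult.commute)
    qed
  qed
qed

text \<open>Here \<open>a = f' 0\<close>, \<open>b = g' 0\<close> and \<open>m = inf f'\<close>, so that \<open>chi a b\<close> and \<open>chi m L\<close> below are
  \<open>\<chi>\<^sub>0\<close> and \<open>\<chi>\<^sub>L\<close>. Of the Hoelder condition only \<open>f_near\<close> and \<open>g_near\<close> are needed.\<close>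

locale wave = finite_measure \<nu> for \<nu> :: "real measure" +
  fixes c a b m L \<alpha> :: real and f g :: "real \<Rightarrow> real"
  assumes sets_nu [simp, measurable_cong]: "sets \<nu> = sets borel"
    and mass: "measure \<nu> UNIV = 1" and null0: "measure \<nu> {0} = 0"
    and \<alpha>: "0 < \<alpha>" and ab: "a < b" "0 < b" and Lb: "b \<le> L" and ma: "m \<le> a"
    and f0: "f 0 = 0" and g0: "g 0 = 0" and g_nonneg: "\<And>s. 0 \<le> s \<Longrightarrow> 0 \<le> g s"
    and g_cont: "continuous_on {0..} g"
    and f_lower: "\<And>s t. 0 \<le> t \<Longrightarrow> t \<le> s \<Longrightarrow> m * (s - t) \<le> f s - f t"
    and g_lip: "\<And>s t. 0 \<le> s \<Longrightarrow> 0 \<le> t \<Longrightarrow> \<bar>g s - g t\<bar> \<le> L * \<bar>s - t\<bar>"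
    and f_near: "\<And>B. \<exists>C. \<forall>s\<in>{0..B}. \<forall>t\<in>{0..B}. \<bar>f s - f t - a * (s - t)\<bar> \<le> C * max s t powr \<alpha> * \<bar>s - t\<bar>"
    and g_near: "\<And>B. \<exists>C. \<forall>s\<in>{0..B}. \<forall>t\<in>{0..B}. \<bar>g s - g t - b * (s - t)\<bar> \<le> C * max s t powr \<alpha> * \<bar>s - t\<bar>"
begin

section \<open>The two-sided Laplace transform of \<open>\<nu>\<close> and the characteristic
  function\<close>

lemma space_nu [simp]: "space \<nu> = UNIV"
  using sets_eq_imp_space_eq[OF sets_nu] by simp

lemma meas_nu: "u \<in> borel_measurable borel \<Longrightarrow> u \<in> borel_measurable \<nu>"
  using measurable_cong_sets[OF sets_nu refl] by blast

abbreviation fin :: "real \<Rightarrow> bool" where "fin z \<equiv> integrable \<nu> (\<lambda>v. exp (- z * v))"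

definition T :: "real \<Rightarrow> real" where "T z = (\<integral>v. exp (- z * v) \<partial>\<nu>)"

definition chi :: "real \<Rightarrow> real \<Rightarrow> real \<Rightarrow> real" where "chi p q z = z\<^sup>2 - c * z - p + q * T z"

text \<open>The derivative of \<open>chi a b\<close>; it becomes the coefficient \<open>D\<close> of
  the energy estimate and vanishes at a double zero.\<close>

definition drift :: "real \<Rightarrow> real" where "drift z = 2 * z - c - b * (\<integral>v. v * exp (- z * v) \<partial>\<nu>)"

lemma T_nonneg: "0 \<le> T z"
  unfolding T_def by (rule integral_nonneg_AE) simp

lemma T_0 [simp]: "T 0 = 1"
  using mass by (simp add: T_def)

lemma T_pos: assumes "fin z" shows "0 < T z"
proof (rule ccontr)
  assume "\<not> 0 < T z"
  then have "T z = 0" using T_nonneg[of z] by simp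
  then have "AE v in \<nu>. exp (- z * v) = 0"
    using integral_nonneg_eq_0_iff_AE[OF assms] by (simp add: T_def)
  then have "AE v in \<nu>. False" by simp
  then have "emeasure \<nu> (space \<nu>) = 0" by (simp add: AE_iff_measurable[OF _ refl])
  with mass show False by (simp add: measure_def)
qed

lemma exp_between:
  fixes x y z v :: real
  assumes "y \<le> x" "x \<le> z" shows "exp (- x * v) \<le> exp (- y * v) + exp (- z * v)"
proof (cases "0 \<le> v")
  case True
  then have "exp (- x * v) \<le> exp (- y * v)" using assms by (auto intro: mult_right_mono)
  then show ?thesis by (simp add: add_increasing2)
next
  case False
  then have "exp (- x * v) \<le> exp (- z * v)" using assms by (auto intro: mult_right_mono_neg)
  then show ?thesis by (simp add: add_increasing)
qed

lemma fin_mono: assumes "fin z" "0 \<le> x" "x \<le> z" shows "fin x"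
proof (rule Bochner_Integration.integrable_bound)
  show "integrable \<nu> (\<lambda>v. 1 + exp (- z * v))" using assms by simp
  show "AE v in \<nu>. norm (exp (- x * v)) \<le> norm (1 + exp (- z * v))"
    using exp_between[OF assms(2,3)] by (auto intro!: AE_I2 simp: abs_of_pos add_pos_pos)
  show "(\<lambda>v. exp (- x * v)) \<in> borel_measurable \<nu>" by (rule meas_nu) measurable
qed

lemma integrable_nu_dom:
  fixes u :: "real \<Rightarrow> real"
  assumes "u \<in> borel_measurable borel" "fin z" "\<And>t. \<bar>u t\<bar> \<le> C * exp (z * t)"
  shows "integrable \<nu> (\<lambda>v. u (t - v))" "\<bar>\<integral>v. u (t - v) \<partial>\<nu>\<bar> \<le> C * T z * exp (z * t)"
proof -
  have e: "C * exp (z * (t - v)) = C * exp (z * t) * exp (- z * v)" for v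
    by (simp add: mult.assoc mult_exp_exp right_diff_distrib)
  have b: "\<bar>u (t - v)\<bar> \<le> C * exp (z * t) * exp (- z * v)" for v
    using assms(3)[of "t - v"] by (simp add: e)
  show i: "integrable \<nu> (\<lambda>v. u (t - v))"
  proof (rule Bochner_Integration.integrable_bound)
    show "integrable \<nu> (\<lambda>v. C * exp (z * t) * exp (- z * v))" using assms(2) by simp
    show "(\<lambda>v. u (t - v)) \<in> borel_measurable \<nu>"
      by (intro meas_nu measurable_compose[OF _ assms(1)]) simp
    show "AE v in \<nu>. norm (u (t - v)) \<le> norm (C * exp (z * t) * exp (- z * v))"
      using b by (intro AE_I2) (simp add: order_trans[OF _ abs_ge_self])
  qed
  have "\<bar>\<integral>v. u (t - v) \<partial>\<nu>\<bar> \<le> (\<integral>v. \<bar>u (t - v)\<bar> \<partial>\<nu>)" by (rule integral_abs_bound)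
  also have "\<dots> \<le> (\<integral>v. C * exp (z * t) * exp (- z * v) \<partial>\<nu>)"
    using i assms(2) b by (intro integral_mono) auto
  also have "\<dots> = C * T z * exp (z * t)" by (simp add: T_def)
  finally show "\<bar>\<integral>v. u (t - v) \<partial>\<nu>\<bar> \<le> C * T z * exp (z * t)" .
qed

lemma integrable_nu_bounded:
  fixes u :: "real \<Rightarrow> real"
  assumes "u \<in> borel_measurable borel" "\<And>t. \<bar>u t\<bar> \<le> B"
  shows "integrable \<nu> (\<lambda>v. u (t - v))"
  using integrable_nu_dom(1)[OF assms(1), of 0 B] assms(2) by simp

lemma T_continuous: assumes "fin z" shows "continuous_on {0..z} T"
  unfolding continuous_on_sequentially
proof (intro allI ballI impI, elim conjE)
  fix X x assume x: "x \<in> {0..z}" and X: "\<forall>n. X n \<in> {0..z}" "X \<longlonglongrightarrow> x"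
  have "(\<lambda>n. \<integral>v. exp (- X n * v) \<partial>\<nu>) \<longlonglongrightarrow> (\<integral>v. exp (- x * v) \<partial>\<nu>)"
  proof (rule integral_dominated_convergence)
    show "integrable \<nu> (\<lambda>v. exp (- 0 * v) + exp (- z * v))" using assms by simp
    show "AE v in \<nu>. (\<lambda>n. exp (- X n * v)) \<longlonglongrightarrow> exp (- x * v)"
      by (intro AE_I2 tendsto_intros X)
    show "AE v in \<nu>. norm (exp (- X n * v)) \<le> exp (- 0 * v) + exp (- z * v)" for n
      using exp_between[of 0 "X n" z] X(1) by (intro AE_I2) auto
  qed (auto intro!: meas_nu)
  then show "(T \<circ> X) \<longlonglongrightarrow> T x" by (simp add: T_def o_def)
qed

lemma chi_continuous: "fin z \<Longrightarrow> continuous_on {0..z} (chi p q)"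
  unfolding chi_def[abs_def] by (intro continuous_intros T_continuous)

text \<open>The transform converges on both sides of z, to the right by \<open>k\<close> and to the
  left because z is positive. This gives the weight exp (- z v) exponential moments in both
  directions.\<close>

lemma exp_abs_moment:
  assumes z: "0 < z" "0 < k" and f: "fin (z + k)"
  obtains \<kappa> where "0 < \<kappa>" "\<kappa> \<le> k" "integrable \<nu> (\<lambda>v. exp (\<kappa> * \<bar>v\<bar>) * exp (- z * v))"
proof
  define \<kappa> where "\<kappa> = min z k"
  show \<kappa>: "0 < \<kappa>" "\<kappa> \<le> k" using z by (auto simp: \<kappa>_def)
  have "fin (z - \<kappa>)" "fin (z + \<kappa>)" by (rule fin_mono[OF f]; use z in \<open>simp add: \<kappa>_def\<close>)+
  then have "integrable \<nu> (\<lambda>v. exp (- (z - \<kappa>) * v) + exp (- (z + \<kappa>) * v))" by simp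
  then show "integrable \<nu> (\<lambda>v. exp (\<kappa> * \<bar>v\<bar>) * exp (- z * v))"
  proof (rule Bochner_Integration.integrable_bound)
    show "(\<lambda>v. exp (\<kappa> * \<bar>v\<bar>) * exp (- z * v)) \<in> borel_measurable \<nu>" by (rule meas_nu) measurable
    have "exp (\<kappa> * \<bar>v\<bar>) * exp (- z * v) \<le> exp (- (z - \<kappa>) * v) + exp (- (z + \<kappa>) * v)" for v
      by (cases "0 \<le> v") (simp_all add: mult_exp_exp algebra_simps)
    then show "AE v in \<nu>. norm (exp (\<kappa> * \<bar>v\<bar>) * exp (- z * v)) \<le> norm (exp (- (z - \<kappa>) * v) + exp (- (z + \<kappa>) * v))"
      by (intro AE_I2) (simp add: abs_of_pos add_pos_pos)
  qed
qed

lemma integrable_mult_exp: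
  assumes z: "0 < z" "0 < k" and f: "fin (z + k)"
  shows "integrable \<nu> (\<lambda>v. v * exp (- z * v))"
proof -
  obtain \<kappa> where \<kappa>: "0 < \<kappa>" "integrable \<nu> (\<lambda>v. exp (\<kappa> * \<bar>v\<bar>) * exp (- z * v))"
    using exp_abs_moment[OF assms] by metis
  then have "integrable \<nu> (\<lambda>v. (1 / \<kappa>) * (exp (\<kappa> * \<bar>v\<bar>) * exp (- z * v)))" by simp
  then show ?thesis
  proof (rule Bochner_Integration.integrable_bound)
    show "(\<lambda>v. v * exp (- z * v)) \<in> borel_measurable \<nu>" by (rule meas_nu) measurable
    have "\<bar>v\<bar> * exp (- z * v) \<le> exp (\<kappa> * \<bar>v\<bar>) / \<kappa> * exp (- z * v)" for v
      by (intro mult_right_mono abs_le_exp \<kappa>) simp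
    then show "AE v in \<nu>. norm (v * exp (- z * v)) \<le> norm ((1 / \<kappa>) * (exp (\<kappa> * \<bar>v\<bar>) * exp (- z * v)))"
      using \<kappa> by (intro AE_I2) (simp add: abs_mult)
  qed
qed

text \<open>Strong convexity: the quadratic part contributes (x - z)^2 exactly, and the exponential
  lies above its tangent under the integral. This yields the sign of \<open>chi a b\<close> between
  and beyond its zeros, also if x is an endpoint of the interval of convergence.\<close>

lemma chi_tangent:
  assumes z: "0 < z" "0 < k" "fin (z + k)" and x: "fin x"
  shows "chi a b z + drift z * (x - z) + (x - z)\<^sup>2 \<le> chi a b x"
proof -
  note i = integrable_mult_exp[OF z]
  have fz: "fin z" using z by (intro fin_mono[OF z(3)]) auto
  have "(\<integral>v. exp (- z * v) - (x - z) * (v * exp (- z * v)) \<partial>\<nu>) \<le> (\<integral>v. exp (- x * v) \<partial>\<nu>)"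
  proof (rule integral_mono)
    fix v
    have "(1 - (x - z) * v) * exp (- z * v) \<le> exp (- ((x - z) * v)) * exp (- z * v)"
      using exp_ge_add_one_self[of "- ((x - z) * v)"] by (intro mult_right_mono) auto
    also have "\<dots> = exp (- x * v)" by (simp add: mult_exp_exp algebra_simps)
    finally show "exp (- z * v) - (x - z) * (v * exp (- z * v)) \<le> exp (- x * v)"
      by (simp add: algebra_simps)
  qed (use i fz x in auto)
  then have "T z - (x - z) * (\<integral>v. v * exp (- z * v) \<partial>\<nu>) \<le> T x"
    using i fz by (simp add: T_def)
  then have "b * (T z - (x - z) * (\<integral>v. v * exp (- z * v) \<partial>\<nu>)) \<le> b * T x"
    using ab by (intro mult_left_mono) auto
  then show ?thesis by (simp add: chi_def drift_def power2_eq_square algebra_simps)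
qed

lemma chi_derivative:
  assumes z: "0 < z" "0 < k" "fin (z + k)"
  shows "(chi a b has_real_derivative drift z) (at z)"
proof -
  obtain \<kappa> where \<kappa>: "0 < \<kappa>" "\<kappa> \<le> k" "integrable \<nu> (\<lambda>v. exp (\<kappa> * \<bar>v\<bar>) * exp (- z * v))"
    using exp_abs_moment[OF z] by metis
  define d where "d = min (\<kappa> / 2) z"
  have d: "0 < d" "d \<le> \<kappa> / 2" "d \<le> z" using \<kappa> z by (auto simp: d_def)
  have "((\<lambda>z. \<integral>v. exp (- z * v) \<partial>\<nu>) has_real_derivative (\<integral>v. - v * exp (- z * v) \<partial>\<nu>)) (at z)"
  proof (rule DERIV_integral[OF d(1), where u' = "\<lambda>z v. - v * exp (- z * v)"
        and w = "\<lambda>v. (2 / \<kappa>) * (exp (\<kappa> * \<bar>v\<bar>) * exp (- z * v))"])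
    show "integrable \<nu> (\<lambda>v. exp (- t * v))" if "\<bar>t - z\<bar> < d" for t
      using that d \<kappa> by (intro fin_mono[OF z(3)]) auto
    show "((\<lambda>t. exp (- t * v)) has_real_derivative - v * exp (- t * v)) (at t)" for v t
      by (auto intro!: derivative_eq_intros)
    show "integrable \<nu> (\<lambda>v. (2 / \<kappa>) * (exp (\<kappa> * \<bar>v\<bar>) * exp (- z * v)))" using \<kappa> by simp
    show "(\<lambda>v. - v * exp (- z * v)) \<in> borel_measurable \<nu>" by (rule meas_nu) measurable
    fix v t assume t: "\<bar>t - z\<bar> < d"
    have "\<bar>t - z\<bar> * \<bar>v\<bar> \<le> \<kappa> / 2 * \<bar>v\<bar>" using t d by (intro mult_right_mono) auto
    moreover have "- t * v \<le> - z * v + \<bar>t - z\<bar> * \<bar>v\<bar>"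
      using abs_ge_minus_self[of "(t - z) * v"] unfolding abs_mult by (simp add: left_diff_distrib)
    ultimately have "exp (- t * v) \<le> exp (- z * v + \<kappa> / 2 * \<bar>v\<bar>)" by simp
    then have "\<bar>v\<bar> * exp (- t * v) \<le> exp (\<kappa> / 2 * \<bar>v\<bar>) / (\<kappa> / 2) * exp (- z * v + \<kappa> / 2 * \<bar>v\<bar>)"
      using \<kappa> by (intro mult_mono abs_le_exp) auto
    also have "\<dots> = (2 / \<kappa>) * (exp (\<kappa> / 2 * \<bar>v\<bar>) * exp (- z * v + \<kappa> / 2 * \<bar>v\<bar>))" by simp
    also have "exp (\<kappa> / 2 * \<bar>v\<bar>) * exp (- z * v + \<kappa> / 2 * \<bar>v\<bar>) = exp (\<kappa> * \<bar>v\<bar>) * exp (- z * v)"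
      by (simp add: mult_exp_exp algebra_simps)
    finally show "\<bar>- v * exp (- t * v)\<bar> \<le> (2 / \<kappa>) * (exp (\<kappa> * \<bar>v\<bar>) * exp (- z * v))" by (simp add: abs_mult)
  qed
  then have "(T has_real_derivative - (\<integral>v. v * exp (- z * v) \<partial>\<nu>)) (at z)"
    unfolding T_def[abs_def] by simp
  then show ?thesis
    unfolding chi_def[abs_def] drift_def by (auto intro!: derivative_eq_intros)
qed

section \<open>Solutions of the profile equation\<close>

definition sol :: "(real \<Rightarrow> real) \<Rightarrow> (real \<Rightarrow> real) \<Rightarrow> (real \<Rightarrow> real) \<Rightarrow> bool" where
  "sol \<phi> \<phi>' \<phi>'' \<longleftrightarrow> (\<forall>t. (\<phi> has_real_derivative \<phi>' t) (at t)) \<and>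
     (\<forall>t. (\<phi>' has_real_derivative \<phi>'' t) (at t)) \<and> (\<forall>t. 0 \<le> \<phi> t) \<and> (\<exists>B. \<forall>t. \<phi> t \<le> B) \<and>
     (\<forall>t. \<phi>'' t - c * \<phi>' t - f (\<phi> t) + (\<integral>v. g (\<phi> (t - v)) \<partial>\<nu>) = 0)"

text \<open>The reason why \<open>sol\<close> asks for nonnegativity and not for positivity:
  comparison of a profile with the zero solution shows that its leading coefficient at -infinity is
  positive.\<close>

lemma sol_zero: "sol (\<lambda>_. 0) (\<lambda>_. 0) (\<lambda>_. 0)"
  by (auto simp: sol_def f0 g0)

lemma sol_shift:
  assumes "sol \<phi> \<phi>' \<phi>''" shows "sol (\<lambda>t. \<phi> (t + \<tau>)) (\<lambda>t. \<phi>' (t + \<tau>)) (\<lambda>t. \<phi>'' (t + \<tau>))"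
proof -
  have "\<phi>'' (t + \<tau>) - c * \<phi>' (t + \<tau>) - f (\<phi> (t + \<tau>)) + (\<integral>v. g (\<phi> (t - v + \<tau>)) \<partial>\<nu>) = 0" for t
  proof -
    have "t - v + \<tau> = t + \<tau> - v" for v by simp
    then show ?thesis using assms unfolding sol_def by presburger
  qed
  moreover have "((\<lambda>t. u (t + \<tau>)) has_real_derivative u' (t + \<tau>)) (at t)"
    if "\<And>t. (u has_real_derivative u' t) (at t)" for u u' :: "real \<Rightarrow> real" and t
    using that[of "t + \<tau>"] by (simp add: DERIV_shift)
  ultimately show ?thesis using assms unfolding sol_def by blast
qed

context
  fixes \<phi> \<phi>' \<phi>'' :: "real \<Rightarrow> real"
  assumes sol: "sol \<phi> \<phi>' \<phi>''"
begin

lemma sol_der: "(\<phi> has_real_derivative \<phi>' t) (at t)" "(\<phi>' has_real_derivative \<phi>'' t) (at t)"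
  and sol_nonneg: "0 \<le> \<phi> t"
  and sol_eq: "\<phi>'' t - c * \<phi>' t - f (\<phi> t) + (\<integral>v. g (\<phi> (t - v)) \<partial>\<nu>) = 0"
  using sol unfolding sol_def by auto

lemma sol_bounded: obtains B where "0 < B" "\<And>t. \<phi> t \<le> B"
proof -
  from sol obtain B where "\<And>t. \<phi> t \<le> B" unfolding sol_def by blast
  then have "\<phi> t \<le> \<bar>B\<bar> + 1" for t by (smt (verit))
  with that[of "\<bar>B\<bar> + 1"] show ?thesis by auto
qed

lemma sol_continuous: "continuous_on UNIV \<phi>"
  by (intro continuous_at_imp_continuous_on ballI DERIV_isCont[OF sol_der(1)])

lemma sol_measurable [measurable]: "\<phi> \<in> borel_measurable borel"
  using sol_continuous by (rule borel_measurable_continuous_onI)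

lemma g_sol_continuous: "continuous_on UNIV (\<lambda>t. g (\<phi> t))"
  by (rule continuous_on_compose2[OF g_cont sol_continuous]) (auto simp: sol_nonneg)

lemma g_sol_measurable [measurable]: "(\<lambda>t. g (\<phi> t)) \<in> borel_measurable borel"
  using g_sol_continuous by (rule borel_measurable_continuous_onI)

lemma g_le: "0 \<le> s \<Longrightarrow> g s \<le> L * s"
  using g_lip[of s 0] g0 by auto

lemma g_sol_integrable: "integrable \<nu> (\<lambda>v. g (\<phi> (t - v)))"
proof -
  obtain B where B: "\<And>t. \<phi> t \<le> B" using sol_bounded by metis
  have "\<bar>g (\<phi> t)\<bar> \<le> L * B" for t
    using g_le[OF sol_nonneg[of t]] g_nonneg[OF sol_nonneg[of t]] mult_left_mono[OF B[of t], of L] Lb ab by linarith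
  from integrable_nu_bounded[OF g_sol_measurable this] show ?thesis .
qed

lemma f_le: "\<exists>M>0. \<forall>t. f (\<phi> t) \<le> M * \<phi> t"
proof -
  obtain B where B: "0 < B" "\<And>t. \<phi> t \<le> B" using sol_bounded by metis
  obtain C where C: "\<And>s t. s \<in> {0..B} \<Longrightarrow> t \<in> {0..B} \<Longrightarrow> \<bar>f s - f t - a * (s - t)\<bar> \<le> C * max s t powr \<alpha> * \<bar>s - t\<bar>"
    using f_near[of B] by blast
  have "f (\<phi> t) \<le> (\<bar>a\<bar> + \<bar>C\<bar> * B powr \<alpha> + 1) * \<phi> t" for t
  proof -
    have s: "\<phi> t \<in> {0..B}" "0 \<in> {0..B}" using sol_nonneg B by (auto simp: less_imp_le)
    have "f (\<phi> t) \<le> a * \<phi> t + C * \<phi> t powr \<alpha> * \<phi> t"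
      using C[OF s] f0 sol_nonneg[of t] by (simp add: max_def)
    also have "C * \<phi> t powr \<alpha> * \<phi> t \<le> \<bar>C\<bar> * B powr \<alpha> * \<phi> t"
      using sol_nonneg[of t] B(2)[of t] \<alpha> by (intro mult_right_mono mult_mono powr_mono2) auto
    also have "a * \<phi> t \<le> \<bar>a\<bar> * \<phi> t" using sol_nonneg[of t] by (intro mult_right_mono) auto
    finally show ?thesis using sol_nonneg[of t] by (simp add: distrib_right)
  qed
  moreover have "0 < \<bar>a\<bar> + \<bar>C\<bar> * B powr \<alpha> + 1" by (simp add: add_nonneg_pos)
  ultimately show ?thesis by blast
qed

text \<open>The nonlocal term is nonnegative and \<open>f\<close> is at most linear on the range of
  \<open>\<phi>\<close>, so \<open>\<phi>\<close> satisfies the differential inequality of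
  \<open>harnack_of_supersolution\<close>.\<close>

lemma harnack:
  assumes pos: "\<And>t. 0 < \<phi> t"
  obtains \<rho> where "0 \<le> \<rho>" "\<And>t s. \<phi> (t + s) \<le> exp (\<rho> * \<bar>s\<bar>) * \<phi> t"
proof -
  obtain M where M: "0 < M" "\<And>t. f (\<phi> t) \<le> M * \<phi> t" using f_le by blast
  have "\<phi>'' t - c * \<phi>' t - M * \<phi> t \<le> 0" for t
  proof -
    have "0 \<le> (\<integral>v. g (\<phi> (t - v)) \<partial>\<nu>)" by (rule integral_nonneg_AE) (simp add: g_nonneg sol_nonneg)
    with sol_eq[of t] M(2)[of t] show ?thesis by linarith
  qed
  from harnack_of_supersolution[OF pos sol_der this M(1)] that show ?thesis by blast
qed

end

section \<open>Decay and asymptotics of profiles at -infinity\<close>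

lemma small_powr:
  assumes "0 < e"
  obtains s0 where "0 < s0" "\<And>s. 0 \<le> s \<Longrightarrow> s \<le> s0 \<Longrightarrow> C * s powr \<alpha> \<le> e"
proof
  define s0 where "s0 = (e / (\<bar>C\<bar> + 1)) powr (1 / \<alpha>)"
  show "0 < s0" using assms by (simp add: s0_def)
  fix s assume s: "0 \<le> s" "s \<le> s0"
  have "s powr \<alpha> \<le> s0 powr \<alpha>" using s \<alpha> by (intro powr_mono2) auto
  also have "\<dots> = e / (\<bar>C\<bar> + 1)" using assms \<alpha> by (simp add: s0_def powr_powr)
  finally have "(\<bar>C\<bar> + 1) * s powr \<alpha> \<le> e" by (simp add: field_simps)
  moreover have "C * s powr \<alpha> \<le> (\<bar>C\<bar> + 1) * s powr \<alpha>" by (intro mult_right_mono) auto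
  ultimately show "C * s powr \<alpha> \<le> e" by linarith
qed

text \<open>The function \<open>\<theta>\<close> is a strict subsolution of the linear problem with slightly worse coefficients
  and truncated kernel. The maximum of \<open>\<theta> / \<phi>\<close> therefore lies in the initial window \<open>[t - R, t]\<close>,
  which bounds \<open>\<phi>\<close> there.\<close>

lemma decay:
  assumes sol: "sol \<phi> \<phi>' \<phi>''" and pos: "\<And>t. 0 < \<phi> t" and lim: "(\<phi> \<longlongrightarrow> 0) at_bot"
    and x: "0 < x" "x < l" "fin l" "chi a b l \<le> 0" "0 < chi a b x"
  shows "\<exists>C>0. \<forall>t. \<phi> t \<le> C * exp (x * t)"
proof -
  note der = sol_der[OF sol] and eq = sol_eq[OF sol]
  have fx: "fin x" using x by (intro fin_mono[OF x(3)]) auto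
  \<comment> \<open>The kernel is cut off at |v| \<le> R so that only values of
    \<open>\<phi>\<close> in the linear regime enter. The cut-off lowers the transform, which is
    harmless at l, where an upper bound is wanted, and costs little at x for large R.\<close>
  define I where "I R s v = indicator {- R..R} v * exp (- s * v)" for R s v :: real
  have Imeas [measurable]: "(\<lambda>v. I R s v) \<in> borel_measurable borel" for R s unfolding I_def by measurable
  have I0: "0 \<le> I R s v" "I R s v \<le> exp (- s * v)" for R s v by (auto simp: I_def indicator_def)
  have Iint: "integrable \<nu> (I R s)" if "fin s" for R s
  proof (rule Bochner_Integration.integrable_bound[OF that])
    show "I R s \<in> borel_measurable \<nu>" by (rule meas_nu) measurable
  qed (use I0 in \<open>auto intro!: AE_I2\<close>)
  define TR where "TR R s = (\<integral>v. I R s v \<partial>\<nu>)" for R s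
  have TR0: "0 \<le> TR R s" for R s unfolding TR_def by (rule integral_nonneg_AE) (simp add: I0)
  have TRle: "TR R s \<le> T s" if "fin s" for R s
    unfolding TR_def T_def using that Iint I0 by (intro integral_mono) auto
  have "(\<lambda>n. TR (real n) x) \<longlonglongrightarrow> T x"
    unfolding TR_def T_def
  proof (rule integral_dominated_convergence[OF _ _ fx])
    show "AE v in \<nu>. (\<lambda>n. I (real n) x v) \<longlonglongrightarrow> exp (- x * v)"
    proof (intro AE_I2 tendsto_eventually)
      fix v :: real
      obtain N where "\<bar>v\<bar> \<le> real N" using real_arch_simple by blast
      then show "\<forall>\<^sub>F n in sequentially. I (real n) x v = exp (- x * v)"
        by (intro eventually_sequentiallyI[of N]) (auto simp: I_def indicator_def)
    qed
  qed (use I0 fx in \<open>auto intro!: AE_I2 meas_nu\<close>)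
  then have "(\<lambda>n. x\<^sup>2 - c * x - a + b * TR (real n) x) \<longlonglongrightarrow> chi a b x"
    unfolding chi_def by (intro tendsto_intros)
  from order_tendstoD(1)[OF this x(5)] obtain n where "0 < x\<^sup>2 - c * x - a + b * TR (real n) x"
    by (auto simp: eventually_sequentially)
  moreover define R where "R = real n"
  moreover define d where "d = x\<^sup>2 - c * x - a + b * TR R x"
  ultimately have d: "0 < d" and R: "0 \<le> R" by auto
  \<comment> \<open>Half of \<open>b\<close> keeps the weakened coefficient \<open>b - e\<close>
    positive; the second entry keeps the loss \<open>e * (1 + T x)\<close> at x below the margin
    \<open>d\<close>.\<close>
  define e where "e = min (b / 2) (d / (2 * (1 + T x)))"
  have e: "0 < e" "e < b" "e * (1 + T x) < d"
  proof -
    have t: "0 < 1 + T x" using T_nonneg[of x] by simp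
    show "0 < e" "e < b" using d ab t by (auto simp: e_def)
    have "e * (1 + T x) \<le> d / (2 * (1 + T x)) * (1 + T x)" using t by (intro mult_right_mono) (auto simp: e_def)
    also have "d / (2 * k) * k = d / 2" if "0 < k" for k using that by simp
    note this[OF t]
    finally show "e * (1 + T x) < d" using d by simp
  qed
  define P where "P s = s\<^sup>2 - c * s - (a + e) + (b - e) * TR R s" for s
  have Px: "0 < P x"
  proof -
    have "e * TR R x \<le> e * T x" using e TRle[OF fx] by (intro mult_left_mono) auto
    then have "d - e * (1 + T x) \<le> P x" by (simp add: P_def d_def algebra_simps)
    with e show ?thesis by simp
  qed
  have Pl: "P l \<le> 0"
  proof -
    have "(b - e) * TR R l \<le> b * T l" using e ab TR0 TRle[OF x(3)] by (intro mult_mono) auto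
    then have "P l \<le> chi a b l" using e by (simp add: P_def chi_def)
    with x show ?thesis by simp
  qed

  obtain Cf where Cf: "\<And>s t. s \<in> {0..1} \<Longrightarrow> t \<in> {0..1} \<Longrightarrow> \<bar>f s - f t - a * (s - t)\<bar> \<le> Cf * max s t powr \<alpha> * \<bar>s - t\<bar>"
    using f_near[of 1] by blast
  obtain Cg where Cg: "\<And>s t. s \<in> {0..1} \<Longrightarrow> t \<in> {0..1} \<Longrightarrow> \<bar>g s - g t - b * (s - t)\<bar> \<le> Cg * max s t powr \<alpha> * \<bar>s - t\<bar>"
    using g_near[of 1] by blast
  obtain sf where sf: "0 < sf" "\<And>s. 0 \<le> s \<Longrightarrow> s \<le> sf \<Longrightarrow> Cf * s powr \<alpha> \<le> e"
    using small_powr[OF e(1)] by metis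
  obtain sg where sg: "0 < sg" "\<And>s. 0 \<le> s \<Longrightarrow> s \<le> sg \<Longrightarrow> Cg * s powr \<alpha> \<le> e"
    using small_powr[OF e(1)] by metis
  define s0 where "s0 = min 1 (min sf sg)"
  have s0: "0 < s0" using sf sg by (simp add: s0_def)
  have fs: "f s \<le> (a + e) * s" if "0 \<le> s" "s \<le> s0" for s
  proof -
    have "\<bar>f s - a * s\<bar> \<le> Cf * s powr \<alpha> * s" using Cf[of s 0] that f0 by (simp add: s0_def max_def)
    also have "\<dots> \<le> e * s" using sf(2)[of s] that by (intro mult_right_mono) (auto simp: s0_def)
    finally show ?thesis by (simp add: abs_le_iff algebra_simps)
  qed
  have gs: "(b - e) * s \<le> g s" if "0 \<le> s" "s \<le> s0" for s
  proof -
    have "\<bar>g s - b * s\<bar> \<le> Cg * s powr \<alpha> * s" using Cg[of s 0] that g0 by (simp add: s0_def max_def)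
    also have "\<dots> \<le> e * s" using sg(2)[of s] that by (intro mult_right_mono) (auto simp: s0_def)
    finally show ?thesis by (simp add: abs_le_iff algebra_simps)
  qed
  obtain T0 where T0: "\<And>t. t \<le> T0 \<Longrightarrow> \<phi> t \<le> s0"
    using order_tendstoD(2)[OF lim s0] unfolding eventually_at_bot_linorder by (meson less_imp_le)
  \<comment> \<open>For t < b0 and |v| \<le> R the point t - v lies below \<open>T0\<close>, where
    \<open>\<phi>\<close> is at most \<open>s0\<close>.\<close>
  define b0 where "b0 = T0 - R"
  \<comment> \<open>The weakened operator sends \<open>\<theta>\<close> to P x exp (x (t - b0)) - P
    l exp (l (t - b0)), which is positive by the signs of \<open>P\<close> at x and l. The
    exponentials balance at \<open>b0\<close>, so \<open>\<theta>\<close> is positive exactly to the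
    left of it.\<close>
  define \<theta> where "\<theta> t = exp (x * (t - b0)) - exp (l * (t - b0))" for t
  have \<theta>pos: "0 < \<theta> t" if "t < b0" for t
    unfolding \<theta>_def using x that by (simp add: mult_strict_right_mono_neg)
  have \<theta>neg: "\<theta> t \<le> 0" if "b0 \<le> t" for t
    unfolding \<theta>_def using x that by (simp add: mult_right_mono)
  have d\<theta>: "(\<theta> has_real_derivative x * exp (x * (t - b0)) - l * exp (l * (t - b0))) (at t)" for t
    unfolding \<theta>_def by (auto intro!: derivative_eq_intros)
  obtain \<rho> where \<rho>: "0 \<le> \<rho>" "\<And>t s. \<phi> (t + s) \<le> exp (\<rho> * \<bar>s\<bar>) * \<phi> t"
    using harnack[OF sol pos] by metis

  \<comment> \<open>The constant must not depend on \<open>t\<close>. It comes from the fixed point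
    \<open>b0 - 1\<close>, since the maximum of \<theta> / \<phi> is at least its value there. The
    Harnack inequality carries the bound from the maximum point to \<open>t\<close> over a distance
    of at most R.\<close>
  have claim: "\<phi> t \<le> exp (\<rho> * R) * (\<phi> (b0 - 1) / \<theta> (b0 - 1)) * exp (x * (t - b0))" if t: "t \<le> b0 - 1" for t
  proof -
    have cont: "continuous_on {t - R..b0} (\<lambda>t. \<theta> t / \<phi> t)"
    proof (intro continuous_on_divide ballI)
      show "continuous_on {t - R..b0} \<theta>" by (intro continuous_at_imp_continuous_on ballI DERIV_isCont[OF d\<theta>])
      show "continuous_on {t - R..b0} \<phi>" by (rule continuous_on_subset[OF sol_continuous[OF sol]]) simp
      show "\<phi> s \<noteq> 0" for s using pos[of s] by simp
    qed
    have "{t - R..b0} \<noteq> {}" using t R by simp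
    then obtain t1 where t1: "t1 \<in> {t - R..b0}" "\<And>s. s \<in> {t - R..b0} \<Longrightarrow> \<theta> s / \<phi> s \<le> \<theta> t1 / \<phi> t1"
      using continuous_attains_sup[OF compact_Icc _ cont] by blast
    define M where "M = \<theta> t1 / \<phi> t1"
    have "0 < \<theta> (b0 - 1) / \<phi> (b0 - 1)" using \<theta>pos[of "b0 - 1"] pos by simp
    also have le1: "\<dots> \<le> M" unfolding M_def using t R by (intro t1(2)) auto
    finally have M: "0 < M" .
    then have "0 < \<theta> t1" using pos[of t1] by (simp add: M_def zero_less_divide_iff)
    then have t1b: "t1 < b0" using \<theta>neg[of t1] by linarith
    have dom: "\<theta> s \<le> M * \<phi> s" if "t - R \<le> s" for s
    proof (cases "s \<le> b0")
      case True
      then have "\<theta> s / \<phi> s \<le> M" using that t1(2)[of s] by (simp add: M_def)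
      then show ?thesis using pos[of s] by (simp add: field_simps)
    next
      case False
      have "0 \<le> M * \<phi> s" using M pos[of s] by simp
      with \<theta>neg[of s] False show ?thesis by linarith
    qed
    have eq1: "\<theta> t1 = M * \<phi> t1" using pos[of t1] by (simp add: M_def)
    \<comment> \<open>A maximum point to the right of \<open>t\<close> would be a point where
      \<open>M * \<phi>\<close> touches \<open>\<theta>\<close> from above while dominating it on
      the whole reach [t1 - R, t1 + R] of the truncated kernel.\<close>
    have "t1 \<le> t"
    proof (rule ccontr)
      assume "\<not> t1 \<le> t"
      define u where "u s = \<theta> s - M * \<phi> s" for s
      define u1 where "u1 s = x * exp (x * (s - b0)) - l * exp (l * (s - b0)) - M * \<phi>' s" for s
      have du: "(u has_real_derivative u1 s) (at s)" for s
        unfolding u_def u1_def by (auto intro!: derivative_eq_intros d\<theta> der)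
      have du1: "(u1 has_real_derivative x\<^sup>2 * exp (x * (s - b0)) - l\<^sup>2 * exp (l * (s - b0)) - M * \<phi>'' s) (at s)" for s
        unfolding u1_def by (auto intro!: derivative_eq_intros der simp: power2_eq_square)
      have "0 < t1 - t" using \<open>\<not> t1 \<le> t\<close> by simp
      moreover have "u s \<le> u t1" if "\<bar>s - t1\<bar> < t1 - t" for s
        using dom[of s] that R by (simp add: u_def eq1)
      ultimately have z: "u1 t1 = 0"
        and n: "x\<^sup>2 * exp (x * (t1 - b0)) - l\<^sup>2 * exp (l * (t1 - b0)) - M * \<phi>'' t1 \<le> 0"
        using local_max_derivs[OF _ du du1, of "t1 - t"] by blast+
      define J where "J v = indicator {- R..R} v * \<phi> (t1 - v)" for v
      obtain B where B: "0 < B" "\<And>t. \<phi> t \<le> B" using sol_bounded[OF sol] by metis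
      have Jm: "J \<in> borel_measurable borel"
        unfolding J_def using sol_measurable[OF sol] by measurable
      have Jint: "integrable \<nu> J"
      proof (rule Bochner_Integration.integrable_bound[of _ "\<lambda>_. B"])
        show "J \<in> borel_measurable \<nu>" using Jm by (rule meas_nu)
        show "AE v in \<nu>. norm (J v) \<le> norm B"
          using B sol_nonneg[OF sol] by (intro AE_I2) (auto simp: J_def indicator_def)
      qed simp
      have nl: "(b - e) * (\<integral>v. J v \<partial>\<nu>) \<le> (\<integral>v. g (\<phi> (t1 - v)) \<partial>\<nu>)"
      proof -
        have "(\<integral>v. (b - e) * J v \<partial>\<nu>) \<le> (\<integral>v. g (\<phi> (t1 - v)) \<partial>\<nu>)"
        proof (rule integral_mono)
          fix v
          show "(b - e) * J v \<le> g (\<phi> (t1 - v))"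
          proof (cases "v \<in> {- R..R}")
            case True
            then have "t1 - v \<le> T0" using t1b by (auto simp: b0_def)
            then show ?thesis using True gs[OF sol_nonneg[OF sol] T0] by (simp add: J_def)
          qed (simp add: J_def g_nonneg sol_nonneg[OF sol])
        qed (use Jint g_sol_integrable[OF sol] in auto)
        then show ?thesis by simp
      qed
      have lo: "exp (x * (t1 - b0)) * TR R x - exp (l * (t1 - b0)) * TR R l \<le> M * (\<integral>v. J v \<partial>\<nu>)"
      proof -
        have "(\<integral>v. exp (x * (t1 - b0)) * I R x v - exp (l * (t1 - b0)) * I R l v \<partial>\<nu>) \<le> (\<integral>v. M * J v \<partial>\<nu>)"
        proof (rule integral_mono)
          fix v
          show "exp (x * (t1 - b0)) * I R x v - exp (l * (t1 - b0)) * I R l v \<le> M * J v"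
          proof (cases "v \<in> {- R..R}")
            case True
            then have "\<theta> (t1 - v) \<le> M * \<phi> (t1 - v)" using \<open>\<not> t1 \<le> t\<close> by (intro dom) auto
            moreover have "exp (x * (t1 - b0)) * I R x v - exp (l * (t1 - b0)) * I R l v = \<theta> (t1 - v)"
              using True by (simp add: I_def \<theta>_def mult_exp_exp algebra_simps)
            ultimately show ?thesis using True by (simp add: J_def)
          qed (simp add: I_def J_def)
        qed (use Jint Iint[OF fx] Iint[OF x(3)] in auto)
        then show ?thesis using Iint[OF fx, of R] Iint[OF x(3), of R] by (simp add: TR_def)
      qed
      have "t1 \<le> T0" using t1b R by (simp add: b0_def)
      then have fl: "f (\<phi> t1) \<le> (a + e) * \<phi> t1" by (intro fs sol_nonneg[OF sol] T0)
      have "(b - e) * (exp (x * (t1 - b0)) * TR R x - exp (l * (t1 - b0)) * TR R l) \<le> (b - e) * (M * (\<integral>v. J v \<partial>\<nu>))"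
        using e by (intro mult_left_mono lo) auto
      also have "\<dots> = M * ((b - e) * (\<integral>v. J v \<partial>\<nu>))" by simp
      also have "\<dots> \<le> M * (\<integral>v. g (\<phi> (t1 - v)) \<partial>\<nu>)" using M by (intro mult_left_mono nl) auto
      also have "\<dots> = M * (f (\<phi> t1) - (\<phi>'' t1 - c * \<phi>' t1))" using eq[of t1] by simp
      also have "\<dots> = M * f (\<phi> t1) - (M * \<phi>'' t1 - c * (M * \<phi>' t1))" by (simp add: algebra_simps)
      also have "M * f (\<phi> t1) \<le> M * ((a + e) * \<phi> t1)" using M by (intro mult_left_mono fl) auto
      also have "\<dots> = (a + e) * \<theta> t1" by (simp add: eq1)
      finally have "(b - e) * (exp (x * (t1 - b0)) * TR R x - exp (l * (t1 - b0)) * TR R l)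
          + M * \<phi>'' t1 - c * (M * \<phi>' t1) - (a + e) * \<theta> t1 \<le> 0" by simp
      moreover have "M * \<phi>' t1 = x * exp (x * (t1 - b0)) - l * exp (l * (t1 - b0))" using z by (simp add: u1_def)
      ultimately have "P x * exp (x * (t1 - b0)) - P l * exp (l * (t1 - b0)) \<le> 0"
        using n by (simp add: P_def \<theta>_def algebra_simps)
      moreover have "0 < P x * exp (x * (t1 - b0))" using Px by simp
      moreover have "P l * exp (l * (t1 - b0)) \<le> 0" using Pl by (simp add: mult_nonpos_nonneg)
      ultimately show False by linarith
    qed
    have "\<theta> (b0 - 1) / \<phi> (b0 - 1) * \<phi> t1 \<le> \<theta> t1" using le1 pos[of t1] by (simp add: M_def pos_le_divide_eq)
    then have "\<phi> t1 \<le> \<phi> (b0 - 1) / \<theta> (b0 - 1) * \<theta> t1"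
      using \<theta>pos[of "b0 - 1"] pos[of "b0 - 1"] by (simp add: field_simps)
    also have "\<dots> \<le> \<phi> (b0 - 1) / \<theta> (b0 - 1) * exp (x * (t - b0))"
    proof (rule mult_left_mono)
      have "\<theta> t1 \<le> exp (x * (t1 - b0))" by (simp add: \<theta>_def)
      also have "\<dots> \<le> exp (x * (t - b0))" using \<open>t1 \<le> t\<close> x by simp
      finally show "\<theta> t1 \<le> exp (x * (t - b0))" .
    qed (use \<theta>pos[of "b0 - 1"] pos[of "b0 - 1"] in \<open>simp add: less_imp_le\<close>)
    finally have 1: "\<phi> t1 \<le> \<phi> (b0 - 1) / \<theta> (b0 - 1) * exp (x * (t - b0))" .
    have "\<phi> t \<le> exp (\<rho> * \<bar>t - t1\<bar>) * \<phi> t1" using \<rho>(2)[of t1 "t - t1"] by simp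
    also have "\<dots> \<le> exp (\<rho> * R) * \<phi> t1"
      using t1(1) \<open>t1 \<le> t\<close> \<rho>(1) pos[of t1] by (intro mult_right_mono) (auto intro: mult_left_mono)
    also have "\<dots> \<le> exp (\<rho> * R) * (\<phi> (b0 - 1) / \<theta> (b0 - 1) * exp (x * (t - b0)))"
      by (intro mult_left_mono 1) simp
    finally show ?thesis by (simp add: mult_ac)
  qed
  obtain B where B: "0 < B" "\<And>t. \<phi> t \<le> B" using sol_bounded[OF sol] by metis
  define K where "K = exp (\<rho> * R) * (\<phi> (b0 - 1) / \<theta> (b0 - 1)) * exp (- (x * b0)) + B * exp (- (x * (b0 - 1)))"
  have q: "0 < \<phi> (b0 - 1) / \<theta> (b0 - 1)" using \<theta>pos[of "b0 - 1"] pos[of "b0 - 1"] by simp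
  have "\<phi> t \<le> K * exp (x * t)" for t
  proof (cases "t \<le> b0 - 1")
    case True
    have "\<phi> t \<le> exp (\<rho> * R) * (\<phi> (b0 - 1) / \<theta> (b0 - 1)) * exp (- (x * b0)) * exp (x * t)"
      using claim[OF True] by (simp add: right_diff_distrib exp_diff exp_minus field_simps)
    also have "\<dots> \<le> K * exp (x * t)" using B by (intro mult_right_mono) (auto simp: K_def)
    finally show ?thesis .
  next
    case False
    then have "B * 1 \<le> B * exp (x * (t - (b0 - 1)))" using x B by (intro mult_left_mono) auto
    also have "\<dots> = B * exp (- (x * (b0 - 1))) * exp (x * t)" by (simp add: mult.assoc mult_exp_exp algebra_simps)
    also have "B * exp (- (x * (b0 - 1))) \<le> K"
      unfolding K_def using mult_pos_pos[OF mult_pos_pos[OF exp_gt_zero[of "\<rho> * R"] q] exp_gt_zero[of "- (x * b0)"]]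
      by linarith
    then have "B * exp (- (x * (b0 - 1))) * exp (x * t) \<le> K * exp (x * t)" by (rule mult_right_mono) simp
    finally show ?thesis using B(2)[of t] by simp
  qed
  moreover have "0 < K" unfolding K_def by (intro add_pos_pos mult_pos_pos q B exp_gt_zero)
  ultimately show ?thesis by blast
qed

text \<open>A nonpositive slope at the zero l and convexity make \<open>chi a b\<close> positive to
  the left of l, the sign that \<open>decay\<close> requires at x.\<close>

lemma decay_below_root:
  assumes sol: "sol \<phi> \<phi>' \<phi>''" and pos: "\<And>t. 0 < \<phi> t" and lim: "(\<phi> \<longlongrightarrow> 0) at_bot"
    and l: "0 < l" "0 < k" "fin (l + k)" "chi a b l = 0" "drift l \<le> 0" and x: "0 < x" "x < l"
  shows "\<exists>C>0. \<forall>t. \<phi> t \<le> C * exp (x * t)"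
proof (rule decay[OF sol pos lim x])
  show "fin l" using l by (intro fin_mono[OF l(3)]) auto
  show "chi a b l \<le> 0" using l by simp
  have "fin x" using x l by (intro fin_mono[OF l(3)]) auto
  from chi_tangent[OF l(1-3) this] have "drift l * (x - l) + (x - l)\<^sup>2 \<le> chi a b x" using l by simp
  moreover have "0 \<le> drift l * (x - l)" using l x by (simp add: mult_nonpos_nonpos)
  moreover have "0 < (x - l)\<^sup>2" using x by simp
  ultimately show "0 < chi a b x" by linarith
qed

text \<open>The remainder of the linearization is at most |\<phi> - \<psi>| times the power \<alpha>
  of max (\<phi>, \<psi>), so a difference of order exp (y t) leaves a remainder of order exp ((y +
  \<alpha> x) t) at -infinity. This gain of \<alpha> x drives the improvement of exponents. For t >
  0 boundedness suffices because \<rho> \<ge> 0.\<close>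

lemma remainder_bound:
  assumes \<phi>: "sol \<phi> \<phi>' \<phi>''" and \<psi>: "sol \<psi> \<psi>' \<psi>''"
    and C1: "0 < C1" "\<And>t. \<phi> t \<le> C1 * exp (x * t)" "\<And>t. \<psi> t \<le> C1 * exp (x * t)"
    and C2: "\<And>t. \<bar>\<phi> t - \<psi> t\<bar> \<le> C2 * exp (y * t)"
    and \<rho>: "fin \<rho>" "0 \<le> \<rho>" "\<rho> \<le> y + \<alpha> * x"
  shows "\<exists>C>0. \<forall>t. \<bar>\<phi>'' t - \<psi>'' t - c * (\<phi>' t - \<psi>' t) - a * (\<phi> t - \<psi> t)
      + b * (\<integral>v. \<phi> (t - v) - \<psi> (t - v) \<partial>\<nu>)\<bar> \<le> C * exp (\<rho> * t)"
proof -
  obtain B1 where B1: "0 < B1" "\<And>t. \<phi> t \<le> B1" using sol_bounded[OF \<phi>] by metis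
  obtain B2 where B2: "0 < B2" "\<And>t. \<psi> t \<le> B2" using sol_bounded[OF \<psi>] by metis
  define B where "B = max B1 B2"
  have B: "0 < B" "\<phi> t \<in> {0..B}" "\<psi> t \<in> {0..B}" for t
    using B1 B2 sol_nonneg[OF \<phi>] sol_nonneg[OF \<psi>] unfolding B_def atLeastAtMost_iff less_max_iff_disj le_max_iff_disj
    by blast+
  obtain Cf where Cf: "\<And>s t. s \<in> {0..B} \<Longrightarrow> t \<in> {0..B} \<Longrightarrow> \<bar>f s - f t - a * (s - t)\<bar> \<le> Cf * max s t powr \<alpha> * \<bar>s - t\<bar>"
    using f_near[of B] by blast
  obtain Cg where Cg: "\<And>s t. s \<in> {0..B} \<Longrightarrow> t \<in> {0..B} \<Longrightarrow> \<bar>g s - g t - b * (s - t)\<bar> \<le> Cg * max s t powr \<alpha> * \<bar>s - t\<bar>"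
    using g_near[of B] by blast
  define w where "w t = max (\<phi> t) (\<psi> t) powr \<alpha> * \<bar>\<phi> t - \<psi> t\<bar>" for t
  define K where "K = C1 powr \<alpha> * C2 + B powr \<alpha> * B"
  have C20: "0 \<le> C2" using order_trans[OF abs_ge_zero C2[of 0]] by simp
  have w0: "0 \<le> w t" for t by (simp add: w_def)
  have w: "w t \<le> K * exp (\<rho> * t)" for t
  proof (cases "t \<le> 0")
    case True
    have "max (\<phi> t) (\<psi> t) \<le> C1 * exp (x * t)" using C1 by simp
    then have "max (\<phi> t) (\<psi> t) powr \<alpha> \<le> (C1 * exp (x * t)) powr \<alpha>"
      using \<alpha> sol_nonneg[OF \<phi>, of t] by (intro powr_mono2) auto
    also have "\<dots> = C1 powr \<alpha> * exp (\<alpha> * x * t)"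
      using C1(1) by (simp add: powr_mult exp_powr_real mult_ac)
    finally have "w t \<le> (C1 powr \<alpha> * exp (\<alpha> * x * t)) * (C2 * exp (y * t))"
      unfolding w_def by (intro mult_mono C2) auto
    also have "\<dots> = C1 powr \<alpha> * C2 * exp ((y + \<alpha> * x) * t)" by (simp add: mult_exp_exp algebra_simps)
    also have "\<dots> \<le> C1 powr \<alpha> * C2 * exp (\<rho> * t)"
      using True \<rho>(3) C20 by (intro mult_left_mono) (auto intro: mult_right_mono_neg)
    also have "\<dots> \<le> K * exp (\<rho> * t)" using B(1) by (intro mult_right_mono) (auto simp: K_def)
    finally show ?thesis .
  next
    case False
    have "w t \<le> B powr \<alpha> * B" unfolding w_def
      using B(2,3)[of t] \<alpha> by (intro mult_mono powr_mono2) (auto simp: max_def abs_le_iff)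
    also have "\<dots> \<le> K * 1" using C20 by (simp add: K_def)
    also have "\<dots> \<le> K * exp (\<rho> * t)"
      using False \<rho>(2) C20 B(1) by (intro mult_left_mono) (auto simp: K_def)
    finally show ?thesis .
  qed
  define G where "G t = g (\<phi> t) - g (\<psi> t) - b * (\<phi> t - \<psi> t)" for t
  have G: "\<bar>G t\<bar> \<le> \<bar>Cg\<bar> * K * exp (\<rho> * t)" for t
  proof -
    have "\<bar>G t\<bar> \<le> Cg * w t" using Cg[OF B(2,3)] by (simp add: G_def w_def mult.assoc)
    also have "\<dots> \<le> \<bar>Cg\<bar> * w t" using w0 by (intro mult_right_mono) auto
    also have "\<dots> \<le> \<bar>Cg\<bar> * (K * exp (\<rho> * t))" using w by (intro mult_left_mono) auto
    finally show ?thesis by (simp add: mult.assoc)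
  qed
  have Gm: "G \<in> borel_measurable borel"
    unfolding G_def using g_sol_measurable[OF \<phi>] g_sol_measurable[OF \<psi>] sol_measurable[OF \<phi>] sol_measurable[OF \<psi>]
    by measurable
  have i: "integrable \<nu> (\<lambda>v. \<phi> (t - v))" "integrable \<nu> (\<lambda>v. \<psi> (t - v))" for t
    using integrable_nu_bounded[OF sol_measurable[OF \<phi>], of B] integrable_nu_bounded[OF sol_measurable[OF \<psi>], of B]
      B(2,3) by (auto simp: abs_of_nonneg)
  define C where "C = \<bar>Cf\<bar> * K + \<bar>Cg\<bar> * K * T \<rho> + 1"
  have K0: "0 \<le> K" using C20 B(1) by (simp add: K_def)
  have "\<bar>\<phi>'' t - \<psi>'' t - c * (\<phi>' t - \<psi>' t) - a * (\<phi> t - \<psi> t)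
      + b * (\<integral>v. \<phi> (t - v) - \<psi> (t - v) \<partial>\<nu>)\<bar> \<le> C * exp (\<rho> * t)" for t
  proof -
    have "(\<integral>v. G (t - v) \<partial>\<nu>) = (\<integral>v. g (\<phi> (t - v)) \<partial>\<nu>) - (\<integral>v. g (\<psi> (t - v)) \<partial>\<nu>)
        - b * (\<integral>v. \<phi> (t - v) - \<psi> (t - v) \<partial>\<nu>)"
      unfolding G_def using i[of t] g_sol_integrable[OF \<phi>, of t] g_sol_integrable[OF \<psi>, of t] by simp
    then have eq: "\<phi>'' t - \<psi>'' t - c * (\<phi>' t - \<psi>' t) - a * (\<phi> t - \<psi> t) + b * (\<integral>v. \<phi> (t - v) - \<psi> (t - v) \<partial>\<nu>)
        = (f (\<phi> t) - f (\<psi> t) - a * (\<phi> t - \<psi> t)) - (\<integral>v. G (t - v) \<partial>\<nu>)"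
      using sol_eq[OF \<phi>, of t] sol_eq[OF \<psi>, of t] by (simp add: algebra_simps)
    have "\<bar>f (\<phi> t) - f (\<psi> t) - a * (\<phi> t - \<psi> t)\<bar> \<le> Cf * w t" using Cf[OF B(2,3)] by (simp add: w_def mult.assoc)
    also have "\<dots> \<le> \<bar>Cf\<bar> * w t" using w0 by (intro mult_right_mono) auto
    also have "\<dots> \<le> \<bar>Cf\<bar> * (K * exp (\<rho> * t))" using w by (intro mult_left_mono) auto
    finally have "\<bar>f (\<phi> t) - f (\<psi> t) - a * (\<phi> t - \<psi> t)\<bar> \<le> \<bar>Cf\<bar> * K * exp (\<rho> * t)" by (simp add: mult.assoc)
    moreover have "\<bar>\<integral>v. G (t - v) \<partial>\<nu>\<bar> \<le> \<bar>Cg\<bar> * K * T \<rho> * exp (\<rho> * t)"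
      by (rule integrable_nu_dom(2)[OF Gm \<rho>(1) G])
    moreover have "C * exp (\<rho> * t) = \<bar>Cf\<bar> * K * exp (\<rho> * t) + \<bar>Cg\<bar> * K * T \<rho> * exp (\<rho> * t) + exp (\<rho> * t)"
      by (simp add: C_def distrib_right)
    moreover have "0 \<le> exp (\<rho> * t)" by simp
    ultimately show ?thesis unfolding eq by linarith
  qed
  moreover have "0 < C" using K0 T_nonneg[of \<rho>] by (simp add: C_def add_nonneg_pos)
  ultimately show ?thesis by blast
qed

text \<open>Division by exp (l t) replaces \<open>\<nu>\<close> by the measure with the weight b exp
  (- l v). The zeroth-order coefficient becomes \<open>chi a b l\<close>, which is 0, so only
  differences p (t - v) - p t remain and \<open>asymptotics_linear\<close> applies.\<close>

lemma sol_asymptotics: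
  assumes sol: "sol \<phi> \<phi>' \<phi>''" and pos: "\<And>t. 0 < \<phi> t" and lim: "(\<phi> \<longlongrightarrow> 0) at_bot"
    and l: "0 < l" "0 < k" "fin (l + k)" "chi a b l = 0" "drift l \<le> 0"
  shows "drift l < 0 \<Longrightarrow> \<exists>A\<ge>0. ((\<lambda>t. \<phi> t * exp (- l * t)) \<longlongrightarrow> A) at_bot"
    and "drift l = 0 \<Longrightarrow> \<exists>A\<ge>0. ((\<lambda>t. \<phi> t * exp (- l * t) / (- t)) \<longlongrightarrow> A) at_bot"
proof -
  note der = sol_der[OF sol]
  have fl: "fin l" using l by (intro fin_mono[OF l(3)]) auto
  note dec = decay_below_root[OF sol pos lim l]
  obtain B where B: "0 < B" "\<And>t. \<phi> t \<le> B" using sol_bounded[OF sol] by metis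
  define p where "p t = \<phi> t * exp (- l * t)" for t
  define p' where "p' t = (\<phi>' t - l * \<phi> t) * exp (- l * t)" for t
  define p'' where "p'' t = (\<phi>'' t - 2 * l * \<phi>' t + l\<^sup>2 * \<phi> t) * exp (- l * t)" for t
  have dp: "(p has_real_derivative p' t) (at t)" for t
    unfolding p_def p'_def by (auto intro!: derivative_eq_intros der simp: algebra_simps)
  have dp': "(p' has_real_derivative p'' t) (at t)" for t
    unfolding p'_def p''_def by (auto intro!: derivative_eq_intros der simp: algebra_simps power2_eq_square)
  have ppos: "0 < p t" for t using pos by (simp add: p_def)
  have psub: "subexp p"
    unfolding subexp_def
  proof (intro allI impI)
    fix e :: real assume e: "0 < e"
    \<comment> \<open>An exponent in (0, l) at distance at most \<open>e\<close> from l.\<close>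
    define x where "x = max (l - e) (l / 2)"
    have x: "0 < x" "x < l" "l - x \<le> e" using l e by (auto simp: x_def)
    obtain C where C: "0 < C" "\<And>t. \<phi> t \<le> C * exp (x * t)" using dec[OF x(1,2)] by blast
    have "\<bar>p t\<bar> \<le> (C + B) * exp (e * \<bar>t\<bar>)" for t
    proof (cases "t \<le> 0")
      case True
      have "p t \<le> C * exp (x * t) * exp (- l * t)" unfolding p_def by (intro mult_right_mono C) auto
      also have "\<dots> = C * exp ((l - x) * - t)" by (simp add: mult.assoc mult_exp_exp algebra_simps)
      also have "\<dots> \<le> C * exp (e * - t)"
        using mult_right_mono[OF x(3), of "- t"] True C by (intro mult_left_mono) auto
      also have "\<dots> \<le> (C + B) * exp (e * \<bar>t\<bar>)" using True B(1) C(1) by (intro mult_mono) auto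
      finally show ?thesis using ppos[of t] by simp
    next
      case False
      have "p t \<le> B * 1" unfolding p_def using False l B sol_nonneg[OF sol] by (intro mult_mono) auto
      also have "\<dots> \<le> (C + B) * exp (e * \<bar>t\<bar>)" using B(1) C(1) e by (intro mult_mono) auto
      finally show ?thesis using ppos[of t] by simp
    qed
    then show "\<exists>C. \<forall>t. \<bar>p t\<bar> \<le> C * exp (e * \<bar>t\<bar>)" by blast
  qed
  obtain \<rho>0 where \<rho>0: "0 \<le> \<rho>0" "\<And>t s. \<phi> (t + s) \<le> exp (\<rho>0 * \<bar>s\<bar>) * \<phi> t"
    using harnack[OF sol pos] by metis
  have pharnack: "p (t + s) \<le> exp ((\<rho>0 + l) * \<bar>s\<bar>) * p t" for t s
  proof -
    have "p (t + s) \<le> exp (\<rho>0 * \<bar>s\<bar>) * \<phi> t * exp (- l * (t + s))"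
      unfolding p_def by (intro mult_right_mono \<rho>0) auto
    also have "\<dots> = exp (\<rho>0 * \<bar>s\<bar>) * p t * exp (- l * s)" by (simp add: p_def mult.assoc mult_exp_exp algebra_simps)
    also have "\<dots> \<le> exp (\<rho>0 * \<bar>s\<bar>) * p t * exp (l * \<bar>s\<bar>)"
    proof (rule mult_left_mono)
      have "l * - s \<le> l * \<bar>s\<bar>" using l by (intro mult_left_mono) auto
      then show "exp (- l * s) \<le> exp (l * \<bar>s\<bar>)" by simp
    qed (use ppos[of t] in simp)
    also have "\<dots> = exp ((\<rho>0 + l) * \<bar>s\<bar>) * p t" by (simp add: distrib_right exp_add)
    finally show ?thesis .
  qed

  obtain \<kappa> where \<kappa>: "0 < \<kappa>" "\<kappa> \<le> k" "integrable \<nu> (\<lambda>v. exp (\<kappa> * \<bar>v\<bar>) * exp (- l * v))"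
    using exp_abs_moment[OF l(1-3)] by metis
  define \<mu> where "\<mu> = density \<nu> (\<lambda>v. ennreal (b * exp (- l * v)))"
  have wm: "(\<lambda>v. b * exp (- l * v)) \<in> borel_measurable \<nu>" by (rule meas_nu) measurable
  have wpos: "AE v in \<nu>. 0 \<le> b * exp (- l * v)" using ab by simp
  have sets\<mu>: "sets \<mu> = sets borel" by (simp add: \<mu>_def)
  have int\<mu>: "integral\<^sup>L \<mu> u = (\<integral>v. b * exp (- l * v) * u v \<partial>\<nu>)"
    "integrable \<mu> u \<longleftrightarrow> integrable \<nu> (\<lambda>v. b * exp (- l * v) * u v)"
    if "u \<in> borel_measurable borel" for u :: "real \<Rightarrow> real"
    unfolding \<mu>_def using integral_density[OF meas_nu[OF that] wm wpos] integrable_density[OF meas_nu[OF that] wm wpos] by auto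
  interpret \<mu>: exp_moment \<mu> \<kappa>
  proof
    show "sets \<mu> = sets borel" by (rule sets\<mu>)
    show "0 < \<kappa>" by fact
    have "integrable \<nu> (\<lambda>v. b * (exp (\<kappa> * \<bar>v\<bar>) * exp (- l * v)))" using \<kappa>(3) by simp
    then show "integrable \<mu> (\<lambda>v. exp (\<kappa> * \<bar>v\<bar>))" by (subst int\<mu>) (simp_all add: mult_ac)
  qed

  \<comment> \<open>Below l, yet with (1 + \<alpha>) x > l: the nonlinear remainder then decays
    faster than exp (l t).\<close>
  define x where "x = max (l / 2) (l / (1 + \<alpha> / 2))"
  have x: "0 < x" "x < l" "l < x + \<alpha> * x"
  proof -
    show "0 < x" "x < l" using l \<alpha> by (auto simp: x_def field_simps)
    have "l = l / (1 + \<alpha> / 2) * (1 + \<alpha> / 2)" using \<alpha> by simp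
    also have "\<dots> < l / (1 + \<alpha> / 2) * (1 + \<alpha>)" using l \<alpha> by (intro mult_strict_left_mono) auto
    also have "\<dots> \<le> x * (1 + \<alpha>)" using \<alpha> by (intro mult_right_mono) (auto simp: x_def)
    finally show "l < x + \<alpha> * x" by (simp add: algebra_simps)
  qed
  obtain C1 where C1: "0 < C1" "\<And>t. \<phi> t \<le> C1 * exp (x * t)" using dec[OF x(1,2)] by blast
  define \<rho> where "\<rho> = min (l + k) (x + \<alpha> * x)"
  have \<rho>: "l < \<rho>" "\<rho> \<le> l + k" "\<rho> \<le> x + \<alpha> * x" using x l by (auto simp: \<rho>_def)
  have f\<rho>: "fin \<rho>" using \<rho> l by (intro fin_mono[OF l(3)]) auto
  obtain C where C: "0 < C" "\<And>t. \<bar>\<phi>'' t - 0 - c * (\<phi>' t - 0) - a * (\<phi> t - 0)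
      + b * (\<integral>v. \<phi> (t - v) - 0 \<partial>\<nu>)\<bar> \<le> C * exp (\<rho> * t)"
    using remainder_bound[OF sol sol_zero C1 _ _ f\<rho> _ \<rho>(3), of C1] C1 sol_nonneg[OF sol] \<rho> l
    by (auto simp: less_imp_le)
  have \<phi>m [measurable]: "\<phi> \<in> borel_measurable borel" by (rule sol_measurable[OF sol])
  have pm [measurable]: "p \<in> borel_measurable borel" unfolding p_def by measurable
  have pint: "(\<integral>v. (p (t - v) - p t) \<partial>\<mu>) = exp (- l * t) * (b * (\<integral>v. \<phi> (t - v) \<partial>\<nu>) - b * T l * \<phi> t)" for t
  proof -
    have "(\<integral>v. (p (t - v) - p t) \<partial>\<mu>) = (\<integral>v. b * exp (- l * v) * (p (t - v) - p t) \<partial>\<nu>)"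
      by (rule int\<mu>) measurable
    also have "\<dots> = (\<integral>v. exp (- l * t) * (b * \<phi> (t - v)) - exp (- l * t) * (b * \<phi> t) * exp (- l * v) \<partial>\<nu>)"
    proof (rule Bochner_Integration.integral_cong[OF refl])
      fix v
      have "exp (- l * v) * exp (- l * (t - v)) = exp (- l * t)" by (simp add: mult_exp_exp algebra_simps)
      then have "exp (- l * v) * p (t - v) = exp (- l * t) * \<phi> (t - v)" by (simp add: p_def mult.left_commute)
      then show "b * exp (- l * v) * (p (t - v) - p t)
          = exp (- l * t) * (b * \<phi> (t - v)) - exp (- l * t) * (b * \<phi> t) * exp (- l * v)"
        by (simp add: p_def right_diff_distrib mult_ac)
    qed
    also have "\<dots> = exp (- l * t) * (b * (\<integral>v. \<phi> (t - v) \<partial>\<nu>)) - exp (- l * t) * (b * \<phi> t) * T l"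
    proof -
      have "integrable \<nu> (\<lambda>v. \<phi> (t - v))"
        by (rule integrable_nu_bounded[OF \<phi>m, of B]) (use B sol_nonneg[OF sol] in \<open>simp add: abs_of_nonneg\<close>)
      then show ?thesis using fl by (simp add: T_def)
    qed
    finally show ?thesis by (simp add: algebra_simps)
  qed
  \<comment> \<open>The first moment of the weighted measure is what \<open>drift l\<close>
    subtracts from 2 l - c, so the coefficient \<open>D\<close> of \<open>asymptotics_linear\<close>
    is exactly \<open>drift l\<close>.\<close>
  have m1: "drift l + (\<integral>v. v \<partial>\<mu>) = 2 * l - c"
    by (subst int\<mu>) (simp_all add: drift_def mult_ac flip: integral_mult_right_zero)
  have "\<bar>p'' t + (drift l + (\<integral>v. v \<partial>\<mu>)) * p' t + (\<integral>v. (p (t - v) - p t) \<partial>\<mu>)\<bar> \<le> C * exp ((\<rho> - l) * t)" for t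
  proof -
    have "p'' t + (drift l + (\<integral>v. v \<partial>\<mu>)) * p' t + (\<integral>v. (p (t - v) - p t) \<partial>\<mu>)
        = exp (- l * t) * (\<phi>'' t - c * \<phi>' t + (c * l - l\<^sup>2 - b * T l) * \<phi> t + b * (\<integral>v. \<phi> (t - v) \<partial>\<nu>))"
      unfolding m1 pint p''_def p'_def by (simp add: algebra_simps power2_eq_square)
    also have "c * l - l\<^sup>2 - b * T l = - a" using l(4) by (simp add: chi_def)
    finally have "\<bar>p'' t + (drift l + (\<integral>v. v \<partial>\<mu>)) * p' t + (\<integral>v. (p (t - v) - p t) \<partial>\<mu>)\<bar>
        = exp (- l * t) * \<bar>\<phi>'' t - c * \<phi>' t + - a * \<phi> t + b * (\<integral>v. \<phi> (t - v) \<partial>\<nu>)\<bar>" by (simp add: abs_mult)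
    also have "\<dots> \<le> exp (- l * t) * (C * exp (\<rho> * t))" using C(2)[of t] by (intro mult_left_mono) auto
    also have "\<dots> = C * exp ((\<rho> - l) * t)" by (simp add: mult_exp_exp algebra_simps)
    finally show ?thesis .
  qed
  note main = \<mu>.asymptotics_linear[OF dp dp' ppos psub pharnack _ this _ l(5)]
  have h: "0 \<le> \<rho>0 + l" "0 < \<rho> - l" using \<rho>0 l \<rho> by auto
  show "drift l < 0 \<Longrightarrow> \<exists>A\<ge>0. ((\<lambda>t. \<phi> t * exp (- l * t)) \<longlongrightarrow> A) at_bot"
    using main(1)[OF h] unfolding p_def .
  show "drift l = 0 \<Longrightarrow> \<exists>A\<ge>0. ((\<lambda>t. \<phi> t * exp (- l * t) / (- t)) \<longlongrightarrow> A) at_bot"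
    using main(2)[OF h] unfolding p_def .
qed

subsection \<open>Uniqueness by the maximum principle\<close>

lemma sol_diff_integrable:
  assumes "sol \<phi> \<phi>' \<phi>''" "sol \<psi> \<psi>' \<psi>''"
  shows "integrable \<nu> (\<lambda>v. \<phi> (t - v) - \<psi> (t - v))"
proof -
  have "integrable \<nu> (\<lambda>v. u (t - v))" if s: "sol u u' u''" for u u' u''
  proof -
    obtain B where "\<And>t. u t \<le> B" using sol_bounded[OF s] by metis
    then show ?thesis
      using sol_nonneg[OF s] by (intro integrable_nu_bounded[OF sol_measurable[OF s], of B]) (simp add: abs_of_nonneg)
  qed
  with assms show ?thesis by (intro Bochner_Integration.integrable_diff)
qed

lemma sol_diff_weighted_top:
  assumes "sol \<phi> \<phi>' \<phi>''" "sol \<psi> \<psi>' \<psi>''" and l: "0 < l" and e: "0 < e"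
  shows "\<forall>\<^sub>F t in at_top. \<bar>\<phi> t - \<psi> t\<bar> * exp (- l * t) < e"
proof -
  obtain B1 where B1: "0 < B1" "\<And>t. \<phi> t \<le> B1" using sol_bounded[OF assms(1)] by metis
  obtain B2 where B2: "0 < B2" "\<And>t. \<psi> t \<le> B2" using sol_bounded[OF assms(2)] by metis
  have "((\<lambda>t. (B1 + B2) * exp (- l * t)) \<longlongrightarrow> 0) at_top" using l by real_asymp
  from order_tendstoD(2)[OF this e] show ?thesis
  proof eventually_elim
    case (elim t)
    have "\<bar>\<phi> t - \<psi> t\<bar> \<le> B1 + B2"
      using B1 B2(1) B2(2)[of t] B1(2)[of t] sol_nonneg[OF assms(1), of t] sol_nonneg[OF assms(2), of t] by linarith
    then have "\<bar>\<phi> t - \<psi> t\<bar> * exp (- l * t) \<le> (B1 + B2) * exp (- l * t)" by (rule mult_right_mono) simp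
    then show ?case using elim by (rule order.strict_trans1)
  qed
qed

text \<open>The linearized nonlocal term is monotone since b > 0, so a one-sided comparison is
  possible. Where \<open>chi a b\<close> is negative, K exp (\<rho> t) absorbs the source C exp
  (\<rho> t), and any positive multiple of exp (l t) may be added because
  \<open>chi a b l \<le> 0\<close>. If the bound failed, such a sum would touch the difference from
  above.\<close>

lemma sol_diff_improve_one_sided:
  assumes \<phi>: "sol \<phi> \<phi>' \<phi>''" and \<psi>: "sol \<psi> \<psi>' \<psi>''"
    and l: "0 < l" "l < \<rho>" "fin \<rho>" "chi a b l \<le> 0" "chi a b \<rho> < 0"
    and lim: "((\<lambda>t. (\<phi> t - \<psi> t) * exp (- l * t)) \<longlongrightarrow> 0) at_bot"
    and E: "\<And>t. - C * exp (\<rho> * t) \<le> \<phi>'' t - \<psi>'' t - c * (\<phi>' t - \<psi>' t) - a * (\<phi> t - \<psi> t)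
      + b * (\<integral>v. \<phi> (t - v) - \<psi> (t - v) \<partial>\<nu>)" and C: "0 < C"
  shows "\<phi> t - \<psi> t \<le> (C + 1) / (- chi a b \<rho>) * exp (\<rho> * t)"
proof -
  \<comment> \<open>Chosen so that \<open>K * chi a b \<rho> = - (C + 1)\<close>, which overcomes
    the source with one unit to spare.\<close>
  define K where "K = (C + 1) / (- chi a b \<rho>)"
  have K: "0 < K" "K * chi a b \<rho> = - (C + 1)" using C l by (auto simp: K_def field_simps)
  have fl: "fin l" using l by (intro fin_mono[OF l(3)]) auto
  have claim: "(\<phi> t - \<psi> t) * exp (- l * t) - K * exp ((\<rho> - l) * t) - e \<le> 0" if e: "0 < e" for e t
  proof (rule ccontr)
    define u where "u t = (\<phi> t - \<psi> t) * exp (- l * t) - K * exp ((\<rho> - l) * t) - e" for t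
    assume "\<not> ?thesis"
    then have t1: "0 < u t" by (simp add: u_def)
    have cu: "continuous_on UNIV u"
      unfolding u_def by (intro continuous_intros sol_continuous[OF \<phi>] sol_continuous[OF \<psi>])
    obtain t0 where t0: "\<And>s. u s \<le> u t0"
    proof (rule attains_max_on_closed[OF closed_UNIV cu UNIV_I t1])
      show "\<forall>\<^sub>F s in at_bot. s \<in> UNIV \<longrightarrow> u s < u t"
        using order_tendstoD(2)[OF lim e]
      proof eventually_elim
        case (elim s)
        have "0 < K * exp ((\<rho> - l) * s)" using K by simp
        with elim t1 show ?case by (simp add: u_def)
      qed
      show "\<forall>\<^sub>F s in at_top. s \<in> UNIV \<longrightarrow> u s < u t"
        using sol_diff_weighted_top[OF \<phi> \<psi> l(1) e]
      proof eventually_elim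
        case (elim s)
        have "0 < K * exp ((\<rho> - l) * s)" using K by simp
        moreover have "(\<phi> s - \<psi> s) * exp (- l * s) \<le> \<bar>\<phi> s - \<psi> s\<bar> * exp (- l * s)" by (intro mult_right_mono) auto
        ultimately have "u s < 0" unfolding u_def using elim by linarith
        with t1 show ?case by linarith
      qed
    qed blast
    \<comment> \<open>Subtracting \<open>e\<close> makes \<open>u\<close> negative near both ends,
      so its positive maximum is attained; e + u t0 is the multiple of exp (l t) for which the
      barrier touches the difference.\<close>
    define M where "M = e + u t0"
    have M: "0 < M" using t0[of t] t1 e by (simp add: M_def)
    define V where "V s = K * exp (\<rho> * s) + M * exp (l * s)" for s
    have le: "\<phi> s - \<psi> s - V s \<le> \<phi> t0 - \<psi> t0 - V t0" and eq: "\<phi> t0 - \<psi> t0 = V t0" for s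
    proof -
      have id: "\<phi> s - \<psi> s - V s = (u s - u t0) * exp (l * s)" for s
        by (simp add: u_def V_def M_def left_diff_distrib distrib_right mult.assoc mult_exp_exp)
      show "\<phi> t0 - \<psi> t0 = V t0" using id[of t0] by simp
      have "(u s - u t0) * exp (l * s) \<le> 0" using t0[of s] by (intro mult_nonpos_nonneg) auto
      then show "\<phi> s - \<psi> s - V s \<le> \<phi> t0 - \<psi> t0 - V t0" by (simp add: id)
    qed
    define w1 where "w1 s = \<phi>' s - \<psi>' s - (K * \<rho> * exp (\<rho> * s) + M * l * exp (l * s))" for s
    have dw: "((\<lambda>s. \<phi> s - \<psi> s - V s) has_real_derivative w1 s) (at s)" for s
      unfolding V_def w1_def by (auto intro!: derivative_eq_intros sol_der[OF \<phi>] sol_der[OF \<psi>])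
    have dw1: "(w1 has_real_derivative \<phi>'' s - \<psi>'' s - (K * \<rho>\<^sup>2 * exp (\<rho> * s) + M * l\<^sup>2 * exp (l * s))) (at s)" for s
      unfolding w1_def by (auto intro!: derivative_eq_intros sol_der[OF \<phi>] sol_der[OF \<psi>] simp: power2_eq_square)
    have z: "w1 t0 = 0" and n: "\<phi>'' t0 - \<psi>'' t0 - (K * \<rho>\<^sup>2 * exp (\<rho> * t0) + M * l\<^sup>2 * exp (l * t0)) \<le> 0"
      using local_max_derivs[OF zero_less_one dw dw1 le] by blast+
    have "(\<integral>v. \<phi> (t0 - v) - \<psi> (t0 - v) \<partial>\<nu>) \<le> (\<integral>v. K * exp (\<rho> * t0) * exp (- \<rho> * v) + M * exp (l * t0) * exp (- l * v) \<partial>\<nu>)"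
    proof (rule integral_mono[OF sol_diff_integrable[OF \<phi> \<psi>]])
      show "integrable \<nu> (\<lambda>v. K * exp (\<rho> * t0) * exp (- \<rho> * v) + M * exp (l * t0) * exp (- l * v))"
        using l(3) fl by simp
      show "\<phi> (t0 - v) - \<psi> (t0 - v) \<le> K * exp (\<rho> * t0) * exp (- \<rho> * v) + M * exp (l * t0) * exp (- l * v)" for v
        using le[of "t0 - v"] eq by (simp add: V_def mult.assoc mult_exp_exp right_diff_distrib)
    qed
    also have "\<dots> = K * exp (\<rho> * t0) * T \<rho> + M * exp (l * t0) * T l" using l(3) fl by (simp add: T_def)
    finally have int: "b * (\<integral>v. \<phi> (t0 - v) - \<psi> (t0 - v) \<partial>\<nu>) \<le> b * (K * exp (\<rho> * t0) * T \<rho> + M * exp (l * t0) * T l)"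
      using ab by (intro mult_left_mono) auto
    have "\<phi>' t0 - \<psi>' t0 = K * \<rho> * exp (\<rho> * t0) + M * l * exp (l * t0)" using z by (simp add: w1_def)
    then have "\<phi>'' t0 - \<psi>'' t0 - c * (\<phi>' t0 - \<psi>' t0) - a * (\<phi> t0 - \<psi> t0) + b * (\<integral>v. \<phi> (t0 - v) - \<psi> (t0 - v) \<partial>\<nu>)
        \<le> K * chi a b \<rho> * exp (\<rho> * t0) + M * chi a b l * exp (l * t0)"
      using n int unfolding eq V_def chi_def by (simp add: algebra_simps)
    moreover have "M * chi a b l * exp (l * t0) \<le> 0" using M l by (simp add: mult_nonneg_nonpos mult_nonpos_nonneg)
    ultimately have "- C * exp (\<rho> * t0) \<le> - (C + 1) * exp (\<rho> * t0)" using E[of t0] K(2) by simp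
    then show False by (simp add: algebra_simps)
  qed
  have "(\<phi> t - \<psi> t) * exp (- l * t) \<le> K * exp ((\<rho> - l) * t)"
    by (rule field_le_epsilon) (use claim[of _ t] in fastforce)
  then have "(\<phi> t - \<psi> t) * exp (- l * t) * exp (l * t) \<le> K * exp ((\<rho> - l) * t) * exp (l * t)"
    by (rule mult_right_mono) simp
  then show ?thesis by (simp add: K_def mult.assoc mult_exp_exp algebra_simps)
qed

text \<open>Alternating \<open>remainder_bound\<close> with the one-sided barrier raises the
  exponent from l by \<open>\<alpha> * x\<close> at a time, capped at z. Negativity of
  \<open>chi a b\<close> on all of (l, z] makes each intermediate exponent admissible.\<close>

lemma sol_diff_improve:
  assumes \<phi>: "sol \<phi> \<phi>' \<phi>''" and \<psi>: "sol \<psi> \<psi>' \<psi>''"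
    and C1: "0 < C1" "\<And>t. \<phi> t \<le> C1 * exp (x * t)" "\<And>t. \<psi> t \<le> C1 * exp (x * t)" and x: "0 < x"
    and l: "0 < l" "l < z" "fin z" "chi a b l \<le> 0" "\<And>\<rho>. l < \<rho> \<Longrightarrow> \<rho> \<le> z \<Longrightarrow> chi a b \<rho> < 0"
    and lim: "((\<lambda>t. (\<phi> t - \<psi> t) * exp (- l * t)) \<longlongrightarrow> 0) at_bot"
  shows "\<exists>C. \<forall>t. \<bar>\<phi> t - \<psi> t\<bar> \<le> C * exp (z * t)"
proof -
  define r where "r n = min z (l + real n * (\<alpha> * x))" for n
  have step: "\<exists>C. \<forall>t. \<bar>\<phi> t - \<psi> t\<bar> \<le> C * exp (r n * t)" for n
  proof (induction n)
    case 0
    have "\<forall>\<^sub>F t in at_bot. \<bar>(\<phi> t - \<psi> t) * exp (- l * t)\<bar> < 1"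
      using lim by (auto simp: tendsto_iff dist_real_def)
    then obtain T0 where T0: "\<And>t. t \<le> T0 \<Longrightarrow> \<bar>(\<phi> t - \<psi> t) * exp (- l * t)\<bar> < 1"
      unfolding eventually_at_bot_linorder by blast
    obtain B1 where B1: "0 < B1" "\<And>t. \<phi> t \<le> B1" using sol_bounded[OF \<phi>] by metis
    obtain B2 where B2: "0 < B2" "\<And>t. \<psi> t \<le> B2" using sol_bounded[OF \<psi>] by metis
    have "\<bar>\<phi> t - \<psi> t\<bar> * exp (- l * t) \<le> 1 + (B1 + B2) * exp (- l * T0)" for t
    proof (cases "t \<le> T0")
      case True
      have "0 \<le> (B1 + B2) * exp (- l * T0)" using B1 B2 by simp
      moreover have "\<bar>\<phi> t - \<psi> t\<bar> * exp (- l * t) < 1" using T0[OF True] by (simp add: abs_mult)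
      ultimately show ?thesis by linarith
    next
      case False
      have "\<bar>\<phi> t - \<psi> t\<bar> \<le> B1 + B2"
        using B1(1) B2(1) B2(2)[of t] B1(2)[of t] sol_nonneg[OF \<phi>, of t] sol_nonneg[OF \<psi>, of t] by linarith
      moreover have "exp (- l * t) \<le> exp (- l * T0)" using l False by simp
      ultimately have "\<bar>\<phi> t - \<psi> t\<bar> * exp (- l * t) \<le> (B1 + B2) * exp (- l * T0)" using B1(1) B2(1) by (intro mult_mono) auto
      then show ?thesis by simp
    qed
    then have "\<bar>\<phi> t - \<psi> t\<bar> * exp (- l * t) * exp (l * t) \<le> (1 + (B1 + B2) * exp (- l * T0)) * exp (l * t)" for t
      by (intro mult_right_mono) auto
    moreover have "r 0 = l" using l by (simp add: r_def)
    ultimately show ?case by (auto simp: mult.assoc mult_exp_exp)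
  next
    case (Suc n)
    then obtain C2 where C2: "\<And>t. \<bar>\<phi> t - \<psi> t\<bar> \<le> C2 * exp (r n * t)" by blast
    have ax: "0 < \<alpha> * x" using \<alpha> x by simp
    have r: "l < r (Suc n)" "r (Suc n) \<le> z" "r (Suc n) \<le> r n + \<alpha> * x"
    proof -
      have "0 < real (Suc n) * (\<alpha> * x)" by (rule mult_pos_pos[OF _ ax]) simp
      then show "l < r (Suc n)" using l unfolding r_def min_less_iff_conj by linarith
      show "r (Suc n) \<le> z" by (simp add: r_def)
      have "real (Suc n) * (\<alpha> * x) = real n * (\<alpha> * x) + \<alpha> * x" by (simp add: distrib_right)
      then show "r (Suc n) \<le> r n + \<alpha> * x" using ax unfolding r_def by linarith
    qed
    have fr: "fin (r (Suc n))" using r l by (intro fin_mono[OF l(3)]) auto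
    have r0: "0 \<le> r (Suc n)" using r l by linarith
    have C2': "\<bar>\<psi> t - \<phi> t\<bar> \<le> C2 * exp (r n * t)" for t using C2[of t] by (simp add: abs_minus_commute)
    obtain C where C: "0 < C" "\<And>t. \<bar>\<phi>'' t - \<psi>'' t - c * (\<phi>' t - \<psi>' t) - a * (\<phi> t - \<psi> t)
      + b * (\<integral>v. \<phi> (t - v) - \<psi> (t - v) \<partial>\<nu>)\<bar> \<le> C * exp (r (Suc n) * t)"
      using remainder_bound[OF \<phi> \<psi> C1 C2 fr r0 r(3)] by blast
    obtain D where D: "0 < D" "\<And>t. \<bar>\<psi>'' t - \<phi>'' t - c * (\<psi>' t - \<phi>' t) - a * (\<psi> t - \<phi> t)
      + b * (\<integral>v. \<psi> (t - v) - \<phi> (t - v) \<partial>\<nu>)\<bar> \<le> D * exp (r (Suc n) * t)"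
      using remainder_bound[OF \<psi> \<phi> C1(1,3,2) C2' fr r0 r(3)] by blast
    have lim': "((\<lambda>t. (\<psi> t - \<phi> t) * exp (- l * t)) \<longlongrightarrow> 0) at_bot"
      using tendsto_minus[OF lim] by (simp add: left_diff_distrib)
    have neg: "- k * e \<le> y" if "\<bar>y\<bar> \<le> k * e" for k e y :: real using that by (simp add: abs_le_iff)
    note i1 = sol_diff_improve_one_sided[OF \<phi> \<psi> l(1) r(1) fr l(4) l(5)[OF r(1,2)] lim neg[OF C(2)] C(1)]
    note i2 = sol_diff_improve_one_sided[OF \<psi> \<phi> l(1) r(1) fr l(4) l(5)[OF r(1,2)] lim' neg[OF D(2)] D(1)]
    define E where "E = max ((C + 1) / (- chi a b (r (Suc n)))) ((D + 1) / (- chi a b (r (Suc n))))"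
    have "\<bar>\<phi> t - \<psi> t\<bar> \<le> E * exp (r (Suc n) * t)" for t
    proof (rule abs_leI)
      show "\<phi> t - \<psi> t \<le> E * exp (r (Suc n) * t)"
        by (rule order_trans[OF i1 mult_right_mono]) (auto simp: E_def)
      have "\<psi> t - \<phi> t \<le> E * exp (r (Suc n) * t)"
        by (rule order_trans[OF i2 mult_right_mono]) (auto simp: E_def)
      then show "- (\<phi> t - \<psi> t) \<le> E * exp (r (Suc n) * t)" by simp
    qed
    then show ?case by blast
  qed
  obtain n where "(z - l) / (\<alpha> * x) < real n" using reals_Archimedean2 by blast
  then have "r n = z" using \<alpha> x by (simp add: r_def field_simps min_def)
  with step[of n] show ?thesis by simp
qed

text \<open>The operator has to be evaluated only at the touching point, and there the sign of the
  difference makes \<open>f_lower\<close> applicable.\<close>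

lemma touching_inequality:
  assumes \<phi>: "sol \<phi> \<phi>' \<phi>''" and \<psi>: "sol \<psi> \<psi>' \<psi>''"
    and dom: "\<And>t. \<bar>t - s\<bar> < d \<Longrightarrow> \<phi> t - \<psi> t \<le> V t" and d: "0 < d" and eq: "\<phi> s - \<psi> s = V s" and V0: "0 \<le> V s"
    and V: "\<And>t. \<bar>t - s\<bar> < d \<Longrightarrow> (V has_real_derivative V' t) (at t)" "(V' has_real_derivative V'') (at s)"
  shows "0 \<le> V'' - c * V' s - m * V s + (\<integral>v. g (\<phi> (s - v)) - g (\<psi> (s - v)) \<partial>\<nu>)"
proof -
  have dw: "((\<lambda>s. \<phi> s - \<psi> s - V s) has_real_derivative \<phi>' t - \<psi>' t - V' t) (at t)" if "\<bar>t - s\<bar> < d" for t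
    using that by (auto intro!: derivative_eq_intros sol_der[OF \<phi>] sol_der[OF \<psi>] V)
  have dw1: "((\<lambda>t. \<phi>' t - \<psi>' t - V' t) has_real_derivative \<phi>'' s - \<psi>'' s - V'') (at s)"
    by (auto intro!: derivative_eq_intros sol_der[OF \<phi>] sol_der[OF \<psi>] V)
  have z: "\<phi>' s - \<psi>' s - V' s = 0" and n: "\<phi>'' s - \<psi>'' s - V'' \<le> 0"
    using local_max_derivs[OF d dw dw1] dom eq by auto
  have "m * (\<phi> s - \<psi> s) \<le> f (\<phi> s) - f (\<psi> s)"
    using eq V0 sol_nonneg[OF \<psi>, of s] by (intro f_lower) auto
  moreover have "(\<integral>v. g (\<phi> (s - v)) - g (\<psi> (s - v)) \<partial>\<nu>) = (\<integral>v. g (\<phi> (s - v)) \<partial>\<nu>) - (\<integral>v. g (\<psi> (s - v)) \<partial>\<nu>)"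
    using g_sol_integrable[OF \<phi>] g_sol_integrable[OF \<psi>] by simp
  moreover have "c * (\<phi>' s - \<psi>' s) = c * V' s" using z by simp
  ultimately show ?thesis
    using sol_eq[OF \<phi>, of s] sol_eq[OF \<psi>, of s] n eq by (simp add: algebra_simps)
qed

text \<open>As \<open>chi m L z\<close> may vanish, touching alone is no contradiction, but it
  forces equality throughout: along with s, the set of maximum points of the weighted difference
  contains s - v for almost every v. At its largest and smallest points this gives v \<ge> 0 and v
  \<le> 0, so \<open>\<nu>\<close> would be concentrated at 0.\<close>

lemma sol_eq_of_little_o:
  assumes \<phi>: "sol \<phi> \<phi>' \<phi>''" and \<psi>: "sol \<psi> \<psi>' \<psi>''"
    and z: "0 < z" "fin z" "chi m L z \<le> 0"
    and lim: "((\<lambda>t. (\<phi> t - \<psi> t) * exp (- z * t)) \<longlongrightarrow> 0) at_bot"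
  shows "\<phi> t = \<psi> t"
proof (rule ccontr)
  assume ne: "\<phi> t \<noteq> \<psi> t"
  define u where "u t = \<bar>\<phi> t - \<psi> t\<bar> * exp (- z * t)" for t
  have t1: "0 < u t" using ne by (simp add: u_def)
  have cu: "continuous_on UNIV u"
    unfolding u_def by (intro continuous_intros sol_continuous[OF \<phi>] sol_continuous[OF \<psi>])
  have lim_u: "(u \<longlongrightarrow> 0) at_bot"
    using tendsto_rabs_zero[OF lim] by (simp add: u_def[abs_def] abs_mult)
  have bot: "\<forall>\<^sub>F s in at_bot. u s < e" if "0 < e" for e by (rule order_tendstoD(2)[OF lim_u that])
  have top: "\<forall>\<^sub>F s in at_top. u s < e" if "0 < e" for e
    unfolding u_def by (rule sol_diff_weighted_top[OF \<phi> \<psi> z(1) that])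
  obtain t0 where t0: "\<And>s. u s \<le> u t0"
    by (rule attains_max_on_closed[OF closed_UNIV cu UNIV_I t1])
      (use bot[OF t1] top[OF t1] in \<open>auto elim: eventually_mono\<close>)
  define M where "M = u t0"
  have M: "0 < M" using t0[of t] t1 by (simp add: M_def)
  define S where "S = {s. u s = M}"
  have dom: "\<bar>\<phi> s - \<psi> s\<bar> \<le> M * exp (z * s)" for s
  proof -
    have "u s * exp (z * s) \<le> M * exp (z * s)" using t0[of s] by (intro mult_right_mono) (auto simp: M_def)
    then show ?thesis by (simp add: u_def mult.assoc mult_exp_exp)
  qed
  have inS: "s \<in> S \<longleftrightarrow> \<bar>\<phi> s - \<psi> s\<bar> = M * exp (z * s)" for s
  proof -
    have "\<bar>\<phi> s - \<psi> s\<bar> = u s * exp (z * s)" by (simp add: u_def mult.assoc mult_exp_exp)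
    then show ?thesis by (simp add: S_def)
  qed
  \<comment> \<open>Stated for an arbitrary pair, because the difference may have either sign at a
    maximum point; \<open>S\<close> is symmetric in the two solutions.\<close>
  have one_sided: "AE v in \<nu>. s - v \<in> S"
    if \<phi>: "sol \<phi> \<phi>' \<phi>''" and \<psi>: "sol \<psi> \<psi>' \<psi>''" and dom: "\<And>s. \<bar>\<phi> s - \<psi> s\<bar> \<le> M * exp (z * s)"
      and inS: "\<And>s. s \<in> S \<longleftrightarrow> \<bar>\<phi> s - \<psi> s\<bar> = M * exp (z * s)" and eq: "\<phi> s - \<psi> s = M * exp (z * s)"
    for \<phi> \<phi>' \<phi>'' \<psi> \<psi>' \<psi>'' s
  proof -
    have dV: "((\<lambda>s. M * exp (z * s)) has_real_derivative M * z * exp (z * t)) (at t)" for t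
      by (auto intro!: derivative_eq_intros)
    have dV': "((\<lambda>s. M * z * exp (z * s)) has_real_derivative M * z\<^sup>2 * exp (z * t)) (at t)" for t
      by (auto intro!: derivative_eq_intros simp: power2_eq_square)
    have "0 \<le> M * z\<^sup>2 * exp (z * s) - c * (M * z * exp (z * s)) - m * (M * exp (z * s))
        + (\<integral>v. g (\<phi> (s - v)) - g (\<psi> (s - v)) \<partial>\<nu>)"
      by (rule touching_inequality[OF \<phi> \<psi> _ zero_less_one eq _ dV dV'])
        (use dom M in \<open>auto simp: abs_le_iff\<close>)
    \<comment> \<open>The pointwise loss in the Lipschitz estimate: nonnegative, yet with a
      nonpositive integral, hence zero almost everywhere.\<close>
    moreover define J where "J v = L * (M * exp (z * s)) * exp (- z * v) - (g (\<phi> (s - v)) - g (\<psi> (s - v)))" for v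
    have Ji: "integrable \<nu> J"
      unfolding J_def using z(2) g_sol_integrable[OF \<phi>] g_sol_integrable[OF \<psi>] by simp
    have "(\<integral>v. J v \<partial>\<nu>) = L * (M * exp (z * s)) * T z - (\<integral>v. g (\<phi> (s - v)) - g (\<psi> (s - v)) \<partial>\<nu>)"
      unfolding J_def using z(2) g_sol_integrable[OF \<phi>] g_sol_integrable[OF \<psi>] by (simp add: T_def)
    ultimately have "(\<integral>v. J v \<partial>\<nu>) \<le> chi m L z * (M * exp (z * s))"
      by (simp add: chi_def algebra_simps)
    also have "\<dots> \<le> 0" using z(3) M by (simp add: mult_nonpos_nonneg)
    finally have J0: "(\<integral>v. J v \<partial>\<nu>) \<le> 0" .
    have Jge: "L * (M * exp (z * (s - v)) - \<bar>\<phi> (s - v) - \<psi> (s - v)\<bar>) \<le> J v" for v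
    proof -
      have "g (\<phi> (s - v)) - g (\<psi> (s - v)) \<le> L * \<bar>\<phi> (s - v) - \<psi> (s - v)\<bar>"
        using g_lip[OF sol_nonneg[OF \<phi>] sol_nonneg[OF \<psi>], of "s - v" "s - v"] by (simp add: abs_le_iff)
      then show ?thesis by (simp add: J_def right_diff_distrib mult.assoc mult_exp_exp)
    qed
    have Jnn: "0 \<le> J v" for v
      using order_trans[OF mult_nonneg_nonneg Jge[of v]] dom[of "s - v"] Lb ab by simp
    have "(\<integral>v. J v \<partial>\<nu>) = 0" using J0 Bochner_Integration.integral_nonneg[of \<nu> J] Jnn by (intro antisym) simp_all
    then have "AE v in \<nu>. J v = 0"
      using integral_nonneg_eq_0_iff_AE[OF Ji] Jnn by simp
    then show ?thesis
    proof eventually_elim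
      case (elim v)
      then have "L * (M * exp (z * (s - v)) - \<bar>\<phi> (s - v) - \<psi> (s - v)\<bar>) \<le> 0" using Jge[of v] by simp
      then have "M * exp (z * (s - v)) \<le> \<bar>\<phi> (s - v) - \<psi> (s - v)\<bar>" using Lb ab by (simp add: mult_le_0_iff)
      with dom[of "s - v"] show ?case by (simp add: inS)
    qed
  qed
  have step: "AE v in \<nu>. s - v \<in> S" if "s \<in> S" for s
  proof (cases "0 \<le> \<phi> s - \<psi> s")
    case True
    with that show ?thesis by (intro one_sided[OF \<phi> \<psi> dom inS]) (simp add: inS)
  next
    case False
    with that show ?thesis
      by (intro one_sided[OF \<psi> \<phi>]) (use dom inS in \<open>simp_all add: abs_minus_commute\<close>)
  qed
  have "compact S"
  proof (subst compact_eq_bounded_closed, intro conjI)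
    obtain A where A: "\<And>s. s \<le> A \<Longrightarrow> u s < M" using bot[OF M] unfolding eventually_at_bot_linorder by blast
    obtain B where B: "\<And>s. B \<le> s \<Longrightarrow> u s < M" using top[OF M] unfolding eventually_at_top_linorder by blast
    have "s \<in> {A..B}" if "s \<in> S" for s
      using that A[of s] B[of s] by (cases "s \<le> A"; cases "B \<le> s") (auto simp: S_def)
    then have "S \<subseteq> {A..B}" by blast
    then show "bounded S" using bounded_closed_interval bounded_subset by blast
    show "closed S" unfolding S_def using cu by (intro closed_Collect_eq) auto
  qed
  moreover have "S \<noteq> {}" using M_def by (auto simp: S_def)
  ultimately obtain hi lo where hi: "hi \<in> S" "\<And>s. s \<in> S \<Longrightarrow> s \<le> hi" and lo: "lo \<in> S" "\<And>s. s \<in> S \<Longrightarrow> lo \<le> s"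
    using compact_attains_sup[of S] compact_attains_inf[of S] by metis
  have "AE v in \<nu>. v \<in> {0}"
    using step[OF hi(1)] step[OF lo(1)]
  proof eventually_elim
    case (elim v)
    from hi(2)[OF elim(1)] lo(2)[OF elim(2)] show ?case by simp
  qed
  then have "measure \<nu> {0} = measure \<nu> UNIV" by (intro finite_measure_eq_AE) auto
  with null0 mass show False by simp
qed

end

section \<open>Translations and limits at -infinity\<close>

lemma filterlim_shift_at_bot: "filterlim (\<lambda>t. t + \<tau>) at_bot (at_bot :: real filter)"
  unfolding filterlim_at_bot
proof
  fix Z :: real
  show "\<forall>\<^sub>F t in at_bot. t + \<tau> \<le> Z"
    using eventually_le_at_bot[of "Z - \<tau>"] by eventually_elim simp
qed

lemma tendsto_shift_linear_at_bot:
  fixes u :: "real \<Rightarrow> real"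
  assumes "((\<lambda>t. u t / (- t)) \<longlongrightarrow> A) at_bot"
  shows "((\<lambda>t. u (t + \<tau>) / (- t)) \<longlongrightarrow> A) at_bot"
proof -
  have 1: "((\<lambda>t. u (t + \<tau>) / (- (t + \<tau>))) \<longlongrightarrow> A) at_bot"
    using filterlim_compose[OF assms filterlim_shift_at_bot] .
  have 2: "((\<lambda>t. (t + \<tau>) / t) \<longlongrightarrow> 1) at_bot" by real_asymp
  have "((\<lambda>t. u (t + \<tau>) / (- (t + \<tau>)) * ((t + \<tau>) / t)) \<longlongrightarrow> A) at_bot"
    using tendsto_mult[OF 1 2] by simp
  moreover have "\<forall>\<^sub>F t in at_bot. u (t + \<tau>) / (- (t + \<tau>)) * ((t + \<tau>) / t) = u (t + \<tau>) / (- t)"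
    using eventually_le_at_bot[of "- \<bar>\<tau>\<bar> - 1"]
  proof eventually_elim
    case (elim t)
    then have "t + \<tau> \<noteq> 0" "t \<noteq> 0" by auto
    moreover have "x / (- y) * (y / t) = x / (- t)" if "y \<noteq> 0" for x y using that by simp
    ultimately show ?case by blast
  qed
  ultimately show ?thesis by (rule Lim_transform_eventually)
qed

lemma exp_shift:
  fixes x l t \<tau> :: real
  shows "exp (l * \<tau>) * (x * exp (- l * (t + \<tau>))) = x * exp (- l * t)"
proof -
  have "exp (- l * t) = exp (l * \<tau>) * exp (- l * (t + \<tau>))" by (simp add: mult_exp_exp algebra_simps)
  then show ?thesis by (simp only: mult.left_commute)
qed

context wave
begin

text \<open>At a double zero \<open>l\<close> the linear operator annihilates \<open>exp (l t)\<close> and \<open>t exp (l t)\<close>, while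
  \<open>exp ((l + k) t)\<close> is a strict subsolution. Hence \<open>\<eta> t exp (l t)\<close>, cut off to \<open>0\<close> for \<open>t \<ge> 0\<close>, is a
  supersolution so far to the left (\<open>t < \<tau>\<close>) that the nonlocal effect of the cut-off is negligible.\<close>

lemma critical_barrier:
  assumes \<phi>: "sol \<phi> \<phi>' \<phi>''" and \<psi>: "sol \<psi> \<psi>' \<psi>''"
    and l: "0 < l" "0 < k" "fin (l + k)" "chi a b l = 0" "drift l = 0" and crit: "a = m" "b = L"
    and lim: "((\<lambda>t. (\<phi> t - \<psi> t) * exp (- l * t) / (- t)) \<longlongrightarrow> 0) at_bot"
    and \<tau>: "\<tau> < 0" "2 * b * (\<integral>v. indicator {..\<tau>} v * exp (- (l + k) * v) \<partial>\<nu>) < chi a b (l + k)"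
    and N: "\<And>t. \<tau> \<le> t \<Longrightarrow> \<bar>\<phi> t - \<psi> t\<bar> \<le> N * exp (l * t)"
  shows "\<bar>\<phi> t - \<psi> t\<bar> \<le> N * exp (l * t)"
proof -
  have fl: "fin l" using l by (intro fin_mono[OF l(3)]) auto
  \<comment> \<open>The linear operator sends \<eta> exp (l t) to a negative multiple of exp ((l +
    k) t), with the factor - chi (l + k) / k: the terms with exp (l t) and t exp (l t) vanish
    together with \<open>chi a b l\<close> and \<open>drift l\<close>.\<close>
  define \<eta> where "\<eta> t = - t + (1 - exp (k * t)) / k" for t
  have \<eta>: "0 \<le> \<eta> t" "- t \<le> \<eta> t" if "t \<le> 0" for t
  proof -
    have "0 \<le> (1 - exp (k * t)) / k" using that l by (simp add: mult_nonneg_nonpos)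
    with that show "0 \<le> \<eta> t" "- t \<le> \<eta> t" by (simp_all add: \<eta>_def)
  qed
  have N0: "0 \<le> N"
  proof -
    have "0 \<le> N * exp (l * \<tau>)" using order_trans[OF abs_ge_zero N[of \<tau>]] by simp
    then show ?thesis by (simp add: zero_le_mult_iff)
  qed
  define X where "X = chi a b (l + k)"
  define \<Lambda> where "\<Lambda> = (\<integral>v. indicator {..\<tau>} v * exp (- (l + k) * v) \<partial>\<nu>)"

  have contra: False
    if \<phi>: "sol \<phi> \<phi>' \<phi>''" and \<psi>: "sol \<psi> \<psi>' \<psi>''" and e: "0 < e" and M: "0 < M" and t0: "t0 < \<tau>"
      and left: "\<And>t. t \<le> \<tau> \<Longrightarrow> \<bar>\<phi> t - \<psi> t\<bar> \<le> (N + M + e * \<eta> t) * exp (l * t)"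
      and right: "\<And>t. \<tau> \<le> t \<Longrightarrow> \<bar>\<phi> t - \<psi> t\<bar> \<le> N * exp (l * t)"
      and eq: "\<phi> t0 - \<psi> t0 = (N + M + e * \<eta> t0) * exp (l * t0)"
    for \<phi> \<phi>' \<phi>'' \<psi> \<psi>' \<psi>'' e M t0
  proof -
    define ek where "ek = e / k"
    have ek: "0 < ek" using e l(2) by (simp add: ek_def)
    define Q where "Q = N + M + ek"
    define W where "W t = Q * exp (l * t) - e * (t * exp (l * t)) - ek * exp ((l + k) * t)" for t
    define W' where "W' t = Q * l * exp (l * t) - e * ((1 + l * t) * exp (l * t)) - ek * (l + k) * exp ((l + k) * t)" for t
    define W'' where "W'' = Q * l\<^sup>2 * exp (l * t0) - e * ((2 * l + l\<^sup>2 * t0) * exp (l * t0)) - ek * (l + k)\<^sup>2 * exp ((l + k) * t0)"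
    have W: "(N + M + e * \<eta> t) * exp (l * t) = W t" for t
      using l(2) by (simp add: W_def Q_def ek_def \<eta>_def distrib_right exp_add field_simps)
    have dW: "(W has_real_derivative W' t) (at t)" for t
      unfolding W_def W'_def by (auto intro!: derivative_eq_intros simp: algebra_simps)
    have dW': "(W' has_real_derivative W'') (at t0)"
      unfolding W'_def W''_def by (auto intro!: derivative_eq_intros simp: algebra_simps power2_eq_square)
    have W0: "0 \<le> W t0"
      unfolding W[symmetric] using N0 M e \<eta>(1)[of t0] t0 \<tau> by (intro mult_nonneg_nonneg) auto
    have "0 < \<tau> - t0" using t0 by simp
    have ineq: "0 \<le> W'' - c * W' t0 - m * W t0 + (\<integral>v. g (\<phi> (t0 - v)) - g (\<psi> (t0 - v)) \<partial>\<nu>)"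
    proof (rule touching_inequality[OF \<phi> \<psi> _ \<open>0 < \<tau> - t0\<close> _ W0 dW dW'])
      show "\<phi> t - \<psi> t \<le> W t" if "\<bar>t - t0\<bar> < \<tau> - t0" for t
      proof -
        have "t \<le> \<tau>" using that by (simp add: abs_less_iff)
        from left[OF this] show ?thesis unfolding W by (simp add: abs_le_iff)
      qed
      show "\<phi> t0 - \<psi> t0 = W t0" using eq by (simp add: W)
    qed
    \<comment> \<open>For t \<ge> 0 the barrier \<open>W\<close> may be negative. There e t \<le> ek
      exp (k t), so twice \<open>ek * exp ((l + k) * t)\<close> makes up for both negative terms of
      \<open>e * \<eta> t\<close>.\<close>
    have dom: "\<bar>\<phi> t - \<psi> t\<bar> \<le> W t + indicator {0..} t * (2 * ek * exp ((l + k) * t))" for t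
    proof (cases "t \<le> \<tau>")
      case True
      with left[OF True] \<tau> show ?thesis by (simp add: W)
    next
      case False
      have "N * exp (l * t) \<le> W t + indicator {0..} t * (2 * ek * exp ((l + k) * t))"
      proof (cases "0 \<le> t")
        case True
        have "t \<le> exp (k * t) / k" using abs_le_exp[OF l(2), of t] True by simp
        from mult_left_mono[OF this, of e] have "e * t \<le> ek * exp (k * t)" using e by (simp add: ek_def)
        moreover have "e * (- t + (1 - exp (k * t)) / k) = - (e * t) + ek - ek * exp (k * t)"
          using l(2) by (simp add: ek_def field_simps)
        moreover have "0 < ek * exp (k * t)" using ek by simp
        ultimately have "N \<le> N + M + e * (- t + (1 - exp (k * t)) / k) + 2 * ek * exp (k * t)"
          using M ek by linarith
        then have "N * exp (l * t) \<le> (N + M + e * \<eta> t + 2 * ek * exp (k * t)) * exp (l * t)"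
          by (intro mult_right_mono) (simp_all add: \<eta>_def)
        also have "\<dots> = W t + 2 * ek * exp ((l + k) * t)"
        proof -
          have "exp ((l + k) * t) = exp (k * t) * exp (l * t)" by (simp add: mult_exp_exp algebra_simps)
          then show ?thesis unfolding W[symmetric] by (simp add: distrib_right)
        qed
        finally show ?thesis using True by simp
      next
        case False
        then have "N * exp (l * t) \<le> (N + M + e * \<eta> t) * exp (l * t)"
          using M e \<eta>(1)[of t] by (intro mult_right_mono) auto
        with False show ?thesis by (simp add: W)
      qed
      with right[of t] False show ?thesis by simp
    qed
    have iv: "integrable \<nu> (\<lambda>v. v * exp (- l * v))" by (rule integrable_mult_exp[OF l(1-3)])
    define J where "J v = Q * exp (l * t0) * exp (- l * v) - e * t0 * exp (l * t0) * exp (- l * v)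
      + e * exp (l * t0) * (v * exp (- l * v)) - ek * exp ((l + k) * t0) * exp (- (l + k) * v)" for v
    have Jeq: "W (t0 - v) = J v" for v
      by (simp add: W_def J_def right_diff_distrib left_diff_distrib exp_diff exp_minus exp_add field_simps)
    have Ji: "integrable \<nu> J" unfolding J_def using fl l(3) iv by simp
    have JI: "(\<integral>v. J v \<partial>\<nu>) = Q * exp (l * t0) * T l - e * t0 * exp (l * t0) * T l
      + e * exp (l * t0) * (\<integral>v. v * exp (- l * v) \<partial>\<nu>) - ek * exp ((l + k) * t0) * T (l + k)"
      unfolding J_def using fl l(3) iv by (simp add: T_def)
    \<comment> \<open>The correction acts only where t0 - v \<ge> 0, and then v \<le> \<tau> because
      t0 < \<tau>. The hypothesis on \<open>\<tau>\<close> makes this tail of the transform too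
      small to offset \<open>X\<close>.\<close>
    define I where "I v = indicator {..\<tau>} v * exp (- (l + k) * v)" for v
    have Ii: "integrable \<nu> I"
    proof (rule Bochner_Integration.integrable_bound[OF l(3)])
      show "I \<in> borel_measurable \<nu>" unfolding I_def by (rule meas_nu) measurable
    qed (auto simp: I_def indicator_def)
    have "(\<integral>v. g (\<phi> (t0 - v)) - g (\<psi> (t0 - v)) \<partial>\<nu>) \<le> (\<integral>v. L * (J v + 2 * ek * exp ((l + k) * t0) * I v) \<partial>\<nu>)"
    proof (rule integral_mono)
      show "integrable \<nu> (\<lambda>v. g (\<phi> (t0 - v)) - g (\<psi> (t0 - v)))"
        using g_sol_integrable[OF \<phi>] g_sol_integrable[OF \<psi>] by simp
      show "integrable \<nu> (\<lambda>v. L * (J v + 2 * ek * exp ((l + k) * t0) * I v))" using Ji Ii by simp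
      fix v
      have "g (\<phi> (t0 - v)) - g (\<psi> (t0 - v)) \<le> L * \<bar>\<phi> (t0 - v) - \<psi> (t0 - v)\<bar>"
        using g_lip[OF sol_nonneg[OF \<phi>] sol_nonneg[OF \<psi>], of "t0 - v" "t0 - v"] by (simp add: abs_le_iff)
      also have "\<dots> \<le> L * (J v + 2 * ek * exp ((l + k) * t0) * I v)"
      proof (rule mult_left_mono)
        have "indicator {0..} (t0 - v) * (2 * ek * exp ((l + k) * (t0 - v))) \<le> 2 * ek * exp ((l + k) * t0) * I v"
        proof (cases "0 \<le> t0 - v")
          case True
          then have "v \<le> \<tau>" using t0 by simp
          moreover have "exp ((l + k) * (t0 - v)) = exp ((l + k) * t0) * exp (- (l + k) * v)"
            by (simp add: mult_exp_exp algebra_simps)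
          ultimately show ?thesis using True by (simp add: I_def)
        next
          case False
          then show ?thesis using ek by (simp add: I_def)
        qed
        with dom[of "t0 - v"] show "\<bar>\<phi> (t0 - v) - \<psi> (t0 - v)\<bar> \<le> J v + 2 * ek * exp ((l + k) * t0) * I v"
          by (simp add: Jeq)
      qed (use Lb ab in simp)
      finally show "g (\<phi> (t0 - v)) - g (\<psi> (t0 - v)) \<le> L * (J v + 2 * ek * exp ((l + k) * t0) * I v)" .
    qed
    also have "\<dots> = b * (\<integral>v. J v \<partial>\<nu>) + 2 * ek * exp ((l + k) * t0) * (b * \<Lambda>)"
    proof -
      have "\<Lambda> = integral\<^sup>L \<nu> I" by (simp add: \<Lambda>_def I_def[abs_def])
      then show ?thesis using Ji Ii crit(2) by (simp add: distrib_left)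
    qed
    finally have "0 \<le> W'' - c * W' t0 - a * W t0 + b * (\<integral>v. J v \<partial>\<nu>) + 2 * ek * exp ((l + k) * t0) * (b * \<Lambda>)"
      using ineq crit(1) by simp
    also have "W'' - c * W' t0 - a * W t0 + b * (\<integral>v. J v \<partial>\<nu>)
        = Q * exp (l * t0) * chi a b l - e * t0 * exp (l * t0) * chi a b l - e * exp (l * t0) * drift l
          - ek * exp ((l + k) * t0) * X"
      unfolding JI W''_def W'_def W_def X_def chi_def drift_def by (simp add: algebra_simps)
    finally have "0 \<le> (ek * exp ((l + k) * t0)) * (2 * b * \<Lambda> - X)"
      by (simp add: l(4,5) algebra_simps)
    moreover have "(ek * exp ((l + k) * t0)) * (2 * b * \<Lambda> - X) < 0"
      using \<tau>(2) ek by (intro mult_pos_neg) (auto simp: \<Lambda>_def X_def)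
    ultimately show False by simp
  qed

  have claim: "\<bar>\<phi> t - \<psi> t\<bar> * exp (- l * t) \<le> N + e * \<eta> t" if e: "0 < e" and t: "t \<le> \<tau>" for e t
  proof (rule ccontr)
    define u where "u t = \<bar>\<phi> t - \<psi> t\<bar> * exp (- l * t) - N - e * \<eta> t" for t
    assume "\<not> ?thesis"
    then have t1: "0 < u t" by (simp add: u_def)
    have cu: "continuous_on {..\<tau>} u"
      unfolding u_def \<eta>_def using l(2)
      by (intro continuous_intros continuous_on_subset[OF sol_continuous[OF \<phi>]] continuous_on_subset[OF sol_continuous[OF \<psi>]]) auto
    obtain t0 where t0: "t0 \<in> {..\<tau>}" "\<And>s. s \<in> {..\<tau>} \<Longrightarrow> u s \<le> u t0"
    proof (rule attains_max_on_closed[OF closed_atMost cu _ t1])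
      show "t \<in> {..\<tau>}" using t by simp
      show "\<forall>\<^sub>F s in at_top. s \<in> {..\<tau>} \<longrightarrow> u s < u t"
        using eventually_gt_at_top[of \<tau>] by eventually_elim simp
      show "\<forall>\<^sub>F s in at_bot. s \<in> {..\<tau>} \<longrightarrow> u s < u t"
        using order_tendstoD(2)[OF tendsto_rabs_zero[OF lim] e] eventually_le_at_bot[of "- 1"]
      proof eventually_elim
        case (elim s)
        then have s: "0 < - s" by simp
        have "\<bar>\<phi> s - \<psi> s\<bar> * exp (- l * s) / (- s) < e" using elim by (simp add: abs_mult)
        then have "\<bar>\<phi> s - \<psi> s\<bar> * exp (- l * s) < e * (- s)" using s by (simp only: pos_divide_less_eq)
        also have "\<dots> \<le> e * \<eta> s" using e \<eta>(2)[of s] s by (intro mult_left_mono) auto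
        finally have "u s < 0" using N0 by (simp add: u_def)
        with t1 show ?case by linarith
      qed
    qed blast
    define M where "M = u t0"
    have M: "0 < M" using t0(2)[of t] t t1 by (simp add: M_def)
    have "u \<tau> \<le> 0"
    proof -
      have "\<bar>\<phi> \<tau> - \<psi> \<tau>\<bar> * exp (- l * \<tau>) \<le> N * exp (l * \<tau>) * exp (- l * \<tau>)" by (intro mult_right_mono N) auto
      moreover have "0 \<le> e * \<eta> \<tau>" using e \<eta>(1)[of \<tau>] \<tau> by simp
      ultimately show ?thesis by (simp add: u_def mult.assoc mult_exp_exp)
    qed
    with M have "t0 \<noteq> \<tau>" by (auto simp: M_def)
    with t0 have t0': "t0 < \<tau>" by simp
    have id: "\<bar>\<phi> s - \<psi> s\<bar> = (N + u s + e * \<eta> s) * exp (l * s)" for s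
      by (simp add: u_def mult.assoc mult_exp_exp)
    have left: "\<bar>\<phi> s - \<psi> s\<bar> \<le> (N + M + e * \<eta> s) * exp (l * s)" if "s \<le> \<tau>" for s
      unfolding id using t0(2)[of s] that by (intro mult_right_mono) (auto simp: M_def)
    have eq: "\<bar>\<phi> t0 - \<psi> t0\<bar> = (N + M + e * \<eta> t0) * exp (l * t0)" using id[of t0] by (simp add: M_def)
    show False
    proof (cases "0 \<le> \<phi> t0 - \<psi> t0")
      case True
      show False by (rule contra[OF \<phi> \<psi> e M t0' left N]) (use eq True in auto)
    next
      case False
      show False
        by (rule contra[OF \<psi> \<phi> e M t0']) (use left N eq False in \<open>simp_all add: abs_minus_commute\<close>)
    qed
  qed
  show ?thesis
  proof (cases "\<tau> \<le> t")
    case False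
    then have t: "t \<le> \<tau>" "t \<le> 0" using \<tau> by auto
    have "\<bar>\<phi> t - \<psi> t\<bar> * exp (- l * t) \<le> N"
    proof (rule field_le_epsilon)
      fix e :: real assume e: "0 < e"
      \<comment> \<open>At the fixed point \<open>t\<close> the barrier term becomes arbitrarily
        small when the coefficient is scaled by \<eta> t + 1.\<close>
      have "e / (\<eta> t + 1) * \<eta> t \<le> e" using \<eta>(1)[OF t(2)] e by (simp add: field_simps)
      moreover have "\<bar>\<phi> t - \<psi> t\<bar> * exp (- l * t) \<le> N + e / (\<eta> t + 1) * \<eta> t"
        using \<eta>(1)[OF t(2)] e by (intro claim t) (simp add: add_nonneg_pos)
      ultimately show "\<bar>\<phi> t - \<psi> t\<bar> * exp (- l * t) \<le> N + e" by linarith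
    qed
    then have "\<bar>\<phi> t - \<psi> t\<bar> * exp (- l * t) * exp (l * t) \<le> N * exp (l * t)" by (rule mult_right_mono) simp
    then show ?thesis by (simp add: mult.assoc mult_exp_exp)
  qed (rule N)
qed

text \<open>\<open>critical_barrier\<close> propagates a bound N exp (l t) from a right half-line to
  the whole line. The endpoint \<open>\<tau>\<close> depends only on the equation, so a translation
  moves the half-line far enough to the right for the weighted difference to be below any given e;
  then e tends to 0.\<close>

lemma sol_eq_of_critical:
  assumes \<phi>: "sol \<phi> \<phi>' \<phi>''" and \<psi>: "sol \<psi> \<psi>' \<psi>''"
    and l: "0 < l" "0 < k" "fin (l + k)" "chi a b l = 0" "drift l = 0" and crit: "a = m" "b = L"
    and lim: "((\<lambda>t. (\<phi> t - \<psi> t) * exp (- l * t) / (- t)) \<longlongrightarrow> 0) at_bot"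
  shows "\<phi> t = \<psi> t"
proof -
  have X: "0 < chi a b (l + k)"
  proof -
    have "k\<^sup>2 \<le> chi a b (l + k)" using chi_tangent[OF l(1-3) l(3)] l(4,5) by simp
    moreover have "0 < k\<^sup>2" using l(2) by simp
    ultimately show ?thesis by linarith
  qed
  have "(\<lambda>n. 2 * b * (\<integral>v. indicator {..- (1 + real n)} v * exp (- (l + k) * v) \<partial>\<nu>)) \<longlonglongrightarrow> 2 * b * (\<integral>v. 0 \<partial>\<nu>)"
  proof (intro tendsto_intros, rule integral_dominated_convergence[OF _ _ l(3)])
    show "(\<lambda>v. indicator {..- (1 + real n)} v * exp (- (l + k) * v)) \<in> borel_measurable \<nu>" for n
      by (rule meas_nu) measurable
    show "AE v in \<nu>. (\<lambda>n. indicator {..- (1 + real n)} v * exp (- (l + k) * v)) \<longlonglongrightarrow> 0"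
    proof (intro AE_I2 tendsto_eventually)
      fix v :: real
      obtain n0 where "- v < real n0" using reals_Archimedean2 by blast
      then show "\<forall>\<^sub>F n in sequentially. indicator {..- (1 + real n)} v * exp (- (l + k) * v) = 0"
        by (intro eventually_sequentiallyI[of n0]) (auto simp: indicator_def)
    qed
    show "AE v in \<nu>. norm (indicator {..- (1 + real n)} v * exp (- (l + k) * v)) \<le> exp (- (l + k) * v)" for n
      by (auto simp: indicator_def)
  qed auto
  then have "(\<lambda>n. 2 * b * (\<integral>v. indicator {..- (1 + real n)} v * exp (- (l + k) * v) \<partial>\<nu>)) \<longlonglongrightarrow> 0" by simp
  from order_tendstoD(2)[OF this X] obtain n where
    n: "2 * b * (\<integral>v. indicator {..- (1 + real n)} v * exp (- (l + k) * v) \<partial>\<nu>) < chi a b (l + k)"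
    by (auto simp: eventually_sequentially)
  define \<tau> where "\<tau> = - (1 + real n)"
  have \<tau>: "\<tau> < 0" by (simp add: \<tau>_def)
  have "\<bar>\<phi> t - \<psi> t\<bar> * exp (- l * t) \<le> 0 + e" if e: "0 < e" for e
  proof -
    obtain T1 where T1: "\<And>s. T1 \<le> s \<Longrightarrow> \<bar>\<phi> s - \<psi> s\<bar> * exp (- l * s) < e"
      using sol_diff_weighted_top[OF \<phi> \<psi> l(1) e] unfolding eventually_at_top_linorder by blast
    define \<sigma> where "\<sigma> = T1 - \<tau>"
    have "\<bar>\<phi> (t - \<sigma> + \<sigma>) - \<psi> (t - \<sigma> + \<sigma>)\<bar> \<le> e * exp (l * \<sigma>) * exp (l * (t - \<sigma>))"
    proof (rule critical_barrier[OF sol_shift[OF \<phi>, of \<sigma>] sol_shift[OF \<psi>, of \<sigma>] l crit _ \<tau> n[folded \<tau>_def]])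
      have "((\<lambda>t. (\<phi> (t + \<sigma>) - \<psi> (t + \<sigma>)) * exp (- l * (t + \<sigma>)) / (- t)) \<longlongrightarrow> 0) at_bot"
        by (rule tendsto_shift_linear_at_bot[OF lim])
      from tendsto_mult_left[OF this, of "exp (l * \<sigma>)"]
      show "((\<lambda>t. (\<phi> (t + \<sigma>) - \<psi> (t + \<sigma>)) * exp (- l * t) / (- t)) \<longlongrightarrow> 0) at_bot"
        by (simp only: times_divide_eq_right exp_shift mult_zero_right)
      fix s assume "\<tau> \<le> s"
      then have "T1 \<le> s + \<sigma>" by (simp add: \<sigma>_def)
      from T1[OF this] have "\<bar>\<phi> (s + \<sigma>) - \<psi> (s + \<sigma>)\<bar> * exp (- l * (s + \<sigma>)) * exp (l * (s + \<sigma>)) \<le> e * exp (l * (s + \<sigma>))"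
        by (intro mult_right_mono) auto
      then show "\<bar>\<phi> (s + \<sigma>) - \<psi> (s + \<sigma>)\<bar> \<le> e * exp (l * \<sigma>) * exp (l * s)"
        by (simp add: mult.assoc mult_exp_exp distrib_left add.commute)
    qed
    then have "\<bar>\<phi> t - \<psi> t\<bar> \<le> e * exp (l * t)" by (simp add: mult.assoc mult_exp_exp right_diff_distrib)
    then have "\<bar>\<phi> t - \<psi> t\<bar> * exp (- l * t) \<le> e * exp (l * t) * exp (- l * t)" by (rule mult_right_mono) simp
    then show ?thesis by (simp add: mult.assoc mult_exp_exp)
  qed
  then have "\<bar>\<phi> t - \<psi> t\<bar> * exp (- l * t) \<le> 0" by (rule field_le_epsilon)
  then show ?thesis by (simp add: mult_le_0_iff)
qed

section \<open>Uniqueness up to translation\<close>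

definition wavefront :: "(real \<Rightarrow> real) \<Rightarrow> bool" where
  "wavefront \<phi> \<longleftrightarrow> (\<exists>\<phi>' \<phi>''. sol \<phi> \<phi>' \<phi>'') \<and> (\<forall>t. 0 < \<phi> t) \<and> (\<phi> \<longlongrightarrow> 0) at_bot"

text \<open>\<open>chi a b\<close> equals b - a > 0 at 0 and is negative at z, so it has a zero l
  between, with negative slope by convexity. The difference of suitably translated profiles is o(exp
  (l t)) and improves to an exponent beyond z, where \<open>sol_eq_of_little_o\<close> takes
  over.\<close>

lemma wavefront_unique_noncritical:
  assumes z: "0 < z" "0 < k" "fin (z + k)" "chi m L z \<le> 0" "chi a b z < 0"
    and \<phi>: "wavefront \<phi>" and \<psi>: "wavefront \<psi>"
  shows "\<exists>\<tau>. \<forall>t. \<phi> t = \<psi> (t + \<tau>)"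
proof -
  have fz: "fin z" using z by (intro fin_mono[OF z(3)]) auto
  have "\<exists>l\<ge>0. l \<le> z \<and> chi a b l = 0"
    using z ab by (intro IVT2' chi_continuous[OF fz]) (auto simp: chi_def[of _ _ 0])
  then obtain l where l0: "0 \<le> l" "l \<le> z" "chi a b l = 0" by blast
  have "l \<noteq> 0" "l \<noteq> z" using l0(3) z(5) ab by (auto simp: chi_def[of _ _ 0])
  with l0 have l: "0 < l" "l < z" by auto
  define k1 where "k1 = z - l"
  have k1: "0 < k1" "fin (l + k1)" using l fz by (auto simp: k1_def)
  have dl: "drift l < 0"
  proof -
    have "drift l * (z - l) + (z - l)\<^sup>2 < 0" using chi_tangent[OF l(1) k1 fz] l0(3) z(5) by simp
    then have "drift l * (z - l) < 0" by (smt (verit) zero_le_power2)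
    then show ?thesis using l by (simp add: mult_less_0_iff)
  qed
  have "isCont (chi a b) z" by (rule DERIV_isCont[OF chi_derivative[OF z(1-3)]])
  then have "(chi a b \<longlongrightarrow> chi a b z) (at_right z)"
    by (auto simp: isCont_def intro: tendsto_mono[OF at_le])
  from order_tendstoD(2)[OF this z(5)] obtain d where d: "z < d" "\<And>y. z < y \<Longrightarrow> y < d \<Longrightarrow> chi a b y < 0"
    by (auto simp: eventually_at_right_field)
  \<comment> \<open>Strictly beyond z, so that a difference of order exp (z' t) is o(exp (z t)) at
    -infinity.\<close>
  define z' where "z' = (z + min d (z + k)) / 2"
  have z': "z < z'" "z' < d" "z' < z + k" using d z by (auto simp: z'_def)
  have fz': "fin z'" using z z' by (intro fin_mono[OF z(3)]) auto
  have cz': "chi a b z' < 0" using d(2)[OF z'(1,2)] .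
  \<comment> \<open>Convexity: a nonnegative value at \<open>\<rho>\<close> and the negative one at
    \<open>z'\<close> would force a negative slope at \<open>\<rho>\<close>, hence a positive value
    at l.\<close>
  have neg: "chi a b \<rho> < 0" if "l < \<rho>" "\<rho> \<le> z'" for \<rho>
  proof (cases "\<rho> = z'")
    case False
    with that have \<rho>: "l < \<rho>" "\<rho> < z'" by auto
    have r: "0 < \<rho>" "0 < z' - \<rho>" "fin (\<rho> + (z' - \<rho>))" using \<rho> l fz' by auto
    have fl: "fin l" using l by (intro fin_mono[OF fz]) auto
    show ?thesis
    proof (rule ccontr)
      assume "\<not> ?thesis"
      then have nn: "0 \<le> chi a b \<rho>" by simp
      have "drift \<rho> * (z' - \<rho>) + (z' - \<rho>)\<^sup>2 < 0" using chi_tangent[OF r fz'] nn cz' by linarith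
      then have "drift \<rho> * (z' - \<rho>) < 0" by (smt (verit) zero_le_power2)
      then have "drift \<rho> < 0" using \<rho> by (simp add: mult_less_0_iff)
      then have "0 < drift \<rho> * (l - \<rho>)" using \<rho> by (simp add: mult_neg_neg)
      with chi_tangent[OF r fl] nn l0(3) zero_le_power2[of "l - \<rho>"] show False by linarith
    qed
  qed (use cz' in simp)
  have asym: "\<exists>A\<ge>0. ((\<lambda>t. u t * exp (- l * t)) \<longlongrightarrow> A) at_bot" if w: "wavefront u" for u
    using w sol_asymptotics(1)[OF _ _ _ l(1) k1 l0(3) less_imp_le[OF dl] dl] unfolding wavefront_def by blast
  have l2: "0 < l / 2" "l / 2 < l" using l by auto
  have dec: "\<exists>C>0. \<forall>t. u t \<le> C * exp (l / 2 * t)" if w: "wavefront u" for u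
    using w decay_below_root[OF _ _ _ l(1) k1 l0(3) less_imp_le[OF dl] l2] unfolding wavefront_def by blast
  have equal: "u t = w t"
    if u: "sol u u' u''" and w: "sol w w' w''"
      and C: "0 < C" "\<And>t. u t \<le> C * exp (l / 2 * t)" "\<And>t. w t \<le> C * exp (l / 2 * t)"
      and lim: "((\<lambda>t. (u t - w t) * exp (- l * t)) \<longlongrightarrow> 0) at_bot"
    for u u' u'' w w' w'' C t
  proof (rule sol_eq_of_little_o[OF u w z(1) fz z(4)])
    obtain D where D: "\<And>t. \<bar>u t - w t\<bar> \<le> D * exp (z' * t)"
      using sol_diff_improve[OF u w C l2(1) l(1) _ fz' _ neg lim] l z' l0(3) by force
    have "((\<lambda>t. D * exp ((z' - z) * t)) \<longlongrightarrow> 0) at_bot" using z' by real_asymp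
    moreover have "\<forall>\<^sub>F t in at_bot. norm ((u t - w t) * exp (- z * t)) \<le> D * exp ((z' - z) * t)"
    proof (intro always_eventually allI)
      fix t
      have "\<bar>u t - w t\<bar> * exp (- z * t) \<le> D * exp (z' * t) * exp (- z * t)" by (intro mult_right_mono D) simp
      then show "norm ((u t - w t) * exp (- z * t)) \<le> D * exp ((z' - z) * t)"
        unfolding real_norm_def abs_mult by (simp add: mult.assoc mult_exp_exp left_diff_distrib)
    qed
    ultimately show "((\<lambda>t. (u t - w t) * exp (- z * t)) \<longlongrightarrow> 0) at_bot" by (rule Lim_null_comparison[rotated])
  qed
  have asym_pos: "\<exists>A>0. ((\<lambda>t. u t * exp (- l * t)) \<longlongrightarrow> A) at_bot" if w: "wavefront u" for u
  proof -
    obtain A where A: "0 \<le> A" "((\<lambda>t. u t * exp (- l * t)) \<longlongrightarrow> A) at_bot" using asym[OF w] by blast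
    obtain C where C: "0 < C" "\<And>t. u t \<le> C * exp (l / 2 * t)" using dec[OF w] by blast
    obtain u' u'' where su: "sol u u' u''" and pos: "\<And>t. 0 < u t" using w unfolding wavefront_def by blast
    \<comment> \<open>With leading coefficient 0 the profile would be o(exp (l t)) away from the
      zero solution and therefore equal to it.\<close>
    have "A \<noteq> 0"
    proof
      assume "A = 0"
      then have "((\<lambda>t. (u t - 0) * exp (- l * t)) \<longlongrightarrow> 0) at_bot" using A(2) by simp
      from equal[OF su sol_zero C _ this, of 0] C(1) pos[of 0] show False by simp
    qed
    with A show ?thesis by (intro exI[of _ A]) auto
  qed
  obtain A1 where A1: "0 < A1" "((\<lambda>t. \<phi> t * exp (- l * t)) \<longlongrightarrow> A1) at_bot" using asym_pos[OF \<phi>] by blast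
  obtain A2 where A2: "0 < A2" "((\<lambda>t. \<psi> t * exp (- l * t)) \<longlongrightarrow> A2) at_bot" using asym_pos[OF \<psi>] by blast
  \<comment> \<open>Translation by \<open>\<tau>\<close> multiplies the leading coefficient of
    \<open>\<psi>\<close> by exp (l \<tau>).\<close>
  define \<tau> where "\<tau> = ln (A1 / A2) / l"
  have \<tau>: "exp (l * \<tau>) * A2 = A1" using A1 A2 l by (simp add: \<tau>_def)
  obtain C1 where C1: "0 < C1" "\<And>t. \<phi> t \<le> C1 * exp (l / 2 * t)" using dec[OF \<phi>] by blast
  obtain C2 where C2: "0 < C2" "\<And>t. \<psi> t \<le> C2 * exp (l / 2 * t)" using dec[OF \<psi>] by blast
  obtain \<phi>' \<phi>'' where s\<phi>: "sol \<phi> \<phi>' \<phi>''" using \<phi> unfolding wavefront_def by blast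
  obtain \<psi>' \<psi>'' where s\<psi>: "sol \<psi> \<psi>' \<psi>''" using \<psi> unfolding wavefront_def by blast
  define C where "C = max C1 (C2 * exp (l / 2 * \<tau>))"
  have "\<phi> t = \<psi> (t + \<tau>)" for t
  proof (rule equal[OF s\<phi> sol_shift[OF s\<psi>, of \<tau>]])
    show "0 < C" using C1 by (simp add: C_def)
    show "\<phi> t \<le> C * exp (l / 2 * t)" for t
      by (rule order_trans[OF C1(2) mult_right_mono]) (auto simp: C_def)
    have "\<psi> (t + \<tau>) \<le> C2 * exp (l / 2 * \<tau>) * exp (l / 2 * t)" for t
      using C2(2)[of "t + \<tau>"] by (simp add: mult.assoc mult_exp_exp distrib_left add.commute)
    then show "\<psi> (t + \<tau>) \<le> C * exp (l / 2 * t)" for t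
      by (rule order_trans[OF _ mult_right_mono]) (auto simp: C_def)
    have "((\<lambda>t. \<psi> (t + \<tau>) * exp (- l * (t + \<tau>))) \<longlongrightarrow> A2) at_bot"
      by (rule filterlim_compose[OF A2(2) filterlim_shift_at_bot])
    from tendsto_mult_left[OF this, of "exp (l * \<tau>)"]
    have "((\<lambda>t. \<psi> (t + \<tau>) * exp (- l * t)) \<longlongrightarrow> A1) at_bot"
      by (simp only: exp_shift \<tau>)
    from tendsto_diff[OF A1(2) this] show "((\<lambda>t. (\<phi> t - \<psi> (t + \<tau>)) * exp (- l * t)) \<longlongrightarrow> 0) at_bot"
      by (simp add: left_diff_distrib)
  qed
  then show ?thesis by blast
qed

lemma wavefront_unique_critical:
  assumes l: "0 < l" "0 < k" "fin (l + k)" "chi a b l = 0" "drift l = 0" and crit: "a = m" "b = L"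
    and \<phi>: "wavefront \<phi>" and \<psi>: "wavefront \<psi>"
  shows "\<exists>\<tau>. \<forall>t. \<phi> t = \<psi> (t + \<tau>)"
proof -
  have dl: "drift l \<le> 0" using l by simp
  have asym_pos: "\<exists>A>0. ((\<lambda>t. u t * exp (- l * t) / (- t)) \<longlongrightarrow> A) at_bot" if w: "wavefront u" for u
  proof -
    obtain u' u'' where su: "sol u u' u''" and pos: "\<And>t. 0 < u t" and lu: "(u \<longlongrightarrow> 0) at_bot"
      using w unfolding wavefront_def by blast
    obtain A where A: "0 \<le> A" "((\<lambda>t. u t * exp (- l * t) / (- t)) \<longlongrightarrow> A) at_bot"
      using sol_asymptotics(2)[OF su pos lu l(1-4) dl l(5)] by blast
    have "A \<noteq> 0"
    proof
      assume "A = 0"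
      then have "((\<lambda>t. (u t - 0) * exp (- l * t) / (- t)) \<longlongrightarrow> 0) at_bot" using A(2) by simp
      from sol_eq_of_critical[OF su sol_zero l crit this, of 0] pos[of 0] show False by simp
    qed
    with A show ?thesis by (intro exI[of _ A]) auto
  qed
  obtain A1 where A1: "0 < A1" "((\<lambda>t. \<phi> t * exp (- l * t) / (- t)) \<longlongrightarrow> A1) at_bot" using asym_pos[OF \<phi>] by blast
  obtain A2 where A2: "0 < A2" "((\<lambda>t. \<psi> t * exp (- l * t) / (- t)) \<longlongrightarrow> A2) at_bot" using asym_pos[OF \<psi>] by blast
  define \<tau> where "\<tau> = ln (A1 / A2) / l"
  have \<tau>: "exp (l * \<tau>) * A2 = A1" using A1 A2 l by (simp add: \<tau>_def)
  obtain \<phi>' \<phi>'' where s\<phi>: "sol \<phi> \<phi>' \<phi>''" using \<phi> unfolding wavefront_def by blast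
  obtain \<psi>' \<psi>'' where s\<psi>: "sol \<psi> \<psi>' \<psi>''" using \<psi> unfolding wavefront_def by blast
  have "\<phi> t = \<psi> (t + \<tau>)" for t
  proof (rule sol_eq_of_critical[OF s\<phi> sol_shift[OF s\<psi>, of \<tau>] l crit])
    have "((\<lambda>t. \<psi> (t + \<tau>) * exp (- l * (t + \<tau>)) / (- t)) \<longlongrightarrow> A2) at_bot"
      by (rule tendsto_shift_linear_at_bot[OF A2(2)])
    from tendsto_mult_left[OF this, of "exp (l * \<tau>)"]
    have "((\<lambda>t. \<psi> (t + \<tau>) * exp (- l * t) / (- t)) \<longlongrightarrow> A1) at_bot"
      by (simp only: times_divide_eq_right exp_shift \<tau>)
    from tendsto_diff[OF A1(2) this] show "((\<lambda>t. (\<phi> t - \<psi> (t + \<tau>)) * exp (- l * t) / (- t)) \<longlongrightarrow> 0) at_bot"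
      by (simp add: left_diff_distrib diff_divide_distrib)
  qed
  then show ?thesis by blast
qed

text \<open>The difference of \<open>chi m L\<close> and \<open>chi a b\<close> is (a - m) + (L - b)
  T, which is nonnegative. If \<open>chi a b z\<close> is not negative, it is therefore 0 and the
  two functions coincide. Unless z is a double zero, a nearby point with a negative value leads back
  to the noncritical case.\<close>

lemma wavefront_unique:
  assumes z: "0 < z" "0 < k" "fin (z + k)" "chi m L z \<le> 0"
    and \<phi>: "wavefront \<phi>" and \<psi>: "wavefront \<psi>"
  shows "\<exists>\<tau>. \<forall>t. \<phi> t = \<psi> (t + \<tau>)"
proof (cases "chi a b z < 0")
  case True
  then show ?thesis using wavefront_unique_noncritical[OF z _ \<phi> \<psi>] by blast
next
  case False
  have fz: "fin z" using z by (intro fin_mono[OF z(3)]) auto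
  have split: "chi m L z = chi a b z + (a - m) + (L - b) * T z" by (simp add: chi_def algebra_simps)
  have "0 \<le> (L - b) * T z" using Lb T_nonneg by simp
  with split False z(4) ma have *: "chi a b z = 0" "a = m" "(L - b) * T z = 0" by linarith+
  with T_pos[OF fz] have crit: "a = m" "b = L" by auto
  note der = chi_derivative[OF z(1-3)]
  have near: ?thesis if y: "0 < y" "y < z + k" "chi a b y < 0" for y
  proof (rule wavefront_unique_noncritical[OF y(1) _ _ _ y(3) \<phi> \<psi>])
    show "0 < z + k - y" using y by simp
    show "fin (y + (z + k - y))" using z by simp
    show "chi m L y \<le> 0" using y(3) crit by simp
  qed
  consider "drift z < 0" | "0 < drift z" | "drift z = 0" by linarith
  then show ?thesis
  proof cases
    case 1
    obtain d where d: "0 < d" "\<And>h. 0 < h \<Longrightarrow> h < d \<Longrightarrow> chi a b (z + h) < chi a b z"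
      using DERIV_neg_dec_right[OF der 1] by blast
    have "0 < min d k / 2" "min d k / 2 < d" "min d k / 2 < k" using d(1) z(2) by auto
    with d(2)[of "min d k / 2"] show ?thesis using z * by (intro near[of "z + min d k / 2"]) linarith+
  next
    case 2
    obtain d where d: "0 < d" "\<And>h. 0 < h \<Longrightarrow> h < d \<Longrightarrow> chi a b (z - h) < chi a b z"
      using DERIV_pos_inc_left[OF der 2] by blast
    have "0 < min d z / 2" "min d z / 2 < d" "min d z / 2 < z" using d(1) z(1) by auto
    with d(2)[of "min d z / 2"] show ?thesis using z * by (intro near[of "z - min d z / 2"]) linarith+
  next
    case 3
    show ?thesis by (rule wavefront_unique_critical[OF z(1-3) *(1) 3 crit \<phi> \<psi>])
  qed
qed

end

section \<open>The law of \<open>c s + w\<close> under the kernel\<close>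

text \<open>The indicator discards the values of \<open>K\<close> at negative s, which are
  unconstrained.\<close>

definition kernel_density :: "(real \<Rightarrow> real \<Rightarrow> real) \<Rightarrow> real \<times> real \<Rightarrow> real" where
  "kernel_density K x = indicator {0..} (fst x) * K (fst x) (snd x)"

definition kernel_measure :: "(real \<Rightarrow> real \<Rightarrow> real) \<Rightarrow> (real \<times> real) measure" where
  "kernel_measure K = density lborel (\<lambda>x. ennreal (kernel_density K x))"

definition kernel_law :: "(real \<Rightarrow> real \<Rightarrow> real) \<Rightarrow> real \<Rightarrow> real measure" where
  "kernel_law K c = distr (kernel_measure K) borel (\<lambda>x. c * fst x + snd x)"

lemma borel_measurable_fst_snd [measurable]:
  "(fst :: real \<times> real \<Rightarrow> real) \<in> borel_measurable borel" "(snd :: real \<times> real \<Rightarrow> real) \<in> borel_measurable borel"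
  by (intro borel_measurable_continuous_onI continuous_on_fst continuous_on_snd continuous_on_id)+

lemma sets_kernel [simp, measurable_cong]:
  "sets (kernel_measure K) = sets borel" "sets (kernel_law K c) = sets borel"
  by (simp_all add: kernel_measure_def kernel_law_def)

lemma space_kernel [simp]: "space (kernel_measure K) = UNIV" "space (kernel_law K c) = UNIV"
  by (simp_all add: kernel_measure_def kernel_law_def)

context
  fixes K :: "real \<Rightarrow> real \<Rightarrow> real"
  assumes K: "normalized_kernel K"
begin

lemma kernel_density_integrable: "integrable lborel (kernel_density K)"
proof -
  have "integrable lborel (\<lambda>x. indicator ({0..} \<times> UNIV) x *\<^sub>R (case x of (s, w) \<Rightarrow> K s w))"
    using K unfolding normalized_kernel_def set_integrable_def by blast
  also have "(\<lambda>x. indicator ({0..} \<times> UNIV) x *\<^sub>R (case x of (s, w) \<Rightarrow> K s w)) = kernel_density K"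
    by (auto simp: fun_eq_iff kernel_density_def indicator_def)
  finally show ?thesis .
qed

lemma kernel_density_measurable [measurable]: "kernel_density K \<in> borel_measurable borel"
  using borel_measurable_integrable[OF kernel_density_integrable] by simp

lemma kernel_density_nonneg: "AE x in lborel. 0 \<le> kernel_density K x"
proof -
  have "AE (s, w) in lborel. 0 \<le> s \<longrightarrow> 0 \<le> K s w" using K unfolding normalized_kernel_def by blast
  then show ?thesis by eventually_elim (auto simp: kernel_density_def indicator_def)
qed

lemma integral_kernel_measure:
  fixes y :: "real \<times> real \<Rightarrow> real"
  assumes y [measurable]: "y \<in> borel_measurable borel" and bd: "\<And>x. \<bar>y x\<bar> \<le> B"
  shows "(LBINT s:{0..}. (LBINT w. K s w * y (s, w))) = (\<integral>x. y x \<partial>kernel_measure K)"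
proof -
  have "(\<integral>x. y x \<partial>kernel_measure K) = (\<integral>x. kernel_density K x * y x \<partial>lborel)"
    unfolding kernel_measure_def by (subst integral_density) (use kernel_density_nonneg in auto)
  also have "\<dots> = (\<integral>x. kernel_density K x * y x \<partial>(lborel \<Otimes>\<^sub>M lborel))" by (simp add: lborel_prod)
  also have "\<dots> = (\<integral>s. (\<integral>w. kernel_density K (s, w) * y (s, w) \<partial>lborel) \<partial>lborel)"
  proof (rule lborel_pair.integral_fst'[symmetric])
    have "integrable lborel (\<lambda>x. kernel_density K x * y x)"
    proof (rule Bochner_Integration.integrable_bound[where f = "\<lambda>x. B * kernel_density K x"])
      show "integrable lborel (\<lambda>x. B * kernel_density K x)" using kernel_density_integrable by simp
      have "0 \<le> B" using bd[of undefined] by linarith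
      then show "AE x in lborel. norm (kernel_density K x * y x) \<le> norm (B * kernel_density K x)"
        by (intro AE_I2) (simp add: abs_mult mult.commute[of "\<bar>kernel_density K _\<bar>"] mult_right_mono[OF bd])
    qed measurable
    then show "integrable (lborel \<Otimes>\<^sub>M lborel) (\<lambda>x. kernel_density K x * y x)" by (simp add: lborel_prod)
  qed
  also have "\<dots> = (LBINT s:{0..}. (LBINT w. K s w * y (s, w)))"
    unfolding set_lebesgue_integral_def
    by (intro Bochner_Integration.integral_cong refl) (simp add: kernel_density_def mult.assoc)
  finally show ?thesis by simp
qed

lemma nn_integral_kernel_measure:
  assumes y [measurable]: "y \<in> borel_measurable borel" and nn: "\<And>x. 0 \<le> y x"
  shows "(\<integral>\<^sup>+s\<in>{0..}. (\<integral>\<^sup>+w. ennreal (K s w * y (s, w)) \<partial>lborel) \<partial>lborel) = (\<integral>\<^sup>+x. ennreal (y x) \<partial>kernel_measure K)"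
proof -
  have "(\<integral>\<^sup>+x. ennreal (y x) \<partial>kernel_measure K) = (\<integral>\<^sup>+x. ennreal (kernel_density K x) * ennreal (y x) \<partial>lborel)"
    unfolding kernel_measure_def by (subst nn_integral_density) auto
  also have "\<dots> = (\<integral>\<^sup>+x. ennreal (kernel_density K x) * ennreal (y x) \<partial>(lborel \<Otimes>\<^sub>M lborel))" by (simp add: lborel_prod)
  also have "\<dots> = (\<integral>\<^sup>+s. (\<integral>\<^sup>+w. ennreal (kernel_density K (s, w)) * ennreal (y (s, w)) \<partial>lborel) \<partial>lborel)"
    by (rule lborel.nn_integral_fst[symmetric]) (simp add: lborel_prod)
  also have "\<dots> = (\<integral>\<^sup>+s\<in>{0..}. (\<integral>\<^sup>+w. ennreal (K s w * y (s, w)) \<partial>lborel) \<partial>lborel)"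
  proof (rule nn_integral_cong)
    fix s :: real
    show "(\<integral>\<^sup>+w. ennreal (kernel_density K (s, w)) * ennreal (y (s, w)) \<partial>lborel)
        = (\<integral>\<^sup>+w. ennreal (K s w * y (s, w)) \<partial>lborel) * indicator {0..} s"
      by (cases "0 \<le> s") (auto simp: kernel_density_def ennreal_mult'' nn intro!: nn_integral_cong)
  qed
  finally show ?thesis by simp
qed

lemma K_transform_kernel_measure:
  "K_transform K z c = (\<integral>\<^sup>+x. ennreal (exp (- z * (c * fst x + snd x))) \<partial>kernel_measure K)"
  unfolding K_transform_def
  using nn_integral_kernel_measure[of "\<lambda>x. exp (- z * (c * fst x + snd x))"] by simp

lemma K_transform_kernel_law: "K_transform K z c = (\<integral>\<^sup>+v. ennreal (exp (- z * v)) \<partial>kernel_law K c)"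
  unfolding K_transform_kernel_measure kernel_law_def by (subst nn_integral_distr) auto

lemma emeasure_kernel_measure: "emeasure (kernel_measure K) UNIV = 1"
proof -
  have "(LBINT s:{0..}. (LBINT w. K s w)) = 1" using K unfolding normalized_kernel_def by blast
  then have "(\<integral>x. 1 \<partial>kernel_measure K) = (1 :: real)"
    using integral_kernel_measure[of "\<lambda>_. 1" 1] by simp
  then have "measure (kernel_measure K) UNIV = 1" by simp
  \<comment> \<open>\<open>measure\<close> is 0 on sets of infinite measure, so the value 1 shows
    that the total mass is finite.\<close>
  then show ?thesis by (metis emeasure_eq_ennreal_measure ennreal_1 measure_def enn2real_top zero_neq_one)
qed

lemma finite_measure_kernel: "finite_measure (kernel_measure K)" "finite_measure (kernel_law K c)"
proof -
  show 1: "finite_measure (kernel_measure K)" by (rule finite_measureI) (simp add: emeasure_kernel_measure)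
  show "finite_measure (kernel_law K c)"
    unfolding kernel_law_def by (rule finite_measure.finite_measure_distr[OF 1]) simp
qed

lemma measure_kernel_law: "measure (kernel_law K c) UNIV = 1"
proof -
  have "emeasure (kernel_law K c) UNIV = 1"
    unfolding kernel_law_def by (subst emeasure_distr) (simp_all add: emeasure_kernel_measure)
  then show ?thesis by (simp add: measure_def)
qed

text \<open>For each s only one w satisfies c s + w = 0. The absence of an atom at 0 yields the
  final contradiction in \<open>sol_eq_of_little_o\<close>.\<close>

lemma measure_kernel_law_0: "measure (kernel_law K c) {0} = 0"
proof -
  have "emeasure (kernel_law K c) {0} = emeasure (kernel_measure K) {x. c * fst x + snd x = 0}"
    unfolding kernel_law_def by (subst emeasure_distr) (simp_all add: vimage_def)
  also have "\<dots> = (\<integral>\<^sup>+x. ennreal (indicator {x. c * fst x + snd x = 0} x) \<partial>kernel_measure K)"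
    by (subst nn_integral_indicator[symmetric]) (simp_all add: ennreal_indicator)
  also have "\<dots> = (\<integral>\<^sup>+s\<in>{0..}. (\<integral>\<^sup>+w. ennreal (K s w * indicator {x. c * fst x + snd x = 0} (s, w)) \<partial>lborel) \<partial>lborel)"
    by (rule nn_integral_kernel_measure[symmetric]) auto
  also have "\<dots> = (\<integral>\<^sup>+(s::real). 0 \<partial>lborel)"
  proof (rule nn_integral_cong)
    fix s :: real
    have "AE w in lborel. ennreal (K s w * indicator {x. c * fst x + snd x = 0} (s, w)) = 0"
      using AE_lborel_singleton[of "- c * s"] by eventually_elim (auto simp: indicator_def)
    then have "(\<integral>\<^sup>+w. ennreal (K s w * indicator {x. c * fst x + snd x = 0} (s, w)) \<partial>lborel) = (\<integral>\<^sup>+(w::real). 0 \<partial>lborel)"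
      by (rule nn_integral_cong_AE)
    then show "(\<integral>\<^sup>+w. ennreal (K s w * indicator {x. c * fst x + snd x = 0} (s, w)) \<partial>lborel) * indicator {0..} s
        = 0" by simp
  qed
  finally show ?thesis by (simp add: measure_def)
qed

lemma integral_kernel_law:
  assumes y: "y \<in> borel_measurable borel" and bd: "\<And>v. \<bar>y v\<bar> \<le> (B :: real)"
  shows "(LBINT s:{0..}. (LBINT w. K s w * y (c * s + w))) = (\<integral>v. y v \<partial>kernel_law K c)"
proof -
  have "(LBINT s:{0..}. (LBINT w. K s w * y (c * s + w))) = (\<integral>x. y (c * fst x + snd x) \<partial>kernel_measure K)"
    using integral_kernel_measure[of "\<lambda>x. y (c * fst x + snd x)" B] y bd by simp
  also have "\<dots> = (\<integral>v. y v \<partial>kernel_law K c)"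
    unfolding kernel_law_def using y by (subst integral_distr) auto
  finally show ?thesis .
qed

lemma K_transform_finite_iff: "K_transform K z c < \<infinity> \<longleftrightarrow> integrable (kernel_law K c) (\<lambda>v. exp (- z * v))"
  unfolding K_transform_kernel_law integrable_iff_bounded by simp

lemma K_transform_eq: "integrable (kernel_law K c) (\<lambda>v. exp (- z * v)) \<Longrightarrow>
    K_transform K z c = ennreal (\<integral>v. exp (- z * v) \<partial>kernel_law K c)"
  unfolding K_transform_kernel_law by (rule nn_integral_eq_integral) auto

text \<open>The kernel lives on s \<ge> 0, so c s + w grows with c. Hence a higher speed lowers
  \<open>chi_L\<close> at a fixed positive exponent.\<close>

lemma K_transform_mono_speed:
  assumes "0 \<le> z" "c \<le> c'" shows "K_transform K z c' \<le> K_transform K z c"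
proof -
  have "AE x in lborel. 0 < ennreal (kernel_density K x) \<longrightarrow> 0 \<le> fst x"
    by (rule AE_I2) (auto simp: kernel_density_def indicator_def)
  then have "AE x in kernel_measure K. 0 \<le> fst x"
    unfolding kernel_measure_def by (subst AE_density) auto
  then show ?thesis
    unfolding K_transform_kernel_measure
  proof (intro nn_integral_mono_AE, eventually_elim)
    case (elim x)
    then have "z * (c * fst x + snd x) \<le> z * (c' * fst x + snd x)"
      using assms by (intro mult_left_mono add_right_mono mult_right_mono) auto
    then show ?case by (intro ennreal_leI) simp
  qed
qed

text \<open>Joint lower semicontinuity in exponent and speed, which holds also at the edge of
  convergence; it is used to pass to limits of roots.\<close>

lemma K_transform_fatou:
  assumes "zs \<longlonglongrightarrow> z" "cs \<longlonglongrightarrow> c"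
  shows "K_transform K z c \<le> liminf (\<lambda>n. K_transform K (zs n) (cs n))"
proof -
  have "K_transform K z c = (\<integral>\<^sup>+x. liminf (\<lambda>n. ennreal (exp (- zs n * (cs n * fst x + snd x)))) \<partial>kernel_measure K)"
    unfolding K_transform_kernel_measure
  proof (rule nn_integral_cong)
    fix x :: "real \<times> real"
    have "(\<lambda>n. ennreal (exp (- zs n * (cs n * fst x + snd x)))) \<longlonglongrightarrow> ennreal (exp (- z * (c * fst x + snd x)))"
      by (intro tendsto_ennrealI tendsto_intros assms)
    from lim_imp_Liminf[OF _ this]
    show "ennreal (exp (- z * (c * fst x + snd x))) = liminf (\<lambda>n. ennreal (exp (- zs n * (cs n * fst x + snd x))))"
      by simp
  qed
  also have "\<dots> \<le> liminf (\<lambda>n. K_transform K (zs n) (cs n))"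
    unfolding K_transform_kernel_measure by (rule nn_integral_liminf) simp
  finally show ?thesis .
qed

lemma K_transform_0: "K_transform K 0 c = 1"
  by (simp add: K_transform_kernel_measure emeasure_kernel_measure)

end

section \<open>Consequences of the regularity hypotheses\<close>

lemma hderiv_within:
  assumes "h differentiable (at s within {0..})"
  shows "(h has_real_derivative hderiv h s) (at s within {0..})"
  using assms unfolding hderiv_def
  by (simp add: has_real_derivative_iff_has_vector_derivative vector_derivative_works)

lemma mean_value_halfline:
  fixes h :: "real \<Rightarrow> real"
  assumes der: "\<And>x. x \<in> S \<Longrightarrow> (h has_real_derivative h' x) (at x within S)" and sub: "{t..s} \<subseteq> S" and "t < s"
  obtains x where "t < x" "x < s" "h s - h t = h' x * (s - t)"
proof -
  have "(h has_derivative (*) (h' x)) (at x within {t..s})" if "t \<le> x" "x \<le> s" for x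
    using DERIV_subset[OF der sub, of x] that sub by (auto simp: has_field_derivative_def)
  from mvt_simple[OF \<open>t < s\<close> this] that show ?thesis by auto
qed

text \<open>Near 0 the mean value theorem and the Hoelder bound give the estimate. If the larger of
  s and t is at least \<open>\<delta>\<close>, its power \<open>\<alpha>\<close> is bounded below
  and the Lipschitz constant suffices, so the local condition extends to [0, B].\<close>

lemma hoelder_linearization:
  assumes hol: "C1_holder_on \<alpha> {0..<\<delta>} h" and \<alpha>: "0 < \<alpha>" and \<delta>: "0 < \<delta>"
    and d: "(h has_real_derivative d) (at 0 within {0..})"
    and lip: "\<And>s t. s \<in> {0..B} \<Longrightarrow> t \<in> {0..B} \<Longrightarrow> \<bar>h s - h t\<bar> \<le> \<Lambda> * \<bar>s - t\<bar>"
  shows "\<exists>C. \<forall>s\<in>{0..B}. \<forall>t\<in>{0..B}. \<bar>h s - h t - d * (s - t)\<bar> \<le> C * max s t powr \<alpha> * \<bar>s - t\<bar>"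
proof -
  obtain h' C where h': "\<And>x. x \<in> {0..<\<delta>} \<Longrightarrow> (h has_real_derivative h' x) (at x within {0..<\<delta>})"
    and C: "\<And>x y. x \<in> {0..<\<delta>} \<Longrightarrow> y \<in> {0..<\<delta>} \<Longrightarrow> \<bar>h' x - h' y\<bar> \<le> C * \<bar>x - y\<bar> powr \<alpha>"
    using hol unfolding C1_holder_on_def by blast
  have h0: "h' 0 = d"
  proof -
    have sub: "{0..<\<delta>} \<subseteq> {0..}" by auto
    have "(h has_vector_derivative h' 0) (at 0 within {0..<\<delta>})" "(h has_vector_derivative d) (at 0 within {0..<\<delta>})"
      using h'[of 0] DERIV_subset[OF d sub] \<delta> by (auto simp: has_real_derivative_iff_has_vector_derivative)
    moreover have "at 0 within {0..<\<delta>} \<noteq> bot" using \<delta> by (simp add: trivial_limit_within islimpt_Ico)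
    ultimately show ?thesis by (rule vector_derivative_unique_within[rotated])
  qed
  define D where "D = \<bar>C\<bar> + (\<bar>\<Lambda>\<bar> + \<bar>d\<bar>) / \<delta> powr \<alpha>"
  have ord: "\<bar>h s - h t - d * (s - t)\<bar> \<le> D * s powr \<alpha> * (s - t)" if st: "t < s" "0 \<le> t" "s \<le> B" for s t
  proof (cases "s < \<delta>")
    case True
    then have "{t..s} \<subseteq> {0..<\<delta>}" using st by auto
    from mean_value_halfline[OF h' this st(1)] obtain x where x: "t < x" "x < s" "h s - h t = h' x * (s - t)" .
    have "\<bar>h' x - d\<bar> \<le> C * \<bar>x - 0\<bar> powr \<alpha>" using C[of x 0] x st True \<delta> by (simp add: h0)
    also have "\<dots> \<le> \<bar>C\<bar> * s powr \<alpha>" using x st \<alpha> by (intro mult_mono powr_mono2) auto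
    also have "\<dots> \<le> D * s powr \<alpha>" by (intro mult_right_mono) (simp_all add: D_def)
    finally have "\<bar>h' x - d\<bar> * (s - t) \<le> D * s powr \<alpha> * (s - t)" using st by (intro mult_right_mono) auto
    moreover have "h s - h t - d * (s - t) = (h' x - d) * (s - t)" using x(3) by (simp add: left_diff_distrib)
    ultimately show ?thesis using st by (simp add: abs_mult)
  next
    case False
    have "\<bar>h s - h t - d * (s - t)\<bar> \<le> \<bar>h s - h t\<bar> + \<bar>d * (s - t)\<bar>" by (rule abs_triangle_ineq4)
    also have "\<dots> \<le> \<bar>\<Lambda>\<bar> * (s - t) + \<bar>d\<bar> * (s - t)"
    proof (rule add_mono)
      have "\<bar>h s - h t\<bar> \<le> \<Lambda> * \<bar>s - t\<bar>" using st by (intro lip) auto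
      also have "\<dots> \<le> \<bar>\<Lambda>\<bar> * (s - t)" using st by (simp add: mult_right_mono)
      finally show "\<bar>h s - h t\<bar> \<le> \<bar>\<Lambda>\<bar> * (s - t)" .
    qed (use st in \<open>simp add: abs_mult\<close>)
    also have "\<dots> = (\<bar>\<Lambda>\<bar> + \<bar>d\<bar>) / \<delta> powr \<alpha> * \<delta> powr \<alpha> * (s - t)"
    proof -
      have "(\<bar>\<Lambda>\<bar> + \<bar>d\<bar>) / \<delta> powr \<alpha> * \<delta> powr \<alpha> = \<bar>\<Lambda>\<bar> + \<bar>d\<bar>" using \<delta> by simp
      then show ?thesis by (simp only: distrib_right)
    qed
    also have "\<dots> \<le> D * s powr \<alpha> * (s - t)"
      using st False \<delta> \<alpha> by (intro mult_right_mono mult_mono powr_mono2) (auto simp: D_def)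
    finally show ?thesis .
  qed
  have "\<bar>h s - h t - d * (s - t)\<bar> \<le> D * max s t powr \<alpha> * \<bar>s - t\<bar>" if "s \<in> {0..B}" "t \<in> {0..B}" for s t
  proof -
    consider "t < s" | "s < t" | "s = t" by linarith
    then show ?thesis
    proof cases
      case 1
      with ord[of t s] that show ?thesis by (simp add: max_def)
    next
      case 2
      have "\<bar>h s - h t - d * (s - t)\<bar> = \<bar>h t - h s - d * (t - s)\<bar>" by (simp add: algebra_simps abs_minus_commute)
      with 2 ord[of s t] that show ?thesis by (simp add: max_def)
    qed simp
  qed
  then show ?thesis by blast
qed

lemma H2_lipschitz:
  assumes "H2 f g"
  obtains \<Lambda> where "\<And>s t. s \<in> {0..B} \<Longrightarrow> t \<in> {0..B} \<Longrightarrow> \<bar>f s - f t\<bar> \<le> \<Lambda> * \<bar>s - t\<bar>"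
proof -
  have der: "(f has_real_derivative hderiv f x) (at x within {0..})" if "x \<in> {0..}" for x
    using assms that by (intro hderiv_within) (auto simp: H2_def differentiable_on_def)
  have "continuous_on {0..B} (hderiv f)" using assms by (auto simp: H2_def intro: continuous_on_subset)
  then have "bounded (hderiv f ` {0..B})" by (intro compact_imp_bounded compact_continuous_image) auto
  then obtain \<Lambda> where "\<forall>x\<in>{0..B}. \<bar>hderiv f x\<bar> \<le> \<Lambda>" by (auto simp: bounded_iff)
  then have \<Lambda>: "\<bar>hderiv f x\<bar> \<le> \<Lambda>" if "x \<in> {0..B}" for x using that by blast
  have ord: "\<bar>f s - f t\<bar> \<le> \<Lambda> * \<bar>s - t\<bar>" if "t < s" "0 \<le> t" "s \<le> B" for s t
  proof -
    from mean_value_halfline[OF der, where t = t and s = s] that obtain x where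
      "t < x" "x < s" "f s - f t = hderiv f x * (s - t)" by auto
    then show ?thesis using that \<Lambda>[of x] by (simp add: abs_mult mult_right_mono)
  qed
  show ?thesis
  proof
    fix s t assume "s \<in> {0..B}" "t \<in> {0..B}"
    then show "\<bar>f s - f t\<bar> \<le> \<Lambda> * \<bar>s - t\<bar>"
      using ord[of t s] ord[of s t] by (cases "t < s"; cases "s < t") (auto simp: abs_minus_commute)
  qed
qed

text \<open>Makes the \<open>INF\<close> in \<open>chi_L\<close> a genuine infimum, over a set
  bounded below by 0.\<close>

lemma H2_hderiv_nonneg:
  assumes "H2 f g" "0 \<le> s" shows "0 \<le> hderiv f s"
proof (rule ccontr)
  assume "\<not> 0 \<le> hderiv f s"
  moreover have "(f has_real_derivative hderiv f s) (at s within {0..})"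
    using assms by (intro hderiv_within) (auto simp: H2_def differentiable_on_def)
  ultimately obtain d where d: "0 < d" "\<And>h. 0 < h \<Longrightarrow> s + h \<in> {0..} \<Longrightarrow> h < d \<Longrightarrow> f (s + h) < f s"
    using has_real_derivative_neg_dec_right[of f "hderiv f s" s "{0..}"] by auto
  have "f (s + d / 2) < f s" using d assms(2) by (intro d(2)) auto
  moreover have "f s < f (s + d / 2)"
    using assms d(1) by (auto simp: H2_def strict_mono_on_def)
  ultimately show False by simp
qed

lemma H2_lower_slope:
  assumes "H2 f g" "0 \<le> t" "t \<le> s"
  shows "(INF x\<in>{0..}. hderiv f x) * (s - t) \<le> f s - f t"
proof (cases "t = s")
  case False
  have der: "(f has_real_derivative hderiv f x) (at x within {0..})" if "x \<in> {0..}" for x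
    using assms(1) that by (intro hderiv_within) (auto simp: H2_def differentiable_on_def)
  from mean_value_halfline[OF der, where t = t and s = s] assms False obtain x where
    x: "t < x" "x < s" "f s - f t = hderiv f x * (s - t)" by auto
  have "(INF x\<in>{0..}. hderiv f x) \<le> hderiv f x"
    using x assms(2) H2_hderiv_nonneg[OF assms(1)] by (intro cINF_lower bdd_belowI2[where m = 0]) auto
  with x assms show ?thesis by (simp add: mult_right_mono)
qed simp

text \<open>Derives from the Lipschitz condition the inequality between \<open>L\<close> and the
  slope of \<open>g\<close> at 0 under which \<open>chi_L\<close> is considered.\<close>

lemma H1_slope_le_lipschitz:
  assumes "H1 g" and lip: "\<And>s\<^sub>1 s\<^sub>2. 0 \<le> s\<^sub>1 \<Longrightarrow> 0 \<le> s\<^sub>2 \<Longrightarrow> \<bar>g s\<^sub>1 - g s\<^sub>2\<bar> \<le> L * \<bar>s\<^sub>1 - s\<^sub>2\<bar>"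
  shows "hderiv g 0 \<le> L"
proof (rule ccontr)
  assume "\<not> hderiv g 0 \<le> L"
  then have pos: "0 < hderiv g 0 - L" by simp
  have "(g has_real_derivative hderiv g 0) (at 0 within {0..})"
    using assms by (intro hderiv_within) (auto simp: H1_def)
  then have "((\<lambda>s. g s - L * s) has_real_derivative hderiv g 0 - L) (at 0 within {0..})"
    by (auto intro!: derivative_eq_intros)
  from has_real_derivative_pos_inc_right[OF this pos] obtain d where
    d: "0 < d" "\<And>h. 0 < h \<Longrightarrow> h < d \<Longrightarrow> g 0 < g h - L * h" by auto
  have "g 0 < g (d / 2) - L * (d / 2)" using d by (intro d(2)) auto
  moreover have "\<bar>g (d / 2) - g 0\<bar> \<le> L * (d / 2)" using lip[of "d / 2" 0] d(1) by simp
  ultimately show False by linarith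
qed

section \<open>The minimal speed\<close>

context
  fixes K :: "real \<Rightarrow> real \<Rightarrow> real" and f :: "real \<Rightarrow> real" and L :: real
  assumes K: "normalized_kernel K" and m0: "0 \<le> (INF s\<in>{0..}. hderiv f s)"
    and mL: "(INF s\<in>{0..}. hderiv f s) < L"
begin

abbreviation slope_inf :: real where "slope_inf \<equiv> (INF s\<in>{0..}. hderiv f s)"

lemma chi_L_finite: "chi_L K f L z c \<noteq> \<infinity> \<Longrightarrow> K_transform K z c < \<infinity>"
  using m0 mL by (cases "K_transform K z c") (auto simp: chi_L_def top.not_eq_extremum)

lemma chi_L_eq:
  assumes "K_transform K z c < \<infinity>"
  shows "chi_L K f L z c = ereal (z\<^sup>2 - c * z - slope_inf + L * enn2real (K_transform K z c))"
proof -
  have "enn2ereal (K_transform K z c) = ereal (enn2real (K_transform K z c))"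
    using assms by (cases "K_transform K z c") auto
  then show ?thesis by (simp add: chi_L_def)
qed

lemma chi_L_continuous:
  assumes "K_transform K z c < \<infinity>" "0 \<le> z"
  shows "continuous_on {0..z} (\<lambda>x. x\<^sup>2 - c * x - slope_inf + L * enn2real (K_transform K x c))"
    and "x \<in> {0..z} \<Longrightarrow> K_transform K x c < \<infinity>"
proof -
  interpret finite_measure "kernel_law K c" by (rule finite_measure_kernel[OF K])
  let ?\<nu> = "kernel_law K c"
  have meas: "(\<lambda>v. exp (- x * v)) \<in> borel_measurable ?\<nu>" for x
    by (simp add: measurable_cong_sets[OF sets_kernel(2) refl])
  have iz: "integrable ?\<nu> (\<lambda>v. exp (- z * v))" using assms K_transform_finite_iff[OF K] by blast
  have dom: "exp (- x * v) \<le> 1 + exp (- z * v)" if "x \<in> {0..z}" for x v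
  proof (cases "0 \<le> v")
    case True
    then have "exp (- x * v) \<le> 1" using that by (simp add: mult_nonneg_nonneg)
    then show ?thesis by (simp add: add_increasing2)
  next
    case False
    then have "exp (- x * v) \<le> exp (- z * v)" using that by (auto intro: mult_right_mono_neg)
    then show ?thesis by (rule order_trans) simp
  qed
  have ix: "integrable ?\<nu> (\<lambda>v. exp (- x * v))" if "x \<in> {0..z}" for x
  proof (rule Bochner_Integration.integrable_bound[OF _ meas])
    show "integrable ?\<nu> (\<lambda>v. 1 + exp (- z * v))" using iz by simp
    show "AE v in ?\<nu>. norm (exp (- x * v)) \<le> norm (1 + exp (- z * v))"
      using dom[OF that] by (intro AE_I2) (simp add: abs_of_pos add_pos_pos)
  qed
  then show "x \<in> {0..z} \<Longrightarrow> K_transform K x c < \<infinity>" using K_transform_finite_iff[OF K] by blast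
  have eq: "enn2real (K_transform K x c) = (\<integral>v. exp (- x * v) \<partial>?\<nu>)" if "x \<in> {0..z}" for x
    using K_transform_eq[OF K ix[OF that]] by simp
  have "continuous_on {0..z} (\<lambda>x. \<integral>v. exp (- x * v) \<partial>?\<nu>)"
    unfolding continuous_on_sequentially
  proof (intro allI ballI impI, elim conjE)
    fix X x assume x: "x \<in> {0..z}" and X: "\<forall>n. X n \<in> {0..z}" "X \<longlonglongrightarrow> x"
    have "(\<lambda>n. \<integral>v. exp (- X n * v) \<partial>?\<nu>) \<longlonglongrightarrow> (\<integral>v. exp (- x * v) \<partial>?\<nu>)"
    proof (rule integral_dominated_convergence[OF meas meas])
      show "integrable ?\<nu> (\<lambda>v. 1 + exp (- z * v))" using iz by simp
      show "AE v in ?\<nu>. (\<lambda>n. exp (- X n * v)) \<longlonglongrightarrow> exp (- x * v)" by (intro AE_I2 tendsto_intros X)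
      show "AE v in ?\<nu>. norm (exp (- X n * v)) \<le> 1 + exp (- z * v)" for n
        using dom X(1) by (intro AE_I2) simp
    qed
    then show "((\<lambda>x. \<integral>v. exp (- x * v) \<partial>?\<nu>) \<circ> X) \<longlonglongrightarrow> (\<integral>v. exp (- x * v) \<partial>?\<nu>)" by (simp add: o_def)
  qed
  then have "continuous_on {0..z} (\<lambda>x. enn2real (K_transform K x c))"
    by (rule continuous_on_cong[THEN iffD1, rotated 2]) (simp_all add: eq)
  then show "continuous_on {0..z} (\<lambda>x. x\<^sup>2 - c * x - slope_inf + L * enn2real (K_transform K x c))"
    by (intro continuous_intros)
qed

text \<open>At exponent 0 the value is \<open>L - slope_inf\<close> > 0, so a nonpositive value
  yields a zero in between. This recovers a root where only an inequality survives a limit.\<close>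

lemma chi_L_root:
  assumes fin: "K_transform K z c < \<infinity>" and z: "0 \<le> z"
    and le: "z\<^sup>2 - c * z - slope_inf + L * enn2real (K_transform K z c) \<le> 0"
  shows "\<exists>z>0. chi_L K f L z c = 0"
proof -
  let ?h = "\<lambda>x. x\<^sup>2 - c * x - slope_inf + L * enn2real (K_transform K x c)"
  have h0: "0 < ?h 0" using mL by (simp add: K_transform_0[OF K])
  have "\<exists>x\<ge>0. x \<le> z \<and> ?h x = 0"
    using le h0 z by (intro IVT2' chi_L_continuous[OF fin z]) auto
  then obtain x where x: "0 \<le> x" "x \<le> z" "?h x = 0" by blast
  then have "x \<noteq> 0" using h0 by auto
  moreover have "chi_L K f L x c = 0"
    using chi_L_eq[OF chi_L_continuous(2)[OF fin z]] x by simp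
  ultimately show ?thesis using x by (intro exI[of _ x]) auto
qed

lemma chi_L_zeroD:
  assumes "chi_L K f L z c = 0"
  shows "K_transform K z c < \<infinity>" "z\<^sup>2 - c * z - slope_inf + L * enn2real (K_transform K z c) = 0"
    "K_transform K z c = ennreal ((slope_inf - z\<^sup>2 + c * z) / L)" "z\<^sup>2 - c * z \<le> slope_inf"
proof -
  show fin: "K_transform K z c < \<infinity>" using assms by (intro chi_L_finite) simp
  then show eq: "z\<^sup>2 - c * z - slope_inf + L * enn2real (K_transform K z c) = 0"
    using chi_L_eq[OF fin] assms by simp
  have "enn2real (K_transform K z c) = (slope_inf - z\<^sup>2 + c * z) / L"
    using eq m0 mL by (simp add: field_simps)
  then show "K_transform K z c = ennreal ((slope_inf - z\<^sup>2 + c * z) / L)"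
    using fin by (metis ennreal_enn2real infinity_ennreal_def)
  have "0 \<le> L * enn2real (K_transform K z c)" using m0 mL by simp
  with eq show "z\<^sup>2 - c * z \<le> slope_inf" by linarith
qed

text \<open>\<open>LEAST\<close> has its intended meaning only if the infimum of the admissible
  speeds is attained. The set is nonempty because a large speed makes \<open>chi_L\<close>
  nonpositive at \<open>z0\<close>, it is bounded below, and its infimum belongs to it because roots
  stay bounded and Fatou passes to the limit.\<close>

lemma c_star_least:
  assumes z0: "0 < z0" "K_transform K z0 0 < \<infinity>"
  shows "\<exists>z>0. chi_L K f L z (c_star K f L) = 0"
proof -
  let ?C = "{c. \<exists>z>0. chi_L K f L z c = 0}"
  have L0: "0 < L" using m0 mL by simp
  have ne: "?C \<noteq> {}"
  proof -
    define t where "t = enn2real (K_transform K z0 0)"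
    \<comment> \<open>Solves c z0 = z0^2 + L t, which cancels the positive terms of
      \<open>chi_L\<close> at \<open>z0\<close>.\<close>
    define c where "c = (z0\<^sup>2 + L * t) / z0"
    have c0: "0 \<le> c" using z0 L0 by (simp add: c_def t_def)
    have le: "K_transform K z0 c \<le> K_transform K z0 0"
      using z0 c0 by (intro K_transform_mono_speed[OF K]) auto
    with z0 have fin: "K_transform K z0 c < \<infinity>" by (simp add: order.strict_trans1)
    have "enn2real (K_transform K z0 c) \<le> t" unfolding t_def using le z0 by (intro enn2real_mono) auto
    then have "L * enn2real (K_transform K z0 c) \<le> L * t" using L0 by simp
    moreover have "c * z0 = z0\<^sup>2 + L * t" using z0 by (simp add: c_def)
    ultimately have "z0\<^sup>2 - c * z0 - slope_inf + L * enn2real (K_transform K z0 c) \<le> 0" using m0 by linarith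
    from chi_L_root[OF fin _ this] z0 show ?thesis by auto
  qed
  \<comment> \<open>For speeds tending to -infinity the roots z tend to 0, since z^2 - c z \<le>
    \<open>slope_inf\<close>. The transform at these z and speed 0 is at most
    \<open>slope_inf / L\<close> < 1, while Fatou gives at least 1 in the limit.\<close>
  have bdd: "bdd_below ?C"
  proof (rule ccontr)
    assume nb: "\<not> bdd_below ?C"
    have "\<exists>c\<in>?C. c < x" for x
    proof (rule ccontr)
      assume "\<not> (\<exists>c\<in>?C. c < x)"
      then have "x \<le> c" if "c \<in> ?C" for c using that by (meson not_le)
      then have "bdd_below ?C" by (rule bdd_belowI)
      with nb show False by contradiction
    qed
    then have "\<exists>c z. c < - real n - 1 \<and> 0 < z \<and> chi_L K f L z c = 0" for n :: nat by blast
    then obtain cs zs where cs: "\<And>n::nat. cs n < - real n - 1" and zs: "\<And>n. 0 < zs n" "\<And>n. chi_L K f L (zs n) (cs n) = 0"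
      by metis
    have zle: "zs n \<le> slope_inf * inverse (real (Suc n))" for n
    proof -
      have "(real n + 1) * zs n \<le> - cs n * zs n" using cs[of n] zs(1)[of n] by (intro mult_right_mono) auto
      also have "\<dots> \<le> slope_inf" using chi_L_zeroD(4)[OF zs(2)[of n]] zero_le_power2[of "zs n"] by linarith
      finally show ?thesis by (simp add: field_simps)
    qed
    have "zs \<longlonglongrightarrow> 0"
    proof (rule tendsto_sandwich[of "\<lambda>_. 0"])
      show "(\<lambda>n. slope_inf * inverse (real (Suc n))) \<longlonglongrightarrow> 0"
        using tendsto_mult_right_zero[OF LIMSEQ_inverse_real_of_nat] .
    qed (use zs(1) zle in \<open>auto intro!: always_eventually less_imp_le\<close>)
    from K_transform_fatou[OF K this tendsto_const[of 0]]
    have "1 \<le> liminf (\<lambda>n. K_transform K (zs n) 0)" by (simp add: K_transform_0[OF K])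
    also have "\<dots> \<le> liminf (\<lambda>n. ennreal (slope_inf / L))"
    proof (intro Liminf_mono always_eventually allI)
      fix n
      have "K_transform K (zs n) 0 \<le> K_transform K (zs n) (cs n)"
        using cs[of n] zs(1)[of n] by (intro K_transform_mono_speed[OF K]) auto
      also have "\<dots> = ennreal ((slope_inf - (zs n)\<^sup>2 + cs n * zs n) / L)" by (rule chi_L_zeroD(3)[OF zs(2)])
      also have "\<dots> \<le> ennreal (slope_inf / L)"
      proof (intro ennreal_leI divide_right_mono)
        have "cs n * zs n \<le> 0" using cs[of n] zs(1)[of n] by (intro mult_nonpos_nonneg) auto
        then show "slope_inf - (zs n)\<^sup>2 + cs n * zs n \<le> slope_inf" using zero_le_power2[of "zs n"] by linarith
      qed (use L0 in simp)
      finally show "K_transform K (zs n) 0 \<le> ennreal (slope_inf / L)" .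
    qed
    finally have "1 \<le> ennreal (slope_inf / L)" by (simp add: Liminf_const)
    moreover have "slope_inf / L < 1" using mL L0 by simp
    ultimately show False using m0 L0 by (simp add: ennreal_1[symmetric] del: ennreal_1)
  qed
  define c0 where "c0 = Inf ?C"
  have low: "c0 \<le> c" if "c \<in> ?C" for c unfolding c0_def by (rule cInf_lower[OF that bdd])
  have "c0 \<in> ?C"
  proof -
    have "\<exists>c\<in>?C. c < c0 + inverse (real (Suc n))" for n
      by (rule cInf_lessD[OF ne]) (simp add: c0_def)
    then have "\<exists>c z. c0 \<le> c \<and> c < c0 + inverse (real (Suc n)) \<and> 0 < z \<and> chi_L K f L z c = 0" for n
      using low by blast
    then obtain cs zs where cs: "\<And>n::nat. c0 \<le> cs n" "\<And>n. cs n < c0 + inverse (real (Suc n))"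
      and zs: "\<And>n. 0 < zs n" "\<And>n. chi_L K f L (zs n) (cs n) = 0" by metis
    have csl: "cs \<longlonglongrightarrow> c0"
    proof (rule tendsto_sandwich[of "\<lambda>_. c0"])
      show "(\<lambda>n. c0 + inverse (real (Suc n))) \<longlonglongrightarrow> c0"
        using tendsto_add[OF tendsto_const[of c0] LIMSEQ_inverse_real_of_nat] by simp
    qed (use cs in \<open>auto intro!: always_eventually less_imp_le\<close>)
    \<comment> \<open>A root above \<open>B\<close> would satisfy z > 1 and z - c > slope_inf + 1,
      against z^2 - c z \<le> \<open>slope_inf\<close>.\<close>
    define B where "B = \<bar>c0\<bar> + slope_inf + 2"
    have "zs n \<in> {0..B}" for n
    proof (rule ccontr)
      assume "zs n \<notin> {0..B}"
      then have z: "B < zs n" using zs(1)[of n] by auto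
      have "inverse (real (Suc n)) \<le> 1" by (simp add: field_simps)
      then have "slope_inf + 1 < zs n - cs n" using z cs(2)[of n] unfolding B_def by linarith
      moreover have "1 < zs n" using z m0 unfolding B_def by linarith
      ultimately have "1 * (slope_inf + 1) < zs n * (zs n - cs n)" using m0 by (intro mult_strict_mono) auto
      with chi_L_zeroD(4)[OF zs(2)[of n]] show False by (simp add: power2_eq_square algebra_simps)
    qed
    then have "\<forall>n. zs n \<in> {0..B}" by blast
    then obtain z r where z: "z \<in> {0..B}" and r: "strict_mono r" "(zs \<circ> r) \<longlonglongrightarrow> z"
      using seq_compactE[OF compact_imp_seq_compact[OF compact_Icc[of 0 B]], of zs] by metis
    have csr: "(cs \<circ> r) \<longlonglongrightarrow> c0" by (rule LIMSEQ_subseq_LIMSEQ[OF csl r(1)])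
    let ?q = "(slope_inf - z\<^sup>2 + c0 * z) / L"
    have "(\<lambda>n. ennreal ((slope_inf - ((zs \<circ> r) n)\<^sup>2 + (cs \<circ> r) n * (zs \<circ> r) n) / L)) \<longlonglongrightarrow> ennreal ?q"
      using L0 by (intro tendsto_ennrealI tendsto_intros r csr) auto
    then have "liminf (\<lambda>n. K_transform K ((zs \<circ> r) n) ((cs \<circ> r) n)) = ennreal ?q"
      using chi_L_zeroD(3)[OF zs(2)] by (intro lim_imp_Liminf) simp_all
    then have le: "K_transform K z c0 \<le> ennreal ?q" using K_transform_fatou[OF K r(2) csr] by simp
    have q0: "0 \<le> ?q"
    proof (rule tendsto_lowerbound)
      show "(\<lambda>n. (slope_inf - ((zs \<circ> r) n)\<^sup>2 + (cs \<circ> r) n * (zs \<circ> r) n) / L) \<longlonglongrightarrow> ?q"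
        using L0 by (intro tendsto_intros r csr) auto
      have "0 \<le> (slope_inf - (zs n)\<^sup>2 + cs n * zs n) / L" for n
        using chi_L_zeroD(4)[OF zs(2)[of n]] L0 by simp
      then show "\<forall>\<^sub>F n in sequentially. 0 \<le> (slope_inf - ((zs \<circ> r) n)\<^sup>2 + (cs \<circ> r) n * (zs \<circ> r) n) / L"
        by simp
    qed simp
    have fin: "K_transform K z c0 < \<infinity>" using le by (simp add: order.strict_trans1)
    have "enn2real (K_transform K z c0) \<le> ?q" using enn2real_mono[OF le] q0 by simp
    then have "L * enn2real (K_transform K z c0) \<le> slope_inf - z\<^sup>2 + c0 * z" using L0 by (simp add: field_simps)
    \<comment> \<open>The limit exponent might a priori be 0; \<open>chi_L_root\<close> accepts this
      and returns a positive root.\<close>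
    then have "\<exists>z>0. chi_L K f L z c0 = 0" using z by (intro chi_L_root[OF fin]) auto
    then show ?thesis by simp
  qed
  moreover have "c_star K f L = c0"
    unfolding c_star_def by (rule Least_equality) (use \<open>c0 \<in> ?C\<close> low in auto)
  ultimately show ?thesis by simp
qed

end

section \<open>Uniqueness of semi-wavefronts\<close>

text \<open>All that the theorem has to extract from \<open>\<gamma>\<close> and
  \<open>c_star\<close> is a point z where \<open>chi_L\<close> is nonpositive and to the right of
  which the transform still converges.\<close>

lemma at_most_one_of_exponent:
  fixes K :: "real \<Rightarrow> real \<Rightarrow> real" and f g :: "real \<Rightarrow> real"
  assumes K: "normalized_kernel K" and H1: "H1 g" and H2: "H2 f g" and H3: "H3 f g"
    and lip: "\<And>s\<^sub>1 s\<^sub>2. 0 \<le> s\<^sub>1 \<Longrightarrow> 0 \<le> s\<^sub>2 \<Longrightarrow> \<bar>g s\<^sub>1 - g s\<^sub>2\<bar> \<le> L * \<bar>s\<^sub>1 - s\<^sub>2\<bar>"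
    and z: "0 < z" "0 < k" "K_transform K (z + k) c < \<infinity>"
    and le: "z\<^sup>2 - c * z - (INF s\<in>{0..}. hderiv f s) + L * enn2real (K_transform K z c) \<le> 0"
  shows "at_most_one_semi_wavefront K f g c"
proof -
  obtain \<alpha> \<delta> where \<alpha>: "0 < \<alpha>" "0 < \<delta>" and hf: "C1_holder_on \<alpha> {0..<\<delta>} f" and hg: "C1_holder_on \<alpha> {0..<\<delta>} g"
    using H3 unfolding H3_def by blast
  have df: "(f has_real_derivative hderiv f 0) (at 0 within {0..})"
    using H2 by (intro hderiv_within) (auto simp: H2_def differentiable_on_def)
  have dg: "(g has_real_derivative hderiv g 0) (at 0 within {0..})"
    using H1 by (intro hderiv_within) (auto simp: H1_def)
  have ma: "(INF s\<in>{0..}. hderiv f s) \<le> hderiv f 0"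
    using H2_hderiv_nonneg[OF H2] by (intro cINF_lower bdd_belowI2[where m = 0]) auto
  have bL: "hderiv g 0 \<le> L" by (rule H1_slope_le_lipschitz[OF H1 lip])
  interpret fm: finite_measure "kernel_law K c" by (rule finite_measure_kernel[OF K])
  interpret wave "kernel_law K c" c "hderiv f 0" "hderiv g 0" "INF s\<in>{0..}. hderiv f s" L \<alpha> f g
  proof unfold_locales
    show "measure (kernel_law K c) UNIV = 1" "measure (kernel_law K c) {0} = 0"
      using measure_kernel_law[OF K] measure_kernel_law_0[OF K] by auto
    show "0 < \<alpha>" by fact
    show "hderiv f 0 < hderiv g 0" "f 0 = 0" using H2 by (auto simp: H2_def)
    show "0 < hderiv g 0" "g 0 = 0" "continuous_on {0..} g" "\<And>s. 0 \<le> s \<Longrightarrow> 0 \<le> g s"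
      using H1 by (auto simp: H1_def)
    show "\<And>s t. 0 \<le> t \<Longrightarrow> t \<le> s \<Longrightarrow> (INF x\<in>{0..}. hderiv f x) * (s - t) \<le> f s - f t"
      by (rule H2_lower_slope[OF H2])
    show "\<exists>C. \<forall>s\<in>{0..B}. \<forall>t\<in>{0..B}. \<bar>f s - f t - hderiv f 0 * (s - t)\<bar> \<le> C * max s t powr \<alpha> * \<bar>s - t\<bar>" for B
    proof -
      obtain \<Lambda> where "\<And>s t. s \<in> {0..B} \<Longrightarrow> t \<in> {0..B} \<Longrightarrow> \<bar>f s - f t\<bar> \<le> \<Lambda> * \<bar>s - t\<bar>" using H2_lipschitz[OF H2] by metis
      then show ?thesis by (rule hoelder_linearization[OF hf \<alpha> df])
    qed
    show "\<exists>C. \<forall>s\<in>{0..B}. \<forall>t\<in>{0..B}. \<bar>g s - g t - hderiv g 0 * (s - t)\<bar> \<le> C * max s t powr \<alpha> * \<bar>s - t\<bar>" for B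
      by (rule hoelder_linearization[OF hg \<alpha> dg]) (auto intro: lip)
  qed (use ma bL lip in auto)
  have fin: "fin (z + k)" using z(3) K_transform_finite_iff[OF K] by blast
  have "fin z" using z by (intro fin_mono[OF fin]) auto
  then have chi: "chi (INF s\<in>{0..}. hderiv f s) L z \<le> 0"
    using le K_transform_eq[OF K] T_nonneg[of z] by (simp add: chi_def T_def)
  have wf: "wavefront \<phi>" if "semi_wavefront_profile K f g c \<phi>" for \<phi>
  proof -
    from that have pos: "\<And>t. 0 < \<phi> t" and bdd: "bounded (range \<phi>)" and cont: "continuous_on UNIV \<phi>"
      and lim: "(\<phi> \<longlongrightarrow> 0) at_bot" and eq: "solves_equation K f g (\<lambda>t x. \<phi> (x + c * t))"
      unfolding semi_wavefront_profile_def by auto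
    from bdd obtain B where "\<And>t. \<bar>\<phi> t\<bar> \<le> B" by (auto simp: bounded_iff)
    then have B: "\<phi> t \<le> B" for t by (meson abs_le_D1)
    obtain u_t u_x u_xx where eq: "\<And>t x.
        ((\<lambda>\<tau>. \<phi> (x + c * \<tau>)) has_real_derivative u_t t x) (at t) \<and>
        ((\<lambda>y. \<phi> (y + c * t)) has_real_derivative u_x t x) (at x) \<and>
        ((\<lambda>y. u_x t y) has_real_derivative u_xx t x) (at x) \<and>
        u_t t x = u_xx t x - f (\<phi> (x + c * t)) + (LBINT s:{0..}. (LBINT w. K s w * g (\<phi> (x - w + c * (t - s)))))"
      using eq unfolding solves_equation_def by blast
    \<comment> \<open>At time 0 the solution is \<open>\<phi>\<close> itself, so its derivatives in
      x are those of the profile, and the chain rule expresses \<open>u_t\<close> through the first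
      of them.\<close>
    have d1: "(\<phi> has_real_derivative u_x 0 x) (at x)" and d2: "(u_x 0 has_real_derivative u_xx 0 x) (at x)" for x
      using eq[where t = 0 and x = x] by auto
    have ut: "u_t 0 x = c * u_x 0 x" for x
    proof (rule DERIV_unique)
      show "((\<lambda>\<tau>. \<phi> (x + c * \<tau>)) has_real_derivative u_t 0 x) (at 0)" using eq[where t = 0 and x = x] by blast
      have "((\<lambda>\<tau>. x + c * \<tau>) has_real_derivative c) (at 0)" by (auto intro!: derivative_eq_intros)
      from DERIV_chain2[where f = \<phi>, OF _ this, of "u_x 0 x"] d1[of x]
      show "((\<lambda>\<tau>. \<phi> (x + c * \<tau>)) has_real_derivative c * u_x 0 x) (at 0)" by (simp add: mult.commute)
    qed
    have gm: "(\<lambda>t. g (\<phi> t)) \<in> borel_measurable borel"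
      using pos by (intro borel_measurable_continuous_onI continuous_on_compose2[OF g_cont cont]) (auto simp: less_imp_le)
    have gb: "\<bar>g (\<phi> t)\<bar> \<le> L * B" for t
    proof -
      have "\<bar>g (\<phi> t) - g 0\<bar> \<le> L * \<bar>\<phi> t - 0\<bar>" using pos[of t] by (intro lip) auto
      also have "\<dots> \<le> L * B" using pos[of t] B[of t] Lb ab by (intro mult_left_mono) auto
      finally show ?thesis by (simp add: g0)
    qed
    have conv: "(LBINT s:{0..}. (LBINT w. K s w * g (\<phi> (x - w + c * (0 - s))))) = (\<integral>v. g (\<phi> (x - v)) \<partial>kernel_law K c)" for x
    proof -
      have "(\<lambda>v. g (\<phi> (x - v))) \<in> borel_measurable borel"
        by (rule measurable_compose[OF _ gm]) simp
      from integral_kernel_law[OF K this gb, of c]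
      have law: "(LBINT s:{0..}. (LBINT w. K s w * g (\<phi> (x - (c * s + w))))) = (\<integral>v. g (\<phi> (x - v)) \<partial>kernel_law K c)" .
      have "x - w + c * (0 - s) = x - (c * s + w)" for s w by simp
      then show ?thesis by (simp only: law)
    qed
    have "u_xx 0 x - c * u_x 0 x - f (\<phi> x) + (\<integral>v. g (\<phi> (x - v)) \<partial>kernel_law K c) = 0" for x
    proof -
      have "u_t 0 x = u_xx 0 x - f (\<phi> x) + (LBINT s:{0..}. (LBINT w. K s w * g (\<phi> (x - w + c * (0 - s)))))"
        using eq[where t = 0 and x = x] by (simp only: mult_zero_right add_0_right)
      then show ?thesis unfolding conv ut by simp
    qed
    then have "sol \<phi> (u_x 0) (u_xx 0)"
      unfolding sol_def using d1 d2 pos B by (auto simp: less_imp_le)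
    with pos lim show ?thesis unfolding wavefront_def by blast
  qed
  show ?thesis
    unfolding at_most_one_semi_wavefront_def using wavefront_unique[OF z(1,2) fin chi wf wf] by blast
qed

theorem theorem1p1:
  fixes K :: "real \<Rightarrow> real \<Rightarrow> real" and f g :: "real \<Rightarrow> real"
    and L :: real and \<gamma> :: "real \<Rightarrow> ereal"
  assumes "normalized_kernel K" and "H1 g" and "H2 f g" and "H3 f g"
    and "\<And>c. 0 < \<gamma> c"
    and "\<And>c z. 0 \<le> z \<Longrightarrow> ereal z < \<gamma> c \<Longrightarrow> chi_0 K f g z c < \<infinity>"
    and "\<And>c z. \<gamma> c < ereal z \<Longrightarrow> chi_0 K f g z c = \<infinity>"
    and "0 < L"
    and "\<And>s\<^sub>1 s\<^sub>2. 0 \<le> s\<^sub>1 \<Longrightarrow> 0 \<le> s\<^sub>2 \<Longrightarrow> \<bar>g s\<^sub>1 - g s\<^sub>2\<bar> \<le> L * \<bar>s\<^sub>1 - s\<^sub>2\<bar>"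
  shows "(chi_L_left K f L (\<gamma> (c_star K f L)) (c_star K f L) = 0 \<longrightarrow>
            (\<forall>c > c_star K f L. at_most_one_semi_wavefront K f g c)) \<and>
         (chi_L_left K f L (\<gamma> (c_star K f L)) (c_star K f L) \<noteq> 0 \<longrightarrow>
            (\<forall>c \<ge> c_star K f L. at_most_one_semi_wavefront K f g c))"
proof -
  note K = assms(1) and H1 = assms(2) and H2 = assms(3) and lip = assms(9)
  let ?m = "INF s\<in>{0..}. hderiv f s"
  have m0: "0 \<le> ?m" by (rule cINF_greatest) (use H2_hderiv_nonneg[OF H2] in auto)
  have ma: "?m \<le> hderiv f 0"
    using H2_hderiv_nonneg[OF H2] by (intro cINF_lower bdd_belowI2[where m = 0]) auto
  have b: "hderiv f 0 < hderiv g 0" "0 < hderiv g 0" using H1 H2 by (auto simp: H1_def H2_def)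
  have mL: "?m < L" using ma b H1_slope_le_lipschitz[OF H1 lip] by linarith
  have fin: "K_transform K z c < \<infinity>" if "chi_0 K f g z c < \<infinity>" for z c
    using that b by (cases "K_transform K z c") (auto simp: chi_0_def top.not_eq_extremum)
  have inf: "K_transform K z c = \<infinity>" if "chi_0 K f g z c = \<infinity>" for z c
    using that by (cases "K_transform K z c") (auto simp: chi_0_def)
  note one = at_most_one_of_exponent[OF K H1 H2 assms(4) lip]
  \<comment> \<open>A positive exponent of convergence at speed 0, the starting point for
    \<open>c_star_least\<close>.\<close>
  obtain z0 where z0: "0 < z0" "ereal z0 < \<gamma> 0"
    using ereal_dense2[OF assms(5)[of 0]] by (auto simp: zero_ereal_def)
  define c0 where "c0 = c_star K f L"
  obtain z where z: "0 < z" "chi_L K f L z c0 = 0"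
    using c_star_least[OF K m0 mL z0(1) fin[OF assms(6)[OF less_imp_le[OF z0(1)] z0(2)]]] unfolding c0_def by blast
  have zfin: "K_transform K z c0 < \<infinity>" and zeq: "z\<^sup>2 - c0 * z - ?m + L * enn2real (K_transform K z c0) = 0"
    using chi_L_zeroD[OF K m0 mL z(2)] by blast+
  \<comment> \<open>A speed above \<open>c0\<close> makes \<open>chi_L\<close> strictly negative at
    z, hence also slightly to the left of z. Moving there creates the room of convergence even if z
    is the abscissa of convergence at \<open>c0\<close>.\<close>
  have above: "at_most_one_semi_wavefront K f g c" if c: "c0 < c" for c
  proof -
    let ?h = "\<lambda>x. x\<^sup>2 - c * x - ?m + L * enn2real (K_transform K x c)"
    have le: "K_transform K z c \<le> K_transform K z c0" using z c by (intro K_transform_mono_speed[OF K]) auto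
    from le zfin have fz: "K_transform K z c < \<infinity>" by (rule order.strict_trans1)
    have "L * enn2real (K_transform K z c) \<le> L * enn2real (K_transform K z c0)"
      using le zfin assms(8) by (intro mult_left_mono enn2real_mono) auto
    moreover have "c0 * z < c * z" using c z by simp
    ultimately have neg: "?h z < 0" using zeq by linarith
    have "continuous_on {0..z} ?h" using z by (intro chi_L_continuous[OF K m0 mL fz]) simp
    then have "(?h \<longlongrightarrow> ?h z) (at z within {0..z})" using z by (simp add: continuous_on_def)
    then have "(?h \<longlongrightarrow> ?h z) (at_left z)"
      using z by (simp add: at_within_Icc_at_left)
    from order_tendstoD(2)[OF this neg] obtain y where y: "y < z" "\<And>x. y < x \<Longrightarrow> x < z \<Longrightarrow> ?h x < 0"
      by (auto simp: eventually_at_left_field)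
    define x where "x = (max y 0 + z) / 2"
    have x: "y < x" "0 < x" "x < z" using y(1) z(1) by (auto simp: x_def)
    show ?thesis
      by (rule one[of x "z - x"]) (use x y(2)[of x] fz in auto)
  qed
  \<comment> \<open>At \<open>c0\<close> the root z itself is used, so it must lie strictly below
    \<open>\<gamma> c0\<close>. Beyond \<open>\<gamma> c0\<close> the transform diverges, and at z =
    \<open>\<gamma> c0\<close> left continuity would give \<open>chi_L_left\<close> the excluded
    value 0.\<close>
  have at: "at_most_one_semi_wavefront K f g c0" if ne: "chi_L_left K f L (\<gamma> c0) c0 \<noteq> 0"
  proof -
    have "\<not> \<gamma> c0 < ereal z"
    proof
      assume "\<gamma> c0 < ereal z"
      from inf[OF assms(7)[OF this]] zfin show False by simp
    qed
    moreover have "\<gamma> c0 \<noteq> ereal z"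
    proof
      assume eq: "\<gamma> c0 = ereal z"
      let ?h = "\<lambda>x. x\<^sup>2 - c0 * x - ?m + L * enn2real (K_transform K x c0)"
      have "continuous_on {0..z} ?h" using z by (intro chi_L_continuous[OF K m0 mL zfin]) simp
      then have "(?h \<longlongrightarrow> ?h z) (at z within {0..z})" using z by (simp add: continuous_on_def)
      then have "(?h \<longlongrightarrow> 0) (at_left z)"
        using z zeq by (simp add: at_within_Icc_at_left)
      then have lim: "((\<lambda>x. ereal (?h x)) \<longlongrightarrow> ereal 0) (at_left z)" by (rule tendsto_ereal)
      have "\<forall>\<^sub>F x in at_left z. ereal (?h x) = chi_L K f L x c0"
        using eventually_at_left_real[OF z(1)]
      proof eventually_elim
        case (elim x)
        then have "K_transform K x c0 < \<infinity>" using z by (intro chi_L_continuous(2)[OF K m0 mL zfin]) auto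
        then show ?case using chi_L_eq[OF K m0 mL] by simp
      qed
      from Lim_transform_eventually[OF lim this]
      have "((\<lambda>x. chi_L K f L x c0) \<longlongrightarrow> 0) (at_left z)" by (simp only: zero_ereal_def)
      then have "((\<lambda>x. chi_L K f L (real_of_ereal x) c0) \<longlongrightarrow> 0) (at_left (ereal z))"
        by (simp add: at_left_ereal filterlim_filtermap)
      moreover have "at_left (ereal z) \<noteq> bot" by (simp add: at_left_ereal filtermap_bot_iff)
      ultimately have "chi_L_left K f L (\<gamma> c0) c0 = 0"
        unfolding chi_L_left_def eq by (intro tendsto_Lim)
      with ne show False by simp
    qed
    ultimately have "ereal z < \<gamma> c0" by (simp only: not_less order.strict_iff_order) simp
    then obtain z1 where z1: "ereal z < ereal z1" "ereal z1 < \<gamma> c0" using ereal_dense2 by blast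
    then have "K_transform K z1 c0 < \<infinity>" using z by (intro fin assms(6)) auto
    then show ?thesis using z1 z zeq by (intro one[of z "z1 - z"]) auto
  qed
  show ?thesis
    unfolding c0_def[symmetric]
  proof (intro conjI impI allI)
    show "at_most_one_semi_wavefront K f g c" if "c0 < c" for c by (rule above[OF that])
    show "at_most_one_semi_wavefront K f g c" if "chi_L_left K f L (\<gamma> c0) c0 \<noteq> 0" "c0 \<le> c" for c
      using above[of c] at[OF that(1)] that(2) by (cases "c = c0") auto
  qed
qed

end
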